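(* Let $X,Y$ be Polish spaces equipped with Borel probability measures $\mu,\nu$ respectively, and let $c: X\times Y \to [0,\infty]$ be a Borel measurable cost function. (a) Every finite optimal transport plan is $c$-monotone. (b) Every finite $c$-monotone transport plan is optimal if there exist a closed set $F\subseteq X\times Y$ and a $\mu\otimes\nu$-null set $N\subseteq X\times Y$ such that $\{(x,y)\in X\times Y: c(x,y)=\infty\} = F\cup N$.
   Context: A transport plan is an element of $\Pi(\mu,\nu)$, the set of all Borel probability measures on $X\times Y$ with $X$-marginal $\mu$ and $Y$-marginal $\nu$. For $\pi\in\Pi(\mu,\nu)$ the transport cost is $I_c[\pi]:=\int_{X\times Y} c(x,y)\, d\pi\in[0,\infty]$. A transport plan $\pi$ is finite if $I_c[\pi]<\infty$. A transport plan is optimal if it minimizes $I_c[\cdot]$ over $\Pi(\mu,\nu)$. A Borel set $\Gamma\subseteq X\times Y$ is $c$-monotone if for every $n\in\mathbb{N}$ and all pairs $(x_1,y_1),\dots,(x_n,y_n)\in\Gamma$ one has $\sum_{i=1}^n c(x_i,y_i)\le\sum_{i=1}^n c(x_i,y_{i+1})$, with the convention $y_{n+1}:=y_1$. A transport plan $\pi$ is $c$-monotone if there exists a $c$-monotone (Borel) set $\Gamma$ with $\pi(\Gamma)=1$. *)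

theory Defs
  imports "HOL-Probability.Probability"
begin

definition transport_plans ::
  "'a::polish_space measure \<Rightarrow> 'b::polish_space measure \<Rightarrow> ('a \<times> 'b) measure set" where
  "transport_plans \<mu> \<nu> =
    {\<pi>. prob_space \<pi> \<and> sets \<pi> = sets borel \<and> distr \<pi> borel fst = \<mu> \<and> distr \<pi> borel snd = \<nu>}"

definition transport_cost :: "('a \<times> 'b \<Rightarrow> ennreal) \<Rightarrow> ('a \<times> 'b) measure \<Rightarrow> ennreal" where
  "transport_cost c \<pi> = (\<integral>\<^sup>+ z. c z \<partial>\<pi>)"

definition finite_plan ::
  "'a::polish_space measure \<Rightarrow> 'b::polish_space measure \<Rightarrow> ('a \<times> 'b \<Rightarrow> ennreal) \<Rightarrow> ('a \<times> 'b) measure \<Rightarrow> bool" where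
  "finite_plan \<mu> \<nu> c \<pi> \<longleftrightarrow> \<pi> \<in> transport_plans \<mu> \<nu> \<and> transport_cost c \<pi> < \<infinity>"

definition optimal_plan ::
  "'a::polish_space measure \<Rightarrow> 'b::polish_space measure \<Rightarrow> ('a \<times> 'b \<Rightarrow> ennreal) \<Rightarrow> ('a \<times> 'b) measure \<Rightarrow> bool" where
  "optimal_plan \<mu> \<nu> c \<pi> \<longleftrightarrow> \<pi> \<in> transport_plans \<mu> \<nu> \<and>
    (\<forall>\<pi>'\<in>transport_plans \<mu> \<nu>. transport_cost c \<pi> \<le> transport_cost c \<pi>')"

text \<open>The points are indexed by \<open>0, \<dots>, n - 1\<close>, so the convention that the successor of the
  last index is the first one becomes addition modulo \<open>n\<close>.\<close>

definition c_monotone_set ::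
  "('a::polish_space \<times> 'b::polish_space \<Rightarrow> ennreal) \<Rightarrow> ('a \<times> 'b) set \<Rightarrow> bool" where
  "c_monotone_set c \<Gamma> \<longleftrightarrow> \<Gamma> \<in> sets borel \<and>
    (\<forall>(n::nat) (x::nat \<Rightarrow> 'a) (y::nat \<Rightarrow> 'b). (\<forall>i<n. (x i, y i) \<in> \<Gamma>) \<longrightarrow>
      (\<Sum>i<n. c (x i, y i)) \<le> (\<Sum>i<n. c (x i, y (Suc i mod n))))"

definition c_monotone_plan ::
  "'a::polish_space measure \<Rightarrow> 'b::polish_space measure \<Rightarrow> ('a \<times> 'b \<Rightarrow> ennreal) \<Rightarrow> ('a \<times> 'b) measure \<Rightarrow> bool" where
  "c_monotone_plan \<mu> \<nu> c \<pi> \<longleftrightarrow> \<pi> \<in> transport_plans \<mu> \<nu> \<and>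
    (\<exists>\<Gamma>. c_monotone_set c \<Gamma> \<and> emeasure \<pi> \<Gamma> = 1)"

end

theory Submission
  imports Defs "HOL-Complex_Analysis.Great_Picard"
begin

text \<open>(a) By a special case of Kellerer's theorem, either all violating \<open>n\<close>-cycles meet one
  \<open>\<pi>\<close>-null set, which can then be discarded, or the set of these cycles carries a nonzero measure whose
  marginals sum up to at most \<open>\<pi>\<close>; shifting the second coordinates along the cycles makes \<open>\<pi>\<close> cheaper. The dichotomy is proved on the Cantor space, to which Polish spaces
  are transferred by a Borel coding: the cost of fractionally covering a set is continuous along increasing
  unions (an \<open>L\<^sup>2\<close> argument), so a capacitability argument reduces analytic sets to compact ones, where
  greedy packings on finite partitions converge to the required measure.

  (b) Given a competitor \<open>\<pi>'\<close>, take a stationary chain \<open>(x\<^sub>i, y\<^sub>i)\<close> in which every \<open>(x\<^sub>i, y\<^sub>i)\<close> has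
  law \<open>\<pi>\<close> and every \<open>(x\<^sub>i, y\<^sub>i\<^sub>+\<^sub>1)\<close> has law \<open>\<pi>'\<close>. Closing up the path of length \<open>n\<close> to a cycle gives
  \<open>\<Sum>i<n. c (x\<^sub>i, y\<^sub>i) \<le> \<Sum>i<n. c (x\<^sub>i, y\<^sub>i\<^sub>+\<^sub>1) + error\<close>. If the errors are tight in \<open>n\<close>, then taking
  expectations and dividing by \<open>n\<close> yields the claim. Outside the closed set \<open>F\<close> countably many open rectangles
  cover everything, and the cost is finite almost everywhere on each of them; stationarity prevents the chain
  from leaving a class of mutually reachable rectangles, so the cycle can be closed through fixed points of the
  rectangles, at an error that depends only on the two end points.\<close>

section \<open>Measures on the Cantor space\<close>

text \<open>The first alternative of the dichotomy asks for a null set meeting every cycle, and such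
  sets are not stable under averaging. Functions with values in [0, 1] are: almost optimal covers
  can then be averaged, limits of them exist, and an unreachable cost level \<alpha> > 0 survives
  every truncation. A packing that cannot be enlarged is within a factor n of the linear programming
  optimum, and that suffices because only a nonzero measure is wanted. In the Cantor space the
  cylinders are clopen and countably many, so limits of discrete measures come from a diagonal
  subsequence; the chain in (b) is built by the same device from discrete conditional laws. Infinite
  values of c are harmless in (a), because a violating cycle has finite shifted cost by strictness.
  In (b) closedness of F enters through rectangles: two points of a rectangle disjoint from F can
  exchange second coordinates without leaving it, so that infinite cost can only come from
  N.\<close>

instance bool :: second_countable_topology
proof
  show "\<exists>B::bool set set. countable B \<and> open = generate_topology B"
    by (rule exI[of _ UNIV]) (auto simp: fun_eq_iff intro: generate_topology.Basis Topological_Spaces.open_discrete)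
qed

text \<open>Allows the coding of Polish spaces to be applied to \<open>'a \<times> 'b\<close>, whose
  points are the links of a cycle.\<close>

instance prod :: (polish_space, polish_space) polish_space ..

lemma sets_borel_bool: "sets (borel :: bool measure) = UNIV"
proof -
  have "A \<in> sets borel" for A :: "bool set"
    by (rule borel_open[OF Topological_Spaces.open_discrete])
  then show ?thesis by auto
qed

lemma compact_UNIV_fun_bool: "compact (UNIV :: ('i \<Rightarrow> bool) set)"
proof -
  have "compact_space (product_topology (\<lambda>_::'i. euclidean :: bool topology) UNIV)"
    unfolding compact_space_product_topology by (simp add: compact_space_def finite_imp_compact)
  then show ?thesis
    by (simp add: compact_space_def euclidean_product_topology)
qed

definition cylinder :: "'i set \<Rightarrow> 'i set set \<Rightarrow> ('i \<Rightarrow> bool) set" where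
  "cylinder I S = {w. {i\<in>I. w i} \<in> S}"

definition cylinders :: "('i \<Rightarrow> bool) set set" where
  "cylinders = {cylinder I S | I S. finite I}"

lemma cylinders_iff:
  "C \<in> cylinders \<longleftrightarrow> (\<exists>I. finite I \<and> (\<forall>w w'. (\<forall>i\<in>I. w i = w' i) \<longrightarrow> w \<in> C \<longrightarrow> w' \<in> C))"
proof
  assume "C \<in> cylinders"
  then obtain I S where *: "finite I" "C = cylinder I S" by (auto simp: cylinders_def)
  have "w' \<in> C" if "\<forall>i\<in>I. w i = w' i" "w \<in> C" for w w'
  proof -
    have "{i\<in>I. w i} = {i\<in>I. w' i}" using that by auto
    then show ?thesis using that * by (simp add: cylinder_def)
  qed
  with * show "\<exists>I. finite I \<and> (\<forall>w w'. (\<forall>i\<in>I. w i = w' i) \<longrightarrow> w \<in> C \<longrightarrow> w' \<in> C)" by blast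
next
  assume "\<exists>I. finite I \<and> (\<forall>w w'. (\<forall>i\<in>I. w i = w' i) \<longrightarrow> w \<in> C \<longrightarrow> w' \<in> C)"
  then obtain I where I: "finite I" "\<And>w w'. (\<forall>i\<in>I. w i = w' i) \<Longrightarrow> w \<in> C \<Longrightarrow> w' \<in> C" by blast
  have "C = cylinder I ((\<lambda>w. {i\<in>I. w i}) ` C)"
  proof (auto simp: cylinder_def)
    fix w w' assume "{i \<in> I. w i} = {i \<in> I. w' i}" "w' \<in> C"
    then show "w \<in> C" using I(2)[of w' w] by blast
  qed
  then show "C \<in> cylinders" using I(1) unfolding cylinders_def by blast
qed

lemma cylindersI:
  assumes "finite I" "\<And>w w'. (\<And>i. i \<in> I \<Longrightarrow> w i = w' i) \<Longrightarrow> w \<in> C \<Longrightarrow> w' \<in> C"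
  shows "C \<in> cylinders"
  using assms unfolding cylinders_iff by blast

lemma cylindersE:
  assumes "C \<in> cylinders"
  obtains I where "finite I" "\<And>w w'. (\<And>i. i \<in> I \<Longrightarrow> w i = w' i) \<Longrightarrow> w \<in> C \<longleftrightarrow> w' \<in> C"
  using assms unfolding cylinders_iff by metis

text \<open>Only the patterns inside a finite \<open>I\<close> matter. Countability is what permits
  the diagonal subsequence in \<open>cylinder_limit_measure\<close>.\<close>

lemma countable_cylinders: "countable (cylinders :: ('i::countable \<Rightarrow> bool) set set)"
proof -
  have eq: "cylinder I S = cylinder I (S \<inter> Pow I)" for I :: "'i set" and S
    by (auto simp: cylinder_def)
  have "cylinders = (\<Union>I\<in>{I :: 'i set. finite I}. cylinder I ` Pow (Pow I))"
  proof (intro set_eqI iffI)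
    fix C :: "('i \<Rightarrow> bool) set" assume "C \<in> cylinders"
    then obtain I S where "finite I" "C = cylinder I S" by (auto simp: cylinders_def)
    then show "C \<in> (\<Union>I\<in>{I :: 'i set. finite I}. cylinder I ` Pow (Pow I))"
      using eq[of I S] by blast
  qed (auto simp: cylinders_def)
  also have "countable \<dots>"
    by (intro countable_UN countable_Collect_finite countable_image countable_finite) auto
  finally show ?thesis .
qed

lemma algebra_cylinders: "algebra UNIV (cylinders :: ('i \<Rightarrow> bool) set set)"
  unfolding algebra_iff_Un
proof (intro conjI ballI)
  show "{} \<in> (cylinders :: ('i \<Rightarrow> bool) set set)" by (rule cylindersI[of "{}"]) auto
  fix A :: "('i \<Rightarrow> bool) set" assume A: "A \<in> cylinders"
  then obtain I where I: "finite I" "\<And>w w'. (\<And>i. i \<in> I \<Longrightarrow> w i = w' i) \<Longrightarrow> w \<in> A \<longleftrightarrow> w' \<in> A"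
    by (rule cylindersE) blast
  show "UNIV - A \<in> cylinders"
    by (rule cylindersI[OF I(1)]) (use I(2) in blast)
  fix B :: "('i \<Rightarrow> bool) set" assume "B \<in> cylinders"
  then obtain J where J: "finite J" "\<And>w w'. (\<And>i. i \<in> J \<Longrightarrow> w i = w' i) \<Longrightarrow> w \<in> B \<longleftrightarrow> w' \<in> B"
    by (rule cylindersE) blast
  show "A \<union> B \<in> cylinders"
  proof (rule cylindersI[of "I \<union> J"])
    fix w w' assume "\<And>i. i \<in> I \<union> J \<Longrightarrow> w i = w' i" "w \<in> A \<union> B"
    then show "w' \<in> A \<union> B" using I(2)[of w w'] J(2)[of w w'] by simp
  qed (use I J in simp)
qed auto

lemma closed_Collect_coordinate: "closed {w :: 'i \<Rightarrow> bool. w i = b}"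
proof -
  have "closed ((\<lambda>w :: 'i \<Rightarrow> bool. w i) -` {b})"
    by (intro closed_vimage closed_singleton continuous_on_product_coordinates)
  then show ?thesis by (simp add: vimage_def)
qed

lemma closed_cylinder:
  assumes "C \<in> cylinders" shows "closed C"
proof -
  obtain I S where IS: "finite I" "C = cylinder I S" using assms by (auto simp: cylinders_def)
  have "C = (\<Union>T\<in>S \<inter> Pow I. \<Inter>i\<in>I. {w. w i = (i \<in> T)})"
  proof (intro set_eqI iffI)
    fix w assume "w \<in> C"
    then show "w \<in> (\<Union>T\<in>S \<inter> Pow I. \<Inter>i\<in>I. {w. w i = (i \<in> T)})"
      by (auto simp: IS(2) cylinder_def intro!: bexI[of _ "{i\<in>I. w i}"])
  next
    fix w assume "w \<in> (\<Union>T\<in>S \<inter> Pow I. \<Inter>i\<in>I. {w. w i = (i \<in> T)})"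
    then obtain T where T: "T \<in> S" "T \<subseteq> I" "\<And>i. i \<in> I \<Longrightarrow> w i = (i \<in> T)" by auto
    then have "{i\<in>I. w i} = T" by auto
    with T show "w \<in> C" by (simp add: IS(2) cylinder_def)
  qed
  also have "closed \<dots>"
    using IS(1) by (intro closed_UN closed_INT finite_Int ballI closed_Collect_coordinate) auto
  finally show ?thesis .
qed

lemma cylinder_Compl: "C \<in> cylinders \<Longrightarrow> - C \<in> cylinders"
  using algebra.compl_sets[OF algebra_cylinders] by (simp add: Compl_eq_Diff_UNIV)

lemma cylinder_Int: "C \<in> cylinders \<Longrightarrow> D \<in> cylinders \<Longrightarrow> C \<inter> D \<in> cylinders"
  using algebra_cylinders unfolding algebra_iff_Int by blast

lemma open_cylinder: "C \<in> cylinders \<Longrightarrow> open C"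
  using closed_cylinder[OF cylinder_Compl] by (simp add: closed_def)

lemma cylinder_coordinate: "{w. w i} \<in> cylinders"
  by (rule cylindersI[of "{i}"]) auto

lemma sets_borel_fun_bool:
  "sets (borel :: ('i::countable \<Rightarrow> bool) measure) = sigma_sets UNIV cylinders"
proof
  show "sigma_sets UNIV cylinders \<subseteq> sets (borel :: ('i \<Rightarrow> bool) measure)"
    by (intro sets.sigma_sets_subset') (auto intro: open_cylinder borel_open)
  have "id \<in> sigma UNIV cylinders \<rightarrow>\<^sub>M (borel :: ('i \<Rightarrow> bool) measure)"
  proof (rule measurable_coordinatewise_then_product)
    fix i :: 'i
    have "{w. w i} \<in> sets (sigma UNIV cylinders)"
      using cylinder_coordinate[of i] by auto
    moreover have "{w. w i} = {w \<in> space (sigma UNIV (cylinders :: ('i \<Rightarrow> bool) set set)). id w i}"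
      by auto
    ultimately have "(\<lambda>w. id w i) \<in> sigma UNIV cylinders \<rightarrow>\<^sub>M (count_space UNIV :: bool measure)"
      by (simp only: pred_def)
    then show "(\<lambda>w. id w i) \<in> sigma UNIV cylinders \<rightarrow>\<^sub>M (borel :: bool measure)"
      by (subst measurable_cong_sets[OF refl, of _ "count_space UNIV"]) (simp_all add: sets_borel_bool)
  qed
  then show "sets (borel :: ('i \<Rightarrow> bool) measure) \<subseteq> sigma_sets UNIV cylinders"
    by (auto dest!: measurable_sets)
qed

lemma cylinder_in_borel [intro]: "C \<in> cylinders \<Longrightarrow> C \<in> sets (borel :: ('i::countable \<Rightarrow> bool) measure)"
  by (simp add: open_cylinder)

lemma cylinder_neighbourhood_exists:
  fixes U :: "('i::countable \<Rightarrow> bool) set"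
  assumes "open U" "w \<in> U"
  obtains C where "C \<in> cylinders" "w \<in> C" "C \<subseteq> U"
proof -
  have "openin (product_topology (\<lambda>_::'i. euclidean :: bool topology) UNIV) U"
    using assms(1) by (simp add: euclidean_product_topology)
  then obtain X where X: "w \<in> Pi\<^sub>E UNIV X" "finite {i. X i \<noteq> UNIV}" "Pi\<^sub>E UNIV X \<subseteq> U"
    using assms(2) product_topology_open_contains_basis[of "\<lambda>_. euclidean" UNIV U w] by auto
  have "Pi\<^sub>E UNIV X \<in> cylinders"
  proof (rule cylindersI[OF X(2)])
    fix v v' assume *: "\<And>i. i \<in> {i. X i \<noteq> UNIV} \<Longrightarrow> v i = v' i" "v \<in> Pi\<^sub>E UNIV X"
    have "v' i \<in> X i" for i
      using *(1)[of i] PiE_mem[OF *(2), of i] by (cases "X i = UNIV") simp_all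
    then show "v' \<in> Pi\<^sub>E UNIV X" by (simp add: PiE_iff)
  qed
  then show ?thesis using X that by blast
qed

text \<open>By compactness a finitely additive set function on the cylinders is automatically
  continuous at the empty set.\<close>

lemma cylinder_premeasure_extends:
  fixes f :: "('i::countable \<Rightarrow> bool) set \<Rightarrow> real"
  assumes nonneg: "\<And>C. C \<in> cylinders \<Longrightarrow> f C \<ge> 0"
    and add: "\<And>C D. C \<in> cylinders \<Longrightarrow> D \<in> cylinders \<Longrightarrow> C \<inter> D = {} \<Longrightarrow> f (C \<union> D) = f C + f D"
  obtains M where "sets M = sets borel" "\<And>C. C \<in> cylinders \<Longrightarrow> emeasure M C = ennreal (f C)"
proof -
  interpret algebra UNIV "cylinders :: ('i \<Rightarrow> bool) set set" by (rule algebra_cylinders)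
  have f0: "f {} = 0" using add[of "{}" "{}"] by simp
  have "\<exists>\<mu>. (\<forall>s\<in>cylinders. \<mu> s = ennreal (f s)) \<and> measure_space UNIV (sigma_sets UNIV cylinders) \<mu>"
  proof (rule caratheodory_empty_continuous)
    show "positive cylinders (\<lambda>s. ennreal (f s))" by (simp add: positive_def f0)
    show "additive cylinders (\<lambda>s. ennreal (f s))"
      by (auto simp: additive_def add nonneg ennreal_plus[symmetric] simp del: ennreal_plus)
    fix A :: "nat \<Rightarrow> ('i \<Rightarrow> bool) set"
    assume A: "range A \<subseteq> cylinders" "decseq A" "(\<Inter>i. A i) = {}"
    have "\<exists>n. A n = {}"
    proof (rule ccontr)
      assume "\<nexists>n. A n = {}"
      have "UNIV \<inter> \<Inter>(range A) \<noteq> {}"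
      proof (rule compact_imp_fip[OF compact_UNIV_fun_bool])
        fix F assume F: "finite F" "F \<subseteq> range A"
        then obtain J where J: "finite J" "F = A ` J" by (meson finite_subset_image)
        have "A (Max (insert 0 J)) \<subseteq> A j" if "j \<in> J" for j
          using J that by (intro decseqD[OF A(2)] Max_ge) auto
        then have "A (Max (insert 0 J)) \<subseteq> \<Inter>F"
          using J(2) by auto
        then show "UNIV \<inter> \<Inter>F \<noteq> {}" using \<open>\<nexists>n. A n = {}\<close> by blast
      next
        fix T assume "T \<in> range A"
        then show "closed T" using A(1) closed_cylinder by blast
      qed
      then show False using A(3) by simp
    qed
    then obtain n where n: "A n = {}" by auto
    have "eventually (\<lambda>i. ennreal (f (A i)) = 0) sequentially"
      using eventually_ge_at_top[of n]
    proof eventually_elim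
      case (elim i)
      then have "A i = {}" using decseqD[OF A(2) elim] n by blast
      then show ?case by (simp add: f0)
    qed
    then show "(\<lambda>i. ennreal (f (A i))) \<longlonglongrightarrow> 0" by (rule tendsto_eventually)
  qed auto
  then obtain \<mu> where mu: "\<And>s. s\<in>cylinders \<Longrightarrow> \<mu> s = ennreal (f s)"
    "measure_space UNIV (sigma_sets UNIV cylinders) \<mu>" by blast
  have "cylinders \<subseteq> Pow (UNIV :: ('i \<Rightarrow> bool) set)" by auto
  let ?M = "measure_of UNIV cylinders \<mu>"
  have "emeasure ?M C = ennreal (f C)" if "C \<in> cylinders" for C
    using that mu by (subst emeasure_measure_of[OF refl]) (auto simp: measure_space_def)
  moreover have "sets ?M = sets borel" by (simp add: sets_borel_fun_bool)
  ultimately show ?thesis using that by blast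
qed

text \<open>Helly selection: a diagonal subsequence converges on all cylinders, the limit is again
  finitely additive, and \<open>cylinder_premeasure_extends\<close> turns it into a measure.\<close>

lemma cylinder_limit_measure:
  fixes \<eta> :: "nat \<Rightarrow> ('i::countable \<Rightarrow> bool) set \<Rightarrow> real"
  assumes nonneg: "\<And>m C. C \<in> cylinders \<Longrightarrow> \<eta> m C \<ge> 0"
    and bound: "\<And>m C. C \<in> cylinders \<Longrightarrow> \<eta> m C \<le> b"
    and add: "\<And>m C D. C \<in> cylinders \<Longrightarrow> D \<in> cylinders \<Longrightarrow> C \<inter> D = {} \<Longrightarrow> \<eta> m (C \<union> D) = \<eta> m C + \<eta> m D"
  obtains M r where "sets M = sets borel" "finite_measure M" "strict_mono (r :: nat \<Rightarrow> nat)"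
    "\<And>C. C \<in> cylinders \<Longrightarrow> (\<lambda>k. \<eta> (r k) C) \<longlonglongrightarrow> measure M C"
proof -
  interpret algebra UNIV "cylinders :: ('i \<Rightarrow> bool) set set" by (rule algebra_cylinders)
  have "norm (\<eta> m C) \<le> b" if "C \<in> cylinders" for m C
    using nonneg[OF that] bound[OF that] by simp
  then obtain r :: "nat \<Rightarrow> nat" where r: "strict_mono r"
    "\<And>C. C \<in> cylinders \<Longrightarrow> \<exists>l. (\<lambda>k. \<eta> (r k) C) \<longlonglongrightarrow> l"
    by (rule function_convergent_subsequence[OF countable_cylinders, of \<eta> b]) auto
  define f where "f C = lim (\<lambda>k. \<eta> (r k) C)" for C
  have lim: "(\<lambda>k. \<eta> (r k) C) \<longlonglongrightarrow> f C" if "C \<in> cylinders" for C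
    using r(2)[OF that] unfolding f_def by (metis limI)
  have pos: "f C \<ge> 0" if "C \<in> cylinders" for C
    using LIMSEQ_le_const[OF lim[OF that]] nonneg[OF that] by blast
  have f_Un: "f (C \<union> D) = f C + f D" if "C \<in> cylinders" "D \<in> cylinders" "C \<inter> D = {}" for C D
  proof (rule LIMSEQ_unique)
    show "(\<lambda>k. \<eta> (r k) (C \<union> D)) \<longlonglongrightarrow> f (C \<union> D)" using that by (intro lim) auto
    show "(\<lambda>k. \<eta> (r k) (C \<union> D)) \<longlonglongrightarrow> f C + f D"
      using tendsto_add[OF lim lim, OF that(1,2)] by (simp add: add[OF that])
  qed
  obtain M where M: "sets M = sets borel" "\<And>C. C \<in> cylinders \<Longrightarrow> emeasure M C = ennreal (f C)"
    using cylinder_premeasure_extends[of f] pos f_Un by metis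
  have "space M = UNIV" using sets_eq_imp_space_eq[OF M(1)] by simp
  then have "finite_measure M"
    using M(2)[OF top] by (intro finite_measureI) simp
  moreover have "measure M C = f C" if "C \<in> cylinders" for C
    using M(2)[OF that] pos[OF that] by (simp add: measure_def)
  ultimately show ?thesis using that[OF M(1) _ r(1)] lim by simp
qed

section \<open>Fractional covers\<close>

text \<open>Functions almost minimising the \<open>L\<^sup>2\<close> norm in the sets \<open>G k\<close> form, along a subsequence,
  a fast Cauchy sequence by the parallelogram identity.\<close>

lemma decseq_midpoint_convex_AE_convergent:
  fixes G :: "nat \<Rightarrow> ('a \<Rightarrow> real) set"
  assumes "prob_space M"
    and nonempty: "\<And>k. G k \<noteq> {}" and dec: "decseq G"
    and meas: "\<And>k f. f \<in> G k \<Longrightarrow> f \<in> borel_measurable M"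
    and bounds: "\<And>k f x. f \<in> G k \<Longrightarrow> 0 \<le> f x \<and> f x \<le> 1"
    and mid: "\<And>k f g. f \<in> G k \<Longrightarrow> g \<in> G k \<Longrightarrow> (\<lambda>x. (f x + g x) / 2) \<in> G k"
  obtains g where "\<And>j. g j \<in> G j" "AE x in M. convergent (\<lambda>j. g j x)"
proof -
  interpret prob_space M by fact
  define Q where "Q f = (\<integral>x. (f x)\<^sup>2 \<partial>M)" for f :: "'a \<Rightarrow> real"
  have int: "integrable M f" if "f \<in> borel_measurable M" "\<And>x. \<bar>f x\<bar> \<le> 1" for f :: "'a \<Rightarrow> real"
    by (rule integrable_const_bound[where B = 1]) (use that in auto)
  have sq_int: "integrable M (\<lambda>x. (f x)\<^sup>2)" if "f \<in> borel_measurable M" "\<And>x. \<bar>f x\<bar> \<le> 1" for f :: "'a \<Rightarrow> real"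
    by (rule int) (use that in \<open>auto simp: abs_square_le_1\<close>)
  have absb: "\<bar>f x\<bar> \<le> 1" if "f \<in> G k" for f k x using bounds[OF that, of x] by auto
  have absd: "\<bar>f x - g x\<bar> \<le> 1" if "f \<in> G k" "g \<in> G k" for f g k x
    using bounds[OF that(1), of x] bounds[OF that(2), of x] by auto
  have Q0: "0 \<le> Q f" for f by (simp add: Q_def)
  have Q1: "Q f \<le> 1" if "f \<in> G k" for f k
    unfolding Q_def using absb[OF that] meas[OF that]
    by (intro order.trans[OF integral_mono[OF sq_int, of f "\<lambda>_. 1"]]) (auto simp: abs_square_le_1 prob_space)
  define d where "d k = (INF f\<in>G k. Q f)" for k
  have bdd: "bdd_below (Q ` G k)" for k using Q0 by (intro bdd_belowI[of _ 0]) auto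
  have d_le: "d k \<le> Q f" if "f \<in> G k" for f k unfolding d_def by (rule cINF_lower[OF bdd that])
  have d1: "d k \<le> 1" for k using nonempty[of k] d_le Q1 by (metis ex_in_conv order.trans)
  have bddd: "bdd_above (range d)" using d1 by (intro bdd_aboveI[of _ 1]) auto
  define D where "D = (SUP k. d k)"
  have d_D: "d k \<le> D" for k unfolding D_def by (rule cSUP_upper[OF UNIV_I bddd])
  have d_mono: "d k \<le> d l" if "k \<le> l" for k l
    unfolding d_def using decseqD[OF dec that] nonempty bdd by (intro cINF_superset_mono) auto
  define good where "good j k \<longleftrightarrow> j \<le> k \<and> D - (1/8)^j \<le> d k" for j k
  have ex_good: "\<exists>k. good j k" for j
  proof -
    have "D - (1/8)^j < (SUP k. d k)" by (simp add: D_def)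
    then obtain k where "D - (1/8)^j < d k" using less_cSUP_iff[OF _ bddd] by auto
    then have "good j (max j k)" using d_mono[of k "max j k"] by (auto simp: good_def)
    then show ?thesis by blast
  qed
  \<comment> \<open>The least index makes \<kappa> monotone, so that \<open>g (Suc j)\<close> also
    lies in \<open>G (\<kappa> j)\<close> and can be averaged with \<open>g j\<close>.\<close>
  define \<kappa> where "\<kappa> j = (LEAST k. good j k)" for j
  have \<kappa>: "good j (\<kappa> j)" for j unfolding \<kappa>_def using ex_good by (rule LeastI_ex)
  have \<kappa>_mono: "\<kappa> j \<le> \<kappa> (Suc j)" for j
  proof -
    have "(1/8::real) ^ Suc j \<le> (1/8) ^ j" by (intro power_decreasing) auto
    with \<kappa>[of "Suc j"] have "j \<le> \<kappa> (Suc j)" "D - (1/8)^j \<le> d (\<kappa> (Suc j))"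
      unfolding good_def by linarith+
    then have "good j (\<kappa> (Suc j))" by (simp add: good_def)
    then show ?thesis unfolding \<kappa>_def[of j] by (rule Least_le)
  qed
  have "\<exists>f\<in>G (\<kappa> j). Q f \<le> D + (1/8)^j" for j
  proof -
    have "(INF f\<in>G (\<kappa> j). Q f) < D + (1/8)^j"
      using d_D[of "\<kappa> j"] by (simp add: d_def add_strict_increasing2 less_add_same_cancel1 order_le_less_trans)
    then show ?thesis using cINF_less_iff[OF nonempty bdd] by (meson less_imp_le)
  qed
  then obtain g where g: "\<And>j. g j \<in> G (\<kappa> j)" "\<And>j. Q (g j) \<le> D + (1/8)^j" by metis
  have gm[measurable]: "g j \<in> borel_measurable M" for j using meas[OF g(1)] .
  have gS: "g (Suc j) \<in> G (\<kappa> j)" for j using decseqD[OF dec \<kappa>_mono] g(1) by blast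
  have L2: "(\<integral>x. (g j x - g (Suc j) x)\<^sup>2 \<partial>M) \<le> 8 * (1/8)^j" for j
  proof -
    let ?h = "\<lambda>x. (g j x + g (Suc j) x) / 2"
    have h: "?h \<in> G (\<kappa> j)" by (rule mid[OF g(1) gS])
    have i1: "integrable M (\<lambda>x. (g j x)\<^sup>2)" "integrable M (\<lambda>x. (g (Suc j) x)\<^sup>2)" "integrable M (\<lambda>x. (?h x)\<^sup>2)"
      using absb[OF g(1)] absb[OF gS] absb[OF h] by (auto intro!: sq_int)
    have "(\<integral>x. (g j x - g (Suc j) x)\<^sup>2 \<partial>M)
        = (\<integral>x. (2 * (g j x)\<^sup>2 + 2 * (g (Suc j) x)\<^sup>2) - 4 * (?h x)\<^sup>2 \<partial>M)"
      by (intro Bochner_Integration.integral_cong) (auto simp: power2_eq_square field_simps)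
    also have "\<dots> = 2 * Q (g j) + 2 * Q (g (Suc j)) - 4 * Q ?h"
      unfolding Q_def using i1 by simp
    \<comment> \<open>The midpoint is again in \<open>G (\<kappa> j)\<close>, so its squared norm is
      at least \<open>D - (1/8)^j\<close>. The bound obtained is 25/4 times \<open>(1/8)^j\<close>,
      rounded up to 8.\<close>
    also have "\<dots> \<le> 2 * (D + (1/8)^j) + 2 * (D + (1/8)^Suc j) - 4 * (D - (1/8)^j)"
    proof -
      have "D - (1/8)^j \<le> Q ?h"
        using d_le[OF h] \<kappa>[of j] by (auto simp: good_def)
      then show ?thesis using g(2)[of j] g(2)[of "Suc j"] by (intro diff_mono add_mono mult_left_mono) auto
    qed
    also have "\<dots> \<le> 8 * (1/8)^j" by simp
    finally show ?thesis .
  qed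
  have L1: "(\<integral>x. \<bar>g j x - g (Suc j) x\<bar> \<partial>M) \<le> 9 * (1/2)^j" for j
  proof -
    have i: "integrable M (\<lambda>x. (g j x - g (Suc j) x)\<^sup>2)"
      using absd[OF g(1) gS] by (intro sq_int) auto
    \<comment> \<open>Passes from L2 to L1 by completing a square. The rate \<open>(1/8)^j\<close>
      is such that multiplication by \<open>2^j\<close> still leaves a summable sequence.\<close>
    have ineq: "\<bar>t\<bar> \<le> (1/2)^j + 2^j * t\<^sup>2" for t :: real
    proof -
      have "0 \<le> 2^j * (\<bar>t\<bar> - (1/2)^j)\<^sup>2 + 1 * \<bar>t\<bar>" by simp
      also have "2^j * (\<bar>t\<bar> - (1/2)^j)\<^sup>2 = 2^j * t\<^sup>2 - 2 * \<bar>t\<bar> + (1/2)^j"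
        by (simp add: power2_eq_square algebra_simps power_divide)
      finally show ?thesis by linarith
    qed
    have "(\<integral>x. \<bar>g j x - g (Suc j) x\<bar> \<partial>M) \<le> (\<integral>x. (1/2)^j + 2^j * (g j x - g (Suc j) x)\<^sup>2 \<partial>M)"
    proof (rule integral_mono)
      show "integrable M (\<lambda>x. \<bar>g j x - g (Suc j) x\<bar>)"
        using absd[OF g(1) gS] by (intro int) auto
      show "integrable M (\<lambda>x. (1/2)^j + 2^j * (g j x - g (Suc j) x)\<^sup>2)" using i by simp
    qed (rule ineq)
    also have "\<dots> = (1/2)^j + 2^j * (\<integral>x. (g j x - g (Suc j) x)\<^sup>2 \<partial>M)"
      using i by (simp add: prob_space)
    also have "\<dots> \<le> (1/2)^j + 2^j * (8 * (1/8)^j)"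
      using L2[of j] by simp
    also have "\<dots> = (1/2)^j + 8 * (1/4::real)^j"
      by (simp add: power_mult_distrib[symmetric])
    also have "\<dots> \<le> (1/2)^j + 8 * (1/2::real)^j"
      by (simp add: power_mono)
    finally show ?thesis by simp
  qed
  have "(\<integral>\<^sup>+x. (\<Sum>j. ennreal \<bar>g j x - g (Suc j) x\<bar>) \<partial>M) = (\<Sum>j. \<integral>\<^sup>+x. ennreal \<bar>g j x - g (Suc j) x\<bar> \<partial>M)"
    by (rule nn_integral_suminf) measurable
  also have "\<dots> \<le> (\<Sum>j. ennreal (9 * (1/2)^j))"
  proof (intro suminf_le summableI)
    fix j show "(\<integral>\<^sup>+x. ennreal \<bar>g j x - g (Suc j) x\<bar> \<partial>M) \<le> ennreal (9 * (1/2)^j)"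
      using L1[of j] absd[OF g(1) gS] by (subst nn_integral_eq_integral) (auto intro!: int)
  qed
  also have "\<dots> = ennreal (\<Sum>j. 9 * (1/2)^j)"
    by (intro suminf_ennreal2) (auto intro!: summable_mult summable_geometric)
  finally have "(\<integral>\<^sup>+x. (\<Sum>j. ennreal \<bar>g j x - g (Suc j) x\<bar>) \<partial>M) \<noteq> \<infinity>"
    by (auto simp: top_unique)
  then have "AE x in M. (\<Sum>j. ennreal \<bar>g j x - g (Suc j) x\<bar>) \<noteq> \<infinity>"
    by (intro nn_integral_noteq_infinite) auto
  then have "AE x in M. convergent (\<lambda>j. g j x)"
  proof eventually_elim
    case (elim x)
    then have "summable (\<lambda>j. \<bar>g j x - g (Suc j) x\<bar>)"
      by (intro summable_suminf_not_top) auto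
    then have "summable (\<lambda>j. g j x - g (Suc j) x)" by (rule summable_rabs_cancel)
    then have "convergent (\<lambda>n. \<Sum>j<n. g j x - g (Suc j) x)" by (simp add: summable_iff_convergent)
    moreover have "(\<Sum>j<n. g j x - g (Suc j) x) = g 0 x - g n x" for n
      by (induction n) auto
    ultimately have "convergent (\<lambda>n. g 0 x - g n x)" by simp
    then obtain l where "(\<lambda>n. g 0 x - g n x) \<longlonglongrightarrow> l" by (auto simp: convergent_def)
    then have "(\<lambda>n. g 0 x - (g 0 x - g n x)) \<longlonglongrightarrow> g 0 x - l" by (intro tendsto_intros)
    then show ?case by (auto simp: convergent_def)
  qed
  moreover have "g j \<in> G j" for j
    using g(1)[of j] \<kappa>[of j] decseqD[OF dec, of j "\<kappa> j"] by (auto simp: good_def)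
  ultimately show ?thesis using that by blast
qed

text \<open>Relaxation of a set meeting all the tuples \<open>z 0 w\<close>, ...,
  \<open>z (n-1) w\<close>: for an indicator function the inequality on \<open>A\<close> says that
  each tuple has a member in the set.\<close>

definition fractional_cover ::
  "nat \<Rightarrow> (nat \<Rightarrow> 'w \<Rightarrow> 'e) \<Rightarrow> 'e measure \<Rightarrow> 'w set \<Rightarrow> real \<Rightarrow> ('e \<Rightarrow> real) \<Rightarrow> bool" where
  "fractional_cover n z M A L f \<longleftrightarrow> f \<in> borel_measurable M \<and> (\<forall>e. 0 \<le> f e \<and> f e \<le> 1) \<and>
     (\<forall>w\<in>A. 1 \<le> (\<Sum>i<n. f (z i w))) \<and> (\<integral>e. f e \<partial>M) \<le> L"

text \<open>Covers of \<open>A k\<close> at cost \<open>L k\<close> form decreasing midpoint convex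
  sets, so some choice of them converges almost everywhere, and dominated convergence controls the
  integral of the limit. This is the continuity from below required of a capacity.\<close>

lemma fractional_cover_UN:
  assumes "prob_space M" and A: "incseq A" and L: "decseq L" "L \<longlonglongrightarrow> l"
    and ex: "\<And>k. \<exists>f. fractional_cover n z M (A k) (L k) f"
    and z: "\<And>i w. z i w \<in> space M"
  shows "\<exists>f. fractional_cover n z M (\<Union>k. A k) l f"
proof -
  interpret prob_space M by fact
  define G where "G k = {f. fractional_cover n z M (A k) (L k) f}" for k
  obtain g where g: "\<And>j. g j \<in> G j" "AE x in M. convergent (\<lambda>j. g j x)"
  proof (rule decseq_midpoint_convex_AE_convergent[of M G, OF assms(1)])
    show "decseq G"
      unfolding decseq_def
    proof (intro allI impI subsetI)
      fix k m f assume "k \<le> m" "f \<in> G m"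
      then show "f \<in> G k"
        using subsetD[OF incseqD[OF A \<open>k \<le> m\<close>]] decseqD[OF L(1) \<open>k \<le> m\<close>]
        by (auto simp: G_def fractional_cover_def intro: order.trans)
    qed
    fix k
    show "G k \<noteq> {}" using ex[of k] by (auto simp: G_def)
    fix f assume f: "f \<in> G k"
    then show "f \<in> borel_measurable M" "0 \<le> f x \<and> f x \<le> 1" for x
      by (auto simp: G_def fractional_cover_def)
    fix h assume h: "h \<in> G k"
    have [measurable]: "f \<in> borel_measurable M" "h \<in> borel_measurable M"
      using f h by (auto simp: G_def fractional_cover_def)
    have int: "integrable M f" "integrable M h"
      using f h by (auto simp: G_def fractional_cover_def intro!: integrable_const_bound[where B = 1])
    have sums: "(\<Sum>i<n. (f (z i w) + h (z i w)) / 2) = ((\<Sum>i<n. f (z i w)) + (\<Sum>i<n. h (z i w))) / 2" for w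
      by (simp add: sum.distrib flip: sum_divide_distrib)
    have "1 \<le> (\<Sum>i<n. (f (z i w) + h (z i w)) / 2)" if "w \<in> A k" for w
    proof -
      have "1 \<le> (\<Sum>i<n. f (z i w))" "1 \<le> (\<Sum>i<n. h (z i w))"
        using f h that by (auto simp: G_def fractional_cover_def)
      then show ?thesis unfolding sums by simp
    qed
    moreover have "0 \<le> (f e + h e) / 2 \<and> (f e + h e) / 2 \<le> 1" for e
    proof -
      have "0 \<le> f e \<and> f e \<le> 1" "0 \<le> h e \<and> h e \<le> 1"
        using f h by (auto simp: G_def fractional_cover_def)
      then show ?thesis by simp
    qed
    moreover have "(\<integral>e. (f e + h e) / 2 \<partial>M) \<le> L k"
      using f h int by (auto simp: G_def fractional_cover_def)
    ultimately show "(\<lambda>x. (f x + h x) / 2) \<in> G k"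
      unfolding G_def fractional_cover_def by auto
  qed (use that in blast)
  have gm[measurable]: "g j \<in> borel_measurable M" for j
    using g(1)[of j] by (auto simp: G_def fractional_cover_def)
  have gb: "0 \<le> g j e" "g j e \<le> 1" for j e
    using g(1)[of j] by (auto simp: G_def fractional_cover_def)
  \<comment> \<open>The value 1 at points of divergence keeps the covering inequality true for every
    tuple rather than almost every one; it costs nothing because divergence happens on a null set.
    \<open>Cauchy\<close> is the measurable form of convergence.\<close>
  define f where "f e = (if Cauchy (\<lambda>j. g j e) then lim (\<lambda>j. g j e) else 1)" for e
  have fm[measurable]: "f \<in> borel_measurable M"
    unfolding f_def by measurable
  have conv: "(\<lambda>j. g j e) \<longlonglongrightarrow> f e" if "convergent (\<lambda>j. g j e)" for e
    using that by (simp add: f_def Cauchy_convergent_iff convergent_LIMSEQ_iff)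
  have f1: "f e = 1" if "\<not> convergent (\<lambda>j. g j e)" for e
    using that by (simp add: f_def Cauchy_convergent_iff)
  have fb: "0 \<le> f e \<and> f e \<le> 1" for e
  proof (cases "convergent (\<lambda>j. g j e)")
    case True
    show ?thesis
      using LIMSEQ_le_const[OF conv[OF True], of 0] LIMSEQ_le_const2[OF conv[OF True], of 1] gb by auto
  qed (simp add: f1)
  have "1 \<le> (\<Sum>i<n. f (z i w))" if "w \<in> A k" for w k
  proof (cases "\<forall>i<n. convergent (\<lambda>j. g j (z i w))")
    case True
    have "(\<lambda>j. \<Sum>i<n. g j (z i w)) \<longlonglongrightarrow> (\<Sum>i<n. f (z i w))"
      using True by (intro tendsto_sum conv) auto
    moreover have "1 \<le> (\<Sum>i<n. g j (z i w))" if "j \<ge> k" for j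
      using g(1)[of j] \<open>w \<in> A k\<close> incseqD[OF A that] by (auto simp: G_def fractional_cover_def)
    ultimately show ?thesis by (intro LIMSEQ_le_const) auto
  next
    case False
    then obtain i where i: "i < n" "\<not> convergent (\<lambda>j. g j (z i w))" by auto
    then have "1 = f (z i w)" by (simp add: f1)
    also have "\<dots> \<le> (\<Sum>i<n. f (z i w))"
      using i fb by (intro member_le_sum) auto
    finally show ?thesis .
  qed
  moreover have "(\<integral>e. f e \<partial>M) \<le> l"
  proof (rule LIMSEQ_le)
    show "(\<lambda>j. \<integral>e. g j e \<partial>M) \<longlonglongrightarrow> (\<integral>e. f e \<partial>M)"
      by (rule integral_dominated_convergence[where w = "\<lambda>_. 1"]) (use g(2) conv gb in auto)
    show "L \<longlonglongrightarrow> l" by fact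
    show "\<exists>N. \<forall>j\<ge>N. (\<integral>e. g j e \<partial>M) \<le> L j"
      using g(1) by (auto simp: G_def fractional_cover_def)
  qed
  ultimately show ?thesis
    using fb fm by (intro exI[of _ f]) (auto simp: fractional_cover_def)
qed

text \<open>A nonnegative function with integral 0 vanishes off a null set, and a tuple avoiding
  that set would have sum 0 instead of at least 1.\<close>

lemma fractional_cover_zero:
  assumes "prob_space M" "fractional_cover n z M A 0 f" "\<And>i w. z i w \<in> space M"
  shows "\<exists>N\<in>null_sets M. \<forall>w\<in>A. \<exists>i<n. z i w \<in> N"
proof -
  interpret prob_space M by fact
  have [measurable]: "f \<in> borel_measurable M" and fb: "0 \<le> f e" "f e \<le> 1" for e
    using assms(2) by (auto simp: fractional_cover_def)
  have i: "integrable M f" by (rule integrable_const_bound[where B = 1]) (use fb in auto)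
  have "(\<integral>e. f e \<partial>M) = 0"
    using assms(2) fb by (intro antisym integral_nonneg_AE) (auto simp: fractional_cover_def)
  then have "AE e in M. f e = 0"
    using integral_nonneg_eq_0_iff_AE[OF i] fb by auto
  then have "{e \<in> space M. f e \<noteq> 0} \<in> null_sets M"
    by (simp add: AE_iff_null)
  moreover have "\<exists>i<n. z i w \<in> {e \<in> space M. f e \<noteq> 0}" if "w \<in> A" for w
  proof (rule ccontr)
    assume "\<not> ?thesis"
    then have "(\<Sum>i<n. f (z i w)) = 0" using assms(3) by auto
    then show False using assms(2) that by (auto simp: fractional_cover_def)
  qed
  ultimately show ?thesis by blast
qed

section \<open>Analytic sets\<close>

text \<open>Suslin sets as projections along the Baire space; the second component of a point of
  \<open>H\<close> serves as a witness for the first.\<close>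

definition analytic :: "'a::topological_space set \<Rightarrow> bool" where
  "analytic B \<longleftrightarrow> (\<exists>H :: ('a \<times> (nat \<Rightarrow> nat)) set. closed H \<and> B = fst ` H)"

lemma closed_analytic:
  assumes "closed B" shows "analytic B"
  unfolding analytic_def
  by (rule exI[of _ "B \<times> UNIV"]) (use assms in \<open>auto intro: closed_Times\<close>)

lemma analytic_UN:
  fixes B :: "nat \<Rightarrow> 'a::topological_space set"
  assumes "\<And>n. analytic (B n)"
  shows "analytic (\<Union>n. B n)"
proof -
  obtain H :: "nat \<Rightarrow> ('a \<times> (nat \<Rightarrow> nat)) set"
    where H: "\<And>n. closed (H n)" "\<And>n. B n = fst ` H n"
    using assms unfolding analytic_def by metis
  \<comment> \<open>The first entry of a witness names the index \<open>n\<close>, the remaining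
    entries form a witness for \<open>B n\<close>.\<close>
  define K where "K = {(w, f). (w, f \<circ> Suc) \<in> H (f 0)}"
  have cont: "continuous_on UNIV (\<lambda>p :: 'a \<times> (nat \<Rightarrow> nat). (fst p, snd p \<circ> Suc))"
    by (intro continuous_on_Pair continuous_on_fst continuous_on_id continuous_on_coordinatewise_then_product)
      (auto intro!: continuous_on_product_then_coordinatewise continuous_on_snd continuous_on_id)
  have cont0: "continuous_on UNIV (\<lambda>p :: 'a \<times> (nat \<Rightarrow> nat). snd p 0)"
    by (auto intro!: continuous_on_product_then_coordinatewise continuous_on_snd continuous_on_id)
  have "K = (\<Inter>n. (\<lambda>p. snd p 0) -` (- {n}) \<union> (\<lambda>p. (fst p, snd p \<circ> Suc)) -` H n)"
    by (auto simp: K_def)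
  also have "closed \<dots>"
  proof (intro closed_INT ballI closed_Un closed_vimage cont cont0 H(1))
    fix n :: nat show "closed (- {n})" by (simp add: closed_def Topological_Spaces.open_discrete)
  qed
  finally have "closed K" .
  moreover have "(\<Union>n. B n) = fst ` K"
  proof (intro set_eqI iffI)
    fix w assume "w \<in> (\<Union>n. B n)"
    then obtain n f where "(w, f) \<in> H n" by (force simp: H(2))
    then have "(w, case_nat n f) \<in> K" by (simp add: K_def comp_def)
    then show "w \<in> fst ` K" by force
  next
    fix w assume "w \<in> fst ` K"
    then obtain f where "(w, f \<circ> Suc) \<in> H (f 0)" by (auto simp: K_def)
    then show "w \<in> (\<Union>n. B n)" by (force simp: H(2))
  qed
  ultimately show ?thesis unfolding analytic_def by blast
qed

lemma analytic_INT:
  fixes B :: "nat \<Rightarrow> 'a::topological_space set"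
  assumes "\<And>n. analytic (B n)"
  shows "analytic (\<Inter>n. B n)"
proof -
  obtain H :: "nat \<Rightarrow> ('a \<times> (nat \<Rightarrow> nat)) set"
    where H: "\<And>n. closed (H n)" "\<And>n. B n = fst ` H n"
    using assms unfolding analytic_def by metis
  \<comment> \<open>One sequence codes witnesses for all \<open>n\<close> at once, by pairing of
    natural numbers.\<close>
  define s where "s n p = (fst p, \<lambda>k. snd p (prod_encode (n, k)))" for n and p :: "'a \<times> (nat \<Rightarrow> nat)"
  have cont: "continuous_on UNIV (s n)" for n
    unfolding s_def
    by (intro continuous_on_Pair continuous_on_fst continuous_on_id continuous_on_coordinatewise_then_product)
      (auto intro!: continuous_on_product_then_coordinatewise continuous_on_snd continuous_on_id)
  define K where "K = (\<Inter>n. s n -` H n)"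
  have "closed K"
    unfolding K_def by (intro closed_INT ballI closed_vimage cont H(1))
  moreover have "(\<Inter>n. B n) = fst ` K"
  proof (intro set_eqI iffI)
    fix w assume "w \<in> (\<Inter>n. B n)"
    then have "\<exists>f. (w, f) \<in> H n" for n by (force simp: H(2))
    then obtain F where F: "\<And>n. (w, F n) \<in> H n" by metis
    define f where "f j = (case prod_decode j of (n, k) \<Rightarrow> F n k)" for j
    have "(w, f) \<in> K" by (simp add: K_def s_def f_def F)
    then show "w \<in> fst ` K" by force
  next
    fix w assume "w \<in> fst ` K"
    then obtain f where "(w, f) \<in> K" by auto
    then show "w \<in> (\<Inter>n. B n)" by (force simp: H(2) K_def s_def)
  qed
  ultimately show ?thesis unfolding analytic_def by blast
qed

text \<open>Analytic sets are not closed under complements, so the induction carries each set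
  together with its complement.\<close>

lemma borel_imp_analytic:
  fixes B :: "('i::countable \<Rightarrow> bool) set"
  assumes "B \<in> sets borel"
  shows "analytic B"
proof -
  have "B \<in> sigma_sets UNIV cylinders" using assms by (simp add: sets_borel_fun_bool)
  then have "analytic B \<and> analytic (- B)"
  proof induction
    case (Basic a)
    then show ?case by (simp add: closed_analytic closed_cylinder cylinder_Compl)
  next
    case Empty
    then show ?case by (simp add: closed_analytic)
  next
    case (Compl a)
    then show ?case by (simp add: Compl_eq_Diff_UNIV[symmetric])
  next
    case (Union a)
    then show ?case using analytic_UN[of a] analytic_INT[of "\<lambda>i. - a i"] by simp
  qed
  then show ?thesis by simp
qed

text \<open>Bounding one further entry of the witness writes each truncation as an increasing union
  of candidates for the next one.\<close>

definition truncation :: "('a \<times> (nat \<Rightarrow> nat)) set \<Rightarrow> (nat \<Rightarrow> nat) \<Rightarrow> nat \<Rightarrow> 'a set" where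
  "truncation H a k = {w. \<exists>f. (\<forall>i<k. f i \<le> a i) \<and> (w, f) \<in> H}"

lemma truncation_antimono: "k \<le> l \<Longrightarrow> truncation H a l \<subseteq> truncation H a k"
  unfolding truncation_def using less_le_trans by blast

lemma truncation_cong: "(\<And>i. i < k \<Longrightarrow> a i = b i) \<Longrightarrow> truncation H a k = truncation H b k"
  by (auto simp: truncation_def)

text \<open>Choquet's capacitability argument. With the first \<open>k\<close> bounds fixed, growing
  bounds on entry \<open>k\<close> give sets increasing to the current truncation; by
  \<open>fractional_cover_UN\<close> at the constant level \<alpha>, one of them is again
  uncoverable. Dependent choice collects the bounds.\<close>

lemma truncation_bound_exists:
  assumes "prob_space M" "\<And>i w. z i w \<in> space M"
    and no_cover: "\<nexists>f. fractional_cover n z M (fst ` H) \<alpha> f"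
  obtains a where "\<And>k. \<nexists>f. fractional_cover n z M (truncation H a k) \<alpha> f"
proof -
  define P where "P k xs \<longleftrightarrow> length xs = k \<and> (\<nexists>f. fractional_cover n z M (truncation H ((!) xs) k) \<alpha> f)" for k xs
  have "\<exists>s. \<forall>k. P k (s k) \<and> (\<exists>j. s (Suc k) = s k @ [j])"
  proof (rule dependent_nat_choice)
    have "truncation H ((!) []) 0 = fst ` H" by (force simp: truncation_def)
    then show "\<exists>xs. P 0 xs" using no_cover by (auto simp: P_def)
    fix xs k assume Pk: "P k xs"
    have "\<exists>j. P (Suc k) (xs @ [j])"
    proof (rule ccontr)
      assume "\<nexists>j. P (Suc k) (xs @ [j])"
      then have ex: "\<exists>f. fractional_cover n z M (truncation H ((!) (xs @ [j])) (Suc k)) \<alpha> f" for j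
        using Pk by (auto simp: P_def)
      have mem: "w \<in> truncation H ((!) (xs @ [j])) (Suc k) \<longleftrightarrow>
          (\<exists>f. (\<forall>i<k. f i \<le> xs ! i) \<and> f k \<le> j \<and> (w, f) \<in> H)" for w j
        using Pk unfolding truncation_def P_def by (auto simp: less_Suc_eq nth_append)
      have "incseq (\<lambda>j. truncation H ((!) (xs @ [j])) (Suc k))"
        unfolding incseq_def using mem by (auto intro: order.trans) (meson order.trans)
      then have "\<exists>f. fractional_cover n z M (\<Union>j. truncation H ((!) (xs @ [j])) (Suc k)) \<alpha> f"
        by (rule fractional_cover_UN[OF assms(1) _ _ _ ex assms(2)]) auto
      moreover have "(\<Union>j. truncation H ((!) (xs @ [j])) (Suc k)) = truncation H ((!) xs) k"
        by (auto simp: mem) (auto simp: truncation_def)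
      ultimately show False using Pk by (simp add: P_def)
    qed
    then show "\<exists>ys. P (Suc k) ys \<and> (\<exists>j. ys = xs @ [j])" by blast
  qed
  then obtain s where s: "\<And>k. P k (s k)" "\<And>k. \<exists>j. s (Suc k) = s k @ [j]" by blast
  have len: "length (s k) = k" for k using s(1) by (simp add: P_def)
  define a where "a i = s (Suc i) ! i" for i
  have "s k ! i = a i" if "i < k" for i k
    using that
  proof (induction k)
    case (Suc k)
    obtain j where j: "s (Suc k) = s k @ [j]" using s(2) by blast
    show ?case
    proof (cases "i < k")
      case True
      then show ?thesis using Suc j len[of k] by (simp add: nth_append)
    next
      case False
      then have "i = k" using Suc by simp
      then show ?thesis by (simp add: a_def)
    qed
  qed simp
  then have "truncation H a k = truncation H ((!) (s k)) k" for k
    by (intro truncation_cong) simp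
  then show ?thesis using s(1) that[of a] by (simp add: P_def)
qed

lemma tendsto_fun_iff:
  fixes f :: "'b \<Rightarrow> 'i \<Rightarrow> 'a::topological_space"
  shows "(f \<longlongrightarrow> l) F \<longleftrightarrow> (\<forall>i. ((\<lambda>x. f x i) \<longlongrightarrow> l i) F)"
  using limitin_componentwise[of "\<lambda>_. euclidean" UNIV f l F] by (simp add: euclidean_product_topology)

lemma compact_PiE_atMost: "compact (PiE UNIV (\<lambda>i. {..a i}) :: (nat \<Rightarrow> nat) set)"
proof -
  have "compactin (product_topology (\<lambda>_::nat. euclidean :: nat topology) UNIV) (PiE UNIV (\<lambda>i. {..a i}))"
    unfolding compactin_PiE by (simp add: finite_imp_compact)
  then show ?thesis by (simp add: euclidean_product_topology)
qed

text \<open>Points of the truncations approach \<open>w\<close> with witnesses bounded by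
  \<open>a\<close> on longer and longer initial segments; a subsequence of the witnesses converges,
  and closedness of \<open>H\<close> makes the limit a witness for \<open>w\<close>.\<close>

lemma INT_closure_truncation:
  fixes H :: "('a::first_countable_topology \<times> (nat \<Rightarrow> nat)) set"
  assumes "closed H" and w: "\<And>k. w \<in> closure (truncation H a k)"
  shows "w \<in> fst ` H"
proof -
  obtain U :: "nat \<Rightarrow> 'a set" where U: "\<And>i. open (U i)" "\<And>i. w \<in> U i"
    "\<And>S. open S \<Longrightarrow> w \<in> S \<Longrightarrow> eventually (\<lambda>i. U i \<subseteq> S) sequentially"
    by (rule countable_basis_at_decseq) blast
  have "\<exists>v f. v \<in> U k \<and> (\<forall>i<k. f i \<le> a i) \<and> (v, f) \<in> H" for k
  proof -
    have "U k \<inter> truncation H a k \<noteq> {}"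
      using w[of k] U(1,2)[of k] open_Int_closure_eq_empty by blast
    then show ?thesis by (auto simp: truncation_def)
  qed
  then obtain v f where vf: "\<And>k. v k \<in> U k" "\<And>k i. i < k \<Longrightarrow> f k i \<le> a i" "\<And>k. (v k, f k) \<in> H"
    by metis
  have "v \<longlonglongrightarrow> w"
  proof (rule topological_tendstoI)
    fix S assume "open S" "w \<in> S"
    from U(3)[OF this] show "eventually (\<lambda>k. v k \<in> S) sequentially"
      by eventually_elim (use vf(1) in blast)
  qed
  \<comment> \<open>Capping by \<open>a\<close> moves the witnesses into a compact box and changes
    entry \<open>i\<close> only in the finitely many terms with \<open>k \<le> i\<close>.\<close>
  define g where "g k i = min (f k i) (a i)" for k i
  have "seq_compact (PiE UNIV (\<lambda>i. {..a i}))"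
    by (rule compact_imp_seq_compact[OF compact_PiE_atMost])
  moreover have "\<forall>k. g k \<in> PiE UNIV (\<lambda>i. {..a i})" by (simp add: g_def PiE_iff)
  ultimately obtain h r where r: "strict_mono (r :: nat \<Rightarrow> nat)" "(g \<circ> r) \<longlonglongrightarrow> h"
    by (rule seq_compactE)
  have "(\<lambda>k. f (r k)) \<longlonglongrightarrow> h"
    unfolding tendsto_fun_iff
  proof
    fix i
    have "eventually (\<lambda>k. (g \<circ> r) k i = f (r k) i) sequentially"
      using eventually_gt_at_top[of i]
    proof eventually_elim
      case (elim k)
      then have "i < r k" using seq_suble[OF r(1), of k] by simp
      then show ?case using vf(2) by (simp add: g_def min_def)
    qed
    moreover have "(\<lambda>k. (g \<circ> r) k i) \<longlonglongrightarrow> h i"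
      using r(2) unfolding tendsto_fun_iff by blast
    ultimately show "(\<lambda>k. f (r k) i) \<longlonglongrightarrow> h i"
      by (rule Lim_transform_eventually[rotated])
  qed
  moreover have "(\<lambda>k. v (r k)) \<longlonglongrightarrow> w"
    using LIMSEQ_subseq_LIMSEQ[OF \<open>v \<longlonglongrightarrow> w\<close> r(1)] by (simp add: comp_def)
  ultimately have "(\<lambda>k. (v (r k), f (r k))) \<longlonglongrightarrow> (w, h)" by (intro tendsto_Pair)
  then have "(w, h) \<in> H" by (rule closed_sequentially[OF assms(1) vf(3)])
  then show ?thesis by force
qed

section \<open>Kellerer's dichotomy\<close>

text \<open>The sum of the \<open>n\<close> marginals of the discrete measure with weights
  \<open>p\<close>, evaluated at the type \<open>v\<close>.\<close>

definition load :: "nat \<Rightarrow> (nat \<Rightarrow> 'w \<Rightarrow> 'v) \<Rightarrow> 'w set \<Rightarrow> ('w \<Rightarrow> real) \<Rightarrow> 'v \<Rightarrow> real" where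
  "load n t W p v = (\<Sum>w\<in>W. p w * real (card {i. i < n \<and> t i w = v}))"

text \<open>Greedily raising the weights one by one saturates a coordinate of every point.\<close>

lemma maximal_fractional_packing:
  fixes t :: "nat \<Rightarrow> 'w \<Rightarrow> 'v" and cap :: "'v \<Rightarrow> real"
  assumes "finite W" "\<And>v. 0 \<le> cap v" "0 < n"
  shows "\<exists>p. (\<forall>w. 0 \<le> p w) \<and> (\<forall>v. load n t W p v \<le> cap v) \<and>
    (\<forall>w\<in>W. \<exists>i<n. load n t W p (t i w) = cap (t i w))"
  using assms(1)
proof induction
  case empty
  show ?case using assms(2) by (intro exI[of _ "\<lambda>_. 0"]) (auto simp: load_def)
next
  case (insert q W)
  then obtain p where p: "\<And>w. 0 \<le> p w" "\<And>v. load n t W p v \<le> cap v"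
    "\<And>w. w \<in> W \<Longrightarrow> \<exists>i<n. load n t W p (t i w) = cap (t i w)" by blast
  define mult where "mult v = real (card {i. i < n \<and> t i q = v})" for v
  \<comment> \<open>The largest weight of \<open>q\<close> that the capacity at \<open>t i q\<close>
    still allows; division by \<open>mult\<close> is needed because several coordinates of
    \<open>q\<close> may have the same type. The index attaining the minimum becomes
    saturated.\<close>
  define slack where "slack i = (cap (t i q) - load n t W p (t i q)) / mult (t i q)" for i
  have mult_pos: "0 < mult (t i q)" if "i < n" for i
    using that by (auto simp: mult_def card_gt_0_iff)
  define \<epsilon> where "\<epsilon> = Min (slack ` {..<n})"
  have \<epsilon>_le: "\<epsilon> \<le> slack i" if "i < n" for i using that by (auto simp: \<epsilon>_def)
  have "\<epsilon> \<in> slack ` {..<n}" unfolding \<epsilon>_def using assms(3) by (intro Min_in) auto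
  then obtain i0 where i0: "i0 < n" "\<epsilon> = slack i0" by auto
  have slack_nonneg: "0 \<le> slack i" if "i < n" for i
    using p(2) mult_pos[OF that] by (simp add: slack_def)
  define p' where "p' = p(q := \<epsilon>)"
  have load': "load n t (insert q W) p' v = \<epsilon> * mult v + load n t W p v" for v
  proof -
    have "(\<Sum>w\<in>W. p' w * real (card {i. i < n \<and> t i w = v})) = (\<Sum>w\<in>W. p w * real (card {i. i < n \<and> t i w = v}))"
      using insert.hyps(2) by (intro sum.cong) (auto simp: p'_def)
    then show ?thesis using insert.hyps by (simp add: load_def mult_def p'_def)
  qed
  have le: "load n t (insert q W) p' v \<le> cap v" for v
  proof (cases "\<exists>i<n. t i q = v")
    case True
    then obtain i where i: "i < n" "t i q = v" by auto
    have "\<epsilon> * mult v \<le> slack i * mult v"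
      using \<epsilon>_le[OF i(1)] by (intro mult_right_mono) (auto simp: mult_def)
    also have "\<dots> = cap v - load n t W p v" using mult_pos[OF i(1)] i(2) by (simp add: slack_def)
    finally show ?thesis by (simp add: load')
  next
    case False
    then have "mult v = 0" by (auto simp: mult_def)
    then show ?thesis using p(2) by (simp add: load')
  qed
  \<comment> \<open>Loads only grow and stay below the capacity, so coordinates saturated earlier
    remain saturated.\<close>
  have ge: "load n t W p v \<le> load n t (insert q W) p' v" for v
    using slack_nonneg[OF i0(1)] i0(2) by (simp add: load' mult_def)
  have sat: "\<exists>i<n. load n t (insert q W) p' (t i w) = cap (t i w)" if w: "w \<in> insert q W" for w
  proof (cases "w = q")
    case True
    have "load n t (insert q W) p' (t i0 q) = cap (t i0 q)"
      using mult_pos[OF i0(1)] by (simp add: load' i0(2) slack_def)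
    then show ?thesis using i0(1) True by blast
  next
    case False
    then obtain i where "i < n" "load n t W p (t i w) = cap (t i w)" using w p(3) by auto
    then show ?thesis using ge[of "t i w"] le[of "t i w"] by (intro exI[of _ i]) auto
  qed
  have "\<forall>w. 0 \<le> p' w" using p(1) slack_nonneg[OF i0(1)] i0(2) by (simp add: p'_def)
  with le sat show ?case by blast
qed

lemma sum_load:
  assumes "finite W" "finite V"
  shows "(\<Sum>v\<in>V. load n t W p v) = (\<Sum>w\<in>W. p w * real (card {i. i < n \<and> t i w \<in> V}))"
proof -
  have "(\<Sum>v\<in>V. card {i. i < n \<and> t i w = v}) = card {i. i < n \<and> t i w \<in> V}" for w
  proof -
    have "card (\<Union>v\<in>V. {i. i < n \<and> t i w = v}) = (\<Sum>v\<in>V. card {i. i < n \<and> t i w = v})"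
      using assms(2) by (intro card_UN_disjoint) auto
    moreover have "(\<Union>v\<in>V. {i. i < n \<and> t i w = v}) = {i. i < n \<and> t i w \<in> V}" by auto
    ultimately show ?thesis by simp
  qed
  then show ?thesis
    unfolding load_def by (subst sum.swap) (simp flip: sum_distrib_left of_nat_sum)
qed

text \<open>Supplies the sum of the marginals of a measure on cycles, and plans reassembled from a
  remainder and several pushforwards.\<close>

lemma finite_sum_measure_exists:
  fixes M :: "'i \<Rightarrow> 'a measure"
  assumes "finite I" and sets: "\<And>i. i \<in> I \<Longrightarrow> sets (M i) = sets N"
  shows "\<exists>S. sets S = sets N \<and> (\<forall>A\<in>sets N. emeasure S A = (\<Sum>i\<in>I. emeasure (M i) A)) \<and>
    (\<forall>f\<in>borel_measurable N. nn_integral S f = (\<Sum>i\<in>I. nn_integral (M i) f))"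
proof -
  define S where "S = measure_of (space N) (sets N) (\<lambda>A. \<Sum>i\<in>I. emeasure (M i) A)"
  have setsS: "sets S = sets N" by (simp add: S_def)
  have S: "emeasure S A = (\<Sum>i\<in>I. emeasure (M i) A)" if "A \<in> sets N" for A
    unfolding S_def
  proof (rule emeasure_measure_of_sigma)
    show "countably_additive (sets N) (\<lambda>A. \<Sum>i\<in>I. emeasure (M i) A)"
      unfolding countably_additive_def
    proof (intro allI impI)
      fix A :: "nat \<Rightarrow> 'a set"
      assume A: "range A \<subseteq> sets N" "disjoint_family A" "(\<Union>i. A i) \<in> sets N"
      have "(\<Sum>j. \<Sum>i\<in>I. emeasure (M i) (A j)) = (\<Sum>i\<in>I. \<Sum>j. emeasure (M i) (A j))"
        by (rule suminf_sum) auto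
      also have "\<dots> = (\<Sum>i\<in>I. emeasure (M i) (\<Union>j. A j))"
        using A sets by (intro sum.cong refl suminf_emeasure) auto
      finally show "(\<Sum>j. \<Sum>i\<in>I. emeasure (M i) (A j)) = (\<Sum>i\<in>I. emeasure (M i) (\<Union>j. A j))" .
    qed
  qed (use that in \<open>auto simp: positive_def sets.sigma_algebra_axioms\<close>)
  have "nn_integral S f = (\<Sum>i\<in>I. nn_integral (M i) f)" if "f \<in> borel_measurable N" for f
    using that
  proof (induction rule: borel_measurable_induct)
    case (cong f g)
    have "nn_integral S g = nn_integral S f" "\<And>i. i \<in> I \<Longrightarrow> nn_integral (M i) g = nn_integral (M i) f"
      using cong(3) sets_eq_imp_space_eq[OF setsS] sets_eq_imp_space_eq[OF sets]
      by (auto intro!: nn_integral_cong)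
    then show ?case using cong(4) by simp
  next
    case (set A)
    then show ?case using S sets setsS by (simp add: nn_integral_indicator)
  next
    case (mult u c)
    have "u \<in> borel_measurable S" "\<And>i. i \<in> I \<Longrightarrow> u \<in> borel_measurable (M i)"
      using mult(2) by (simp_all add: measurable_cong_sets[OF setsS refl] measurable_cong_sets[OF sets refl])
    then show ?case using mult by (simp add: nn_integral_cmult sum_distrib_left)
  next
    case (add u v)
    have "u \<in> borel_measurable S" "\<And>i. i \<in> I \<Longrightarrow> u \<in> borel_measurable (M i)"
      "v \<in> borel_measurable S" "\<And>i. i \<in> I \<Longrightarrow> v \<in> borel_measurable (M i)"
      using add.hyps(1,3) by (simp_all add: measurable_cong_sets[OF setsS refl] measurable_cong_sets[OF sets refl])
    then show ?case using add by (simp add: nn_integral_add sum.distrib)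
  next
    case (seq U)
    have m: "U k \<in> borel_measurable S" "\<And>i. i \<in> I \<Longrightarrow> U k \<in> borel_measurable (M i)" for k
      using seq.hyps(1) by (simp_all add: measurable_cong_sets[OF setsS refl] measurable_cong_sets[OF sets refl])
    have SUP: "(SUP k. U k) = (\<lambda>x. SUP k. U k x)" by (simp add: fun_eq_iff image_comp)
    have "nn_integral S (SUP k. U k) = (SUP k. nn_integral S (U k))"
      unfolding SUP by (rule nn_integral_monotone_convergence_SUP[OF seq.hyps(3) m(1)])
    also have "\<dots> = (SUP k. \<Sum>i\<in>I. nn_integral (M i) (U k))" using seq.IH by simp
    also have "\<dots> = (\<Sum>i\<in>I. SUP k. nn_integral (M i) (U k))"
      using seq.hyps(3) by (intro ennreal_SUP_sum) (auto simp: incseq_def le_fun_def intro!: nn_integral_mono)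
    also have "\<dots> = (\<Sum>i\<in>I. nn_integral (M i) (SUP k. U k))"
      unfolding SUP using nn_integral_monotone_convergence_SUP[OF seq.hyps(3) m(2)] by simp
    finally show ?case .
  qed
  with setsS S show ?thesis by (intro exI[of _ S]) simp
qed

text \<open>The difference is nonnegative and finitely additive on cylinders, hence extends to a
  measure \<open>R\<close>; uniqueness on the generator gives \<open>N\<close> as the sum of
  \<open>R\<close> and \<open>M\<close>.\<close>

lemma le_on_cylinders_imp_le:
  fixes M N :: "('i::countable \<Rightarrow> bool) measure"
  assumes "finite_measure M" "finite_measure N" and sets: "sets M = sets borel" "sets N = sets borel"
    and le: "\<And>C. C \<in> cylinders \<Longrightarrow> measure M C \<le> measure N C"
    and D: "D \<in> sets borel"
  shows "emeasure M D \<le> emeasure N D"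
proof -
  interpret M: finite_measure M by fact
  interpret N: finite_measure N by fact
  interpret algebra UNIV "cylinders :: ('i \<Rightarrow> bool) set set" by (rule algebra_cylinders)
  have cyl: "C \<in> sets M" "C \<in> sets N" if "C \<in> cylinders" for C
    using that sets by auto
  obtain R where R: "sets R = sets borel"
    "\<And>C. C \<in> cylinders \<Longrightarrow> emeasure R C = ennreal (measure N C - measure M C)"
  proof (rule cylinder_premeasure_extends[of "\<lambda>C. measure N C - measure M C"])
    show "measure N (C \<union> D) - measure M (C \<union> D) = measure N C - measure M C + (measure N D - measure M D)"
      if "C \<in> cylinders" "D \<in> cylinders" "C \<inter> D = {}" for C D :: "('i \<Rightarrow> bool) set"
      using that cyl by (simp add: M.finite_measure_Union N.finite_measure_Union)
  qed (use le in auto)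
  have "sets (if b then R else M) = sets borel" for b using R(1) sets(1) by simp
  then obtain S where setsS: "sets S = sets borel"
    and S': "\<And>A. A \<in> sets borel \<Longrightarrow> emeasure S A = (\<Sum>b\<in>UNIV. emeasure (if b then R else M) A)"
    using finite_sum_measure_exists[of UNIV "\<lambda>b. if b then R else M" borel] by auto
  have S: "emeasure S A = emeasure R A + emeasure M A" if "A \<in> sets borel" for A
    using S'[OF that] by (simp add: UNIV_bool add.commute)
  have SN: "emeasure S C = emeasure N C" if "C \<in> cylinders" for C
    using R(2)[OF that] le[OF that] that
    by (simp add: S cylinder_in_borel M.emeasure_eq_measure N.emeasure_eq_measure ennreal_plus[symmetric] del: ennreal_plus)
  have "S = N"
  proof (rule measure_eqI_generator_eq[where E = cylinders and \<Omega> = UNIV and A = "\<lambda>_. UNIV"])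
    show "Int_stable (cylinders :: ('i \<Rightarrow> bool) set set)" by (auto simp: Int_stable_def)
    show "sets S = sigma_sets UNIV cylinders"
      by (simp add: setsS sets_borel_fun_bool)
    show "sets N = sigma_sets UNIV cylinders" by (simp add: sets sets_borel_fun_bool)
    show "emeasure S UNIV \<noteq> \<infinity>" using SN[OF top] N.emeasure_finite by simp
  qed (use SN in auto)
  then show ?thesis using S[OF D] by simp
qed

text \<open>A Boolean array is read as a sequence of Cantor points, its rows. Since
  \<open>nat \<times> nat\<close> is countable, the lemmas on cylinders apply to such sequences as
  well.\<close>

definition coord :: "nat \<Rightarrow> (nat \<times> nat \<Rightarrow> bool) \<Rightarrow> nat \<Rightarrow> bool" where
  "coord i w = (\<lambda>k. w (i, k))"

lemma coord_measurable [measurable]: "coord i \<in> borel \<rightarrow>\<^sub>M borel"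
  unfolding coord_def
  by (intro measurable_coordinatewise_then_product measurable_product_coordinates)

text \<open>Points with equal first \<open>m\<close> bits form one cell of level \<open>m\<close>,
  named by the positions of its \<open>True\<close> bits.\<close>

definition cell :: "nat \<Rightarrow> (nat \<Rightarrow> bool) \<Rightarrow> nat set" where
  "cell m e = {k. k < m \<and> e k}"

lemma cell_vimage_cylinder: "{e. cell m e \<in> V} \<in> cylinders"
proof -
  have "{e. cell m e \<in> V} = cylinder {..<m} V" by (simp add: cylinder_def cell_def)
  then show ?thesis unfolding cylinders_def using finite_lessThan by blast
qed

lemma coord_vimage_cylinder:
  assumes "D \<in> cylinders" shows "{w. coord i w \<in> D} \<in> cylinders"
proof -
  obtain I where I: "finite I" "\<And>w w'. (\<And>i. i \<in> I \<Longrightarrow> w i = w' i) \<Longrightarrow> w \<in> D \<longleftrightarrow> w' \<in> D"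
    using assms by (rule cylindersE) blast
  show ?thesis
  proof (rule cylindersI[of "Pair i ` I"])
    fix w w' assume "\<And>j. j \<in> Pair i ` I \<Longrightarrow> w j = w' j" "w \<in> {w. coord i w \<in> D}"
    then show "w' \<in> {w. coord i w \<in> D}"
      using I(2)[of "coord i w" "coord i w'"] by (auto simp: coord_def)
  qed (use I in simp)
qed

lemma cylinder_eq_cells:
  assumes "D \<in> cylinders"
  obtains m0 where "\<And>m. m0 \<le> m \<Longrightarrow> \<exists>V. D = {e. cell m e \<in> V}"
proof -
  obtain I where I: "finite I" "\<And>w w'. (\<And>i. i \<in> I \<Longrightarrow> w i = w' i) \<Longrightarrow> w \<in> D \<longleftrightarrow> w' \<in> D"
    using assms by (rule cylindersE) blast
  obtain m0 where m0: "I \<subseteq> {..<m0}" using finite_nat_bounded[OF I(1)] by auto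
  have "D = {e. cell m e \<in> cell m ` D}" if "m0 \<le> m" for m
  proof (intro set_eqI iffI)
    fix e assume "e \<in> {e. cell m e \<in> cell m ` D}"
    then obtain e' where e': "e' \<in> D" "cell m e = cell m e'" by auto
    have "e k = e' k" if "k < m" for k
    proof -
      have "k \<in> cell m e \<longleftrightarrow> k \<in> cell m e'" by (simp add: e'(2))
      then show ?thesis using that by (simp add: cell_def)
    qed
    then have "e i = e' i" if "i \<in> I" for i using that m0 \<open>m0 \<le> m\<close> by auto
    then show "e \<in> D" using e'(1) I(2)[of e e'] by blast
  qed auto
  then show ?thesis by (intro that[of m0] exI)
qed

text \<open>A maximal packing with capacities given by the \<pi>-masses of the cells saturates, for
  every point of \<open>A\<close>, the cell of some coordinate. The saturated cells therefore cover
  \<open>A\<close>, their mass exceeds \<alpha>, and this mass is the load of the packing.\<close>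

lemma packing_of_uncovered:
  fixes \<pi> :: "(nat \<Rightarrow> bool) measure" and A :: "(nat \<times> nat \<Rightarrow> bool) set"
  assumes "prob_space \<pi>" and sets: "sets \<pi> = sets borel" and n: "0 < n"
    and no_cover: "\<nexists>f. fractional_cover n coord \<pi> A \<alpha> f"
  obtains W p where "finite W" "W \<subseteq> A" "\<And>w. 0 \<le> p w"
    "\<alpha> < real n * (\<Sum>w\<in>W. p w)" "(\<Sum>w\<in>W. p w) \<le> 1"
    "\<And>V. (\<Sum>i<n. \<Sum>w\<in>W. p w * indicator {e. cell m e \<in> V} (coord i w)) \<le> measure \<pi> {e. cell m e \<in> V}"
proof -
  interpret prob_space \<pi> by fact
  have space: "space \<pi> = UNIV" using sets_eq_imp_space_eq[OF sets] by simp
  have cell_sets: "{e. cell m e \<in> V} \<in> sets \<pi>" for V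
    unfolding sets using cell_vimage_cylinder by (rule cylinder_in_borel)
  define t where "t i w = cell m (coord i w)" for i w
  define cap where "cap v = measure \<pi> {e. cell m e = v}" for v
  have cap_cell: "{e. cell m e = v} \<in> sets \<pi>" for v using cell_sets[of "{v}"] by simp
  \<comment> \<open>Only finitely many tuples of cells occur in \<open>A\<close>; the finite set
    \<open>W\<close> represents all of them.\<close>
  have "finite ((\<lambda>w. \<lambda>i\<in>{..<n}. t i w) ` A)"
  proof (rule finite_subset)
    show "(\<lambda>w. \<lambda>i\<in>{..<n}. t i w) ` A \<subseteq> {..<n} \<rightarrow>\<^sub>E Pow {..<m}"
      by (auto simp: t_def cell_def)
  qed (simp add: finite_PiE)
  then obtain W where W: "W \<subseteq> A" "finite W" "(\<lambda>w. \<lambda>i\<in>{..<n}. t i w) ` A = (\<lambda>w. \<lambda>i\<in>{..<n}. t i w) ` W"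
    using finite_subset_image[OF _ subset_refl] by (metis (no_types, lifting))
  have "\<exists>p. (\<forall>w. 0 \<le> p w) \<and> (\<forall>v. load n t W p v \<le> cap v) \<and>
    (\<forall>w\<in>W. \<exists>i<n. load n t W p (t i w) = cap (t i w))"
    by (rule maximal_fractional_packing[OF W(2) _ n]) (simp add: cap_def)
  then obtain p where p: "\<And>w. 0 \<le> p w" "\<And>v. load n t W p v \<le> cap v"
    "\<And>w. w \<in> W \<Longrightarrow> \<exists>i<n. load n t W p (t i w) = cap (t i w)" by blast
  have sum_cap: "(\<Sum>v\<in>V. cap v) = measure \<pi> {e. cell m e \<in> V}" if "finite V" for V
  proof -
    have "measure \<pi> (\<Union>v\<in>V. {e. cell m e = v}) = (\<Sum>v\<in>V. cap v)"
      unfolding cap_def using cap_cell that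
      by (intro finite_measure_finite_Union) (auto simp: disjoint_family_on_def)
    moreover have "(\<Union>v\<in>V. {e. cell m e = v}) = {e. cell m e \<in> V}" by auto
    ultimately show ?thesis by simp
  qed
  define V where "V = {v \<in> Pow {..<m}. load n t W p v = cap v}"
  have finV: "finite V" by (simp add: V_def)
  have total: "(\<Sum>w\<in>W. p w * real (card {i. i < n \<and> t i w \<in> V'})) \<le> measure \<pi> {e. cell m e \<in> V'}"
    if "finite V'" for V'
    unfolding sum_load[OF W(2) that, symmetric] sum_cap[OF that, symmetric] by (intro sum_mono p(2))
  have marg: "(\<Sum>i<n. \<Sum>w\<in>W. p w * indicator {e. cell m e \<in> V'} (coord i w)) \<le> measure \<pi> {e. cell m e \<in> V'}" for V'
  proof -
    have "{e. cell m e \<in> V'} = {e. cell m e \<in> V' \<inter> Pow {..<m}}" by (auto simp: cell_def)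
    moreover have "(\<Sum>i<n. \<Sum>w\<in>W. p w * indicator {e. cell m e \<in> V' \<inter> Pow {..<m}} (coord i w))
        = (\<Sum>w\<in>W. p w * real (card {i. i < n \<and> t i w \<in> V' \<inter> Pow {..<m}}))"
    proof (subst sum.swap, intro sum.cong refl)
      fix w
      have "(\<Sum>i<n. indicator {e. cell m e \<in> V' \<inter> Pow {..<m}} (coord i w))
          = real (card ({..<n} \<inter> {i. t i w \<in> V' \<inter> Pow {..<m}}))"
        by (simp add: indicator_def t_def sum.If_cases)
      also have "{..<n} \<inter> {i. t i w \<in> V' \<inter> Pow {..<m}} = {i. i < n \<and> t i w \<in> V' \<inter> Pow {..<m}}" by auto
      finally show "(\<Sum>i<n. p w * indicator {e. cell m e \<in> V' \<inter> Pow {..<m}} (coord i w))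
          = p w * real (card {i. i < n \<and> t i w \<in> V' \<inter> Pow {..<m}})"
        by (simp flip: sum_distrib_left)
    qed
    ultimately show ?thesis using total[of "V' \<inter> Pow {..<m}"] by simp
  qed
  \<comment> \<open>Otherwise the indicator of the saturated cells would be a fractional cover of
    cost at most \<alpha>.\<close>
  have "\<alpha> < measure \<pi> {e. cell m e \<in> V}"
  proof (rule ccontr)
    assume "\<not> ?thesis"
    then have "fractional_cover n coord \<pi> A \<alpha> (indicator {e. cell m e \<in> V})"
      unfolding fractional_cover_def
    proof (intro conjI ballI allI)
      fix w assume "w \<in> A"
      then obtain w' where w': "w' \<in> W" "(\<lambda>i\<in>{..<n}. t i w) = (\<lambda>i\<in>{..<n}. t i w')"
        using W(3) by (metis (no_types, lifting) imageE imageI)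
      then have eq: "t i w = t i w'" if "i < n" for i
        using that by (metis lessThan_iff restrict_apply')
      obtain i where i: "i < n" "load n t W p (t i w) = cap (t i w)"
        using p(3)[OF w'(1)] eq by auto
      then have "cell m (coord i w) \<in> V" by (auto simp: V_def t_def cell_def)
      then have "1 \<le> (indicator {e. cell m e \<in> V} (coord i w) :: real)" by simp
      also have "\<dots> \<le> (\<Sum>i<n. indicator {e. cell m e \<in> V} (coord i w))"
        using i by (intro member_le_sum) auto
      finally show "1 \<le> (\<Sum>i<n. indicator {e. cell m e \<in> V} (coord i w) :: real)" .
    qed (use cell_sets in \<open>auto simp: indicator_def space\<close>)
    then show False using no_cover by blast
  qed
  also have "\<dots> = (\<Sum>v\<in>V. load n t W p v)" unfolding sum_cap[OF finV, symmetric] by (simp add: V_def)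
  also have "\<dots> = (\<Sum>w\<in>W. p w * real (card {i. i < n \<and> t i w \<in> V}))" by (rule sum_load[OF W(2) finV])
  \<comment> \<open>A point contributes at most \<open>n\<close> times to the load of
    \<open>V\<close>: this is where the factor \<open>n\<close> is lost.\<close>
  also have "\<dots> \<le> (\<Sum>w\<in>W. p w * real n)"
  proof (intro sum_mono mult_left_mono)
    fix w
    have "card {i. i < n \<and> t i w \<in> V} \<le> card {..<n}" by (intro card_mono) auto
    then show "real (card {i. i < n \<and> t i w \<in> V}) \<le> real n" by simp
  qed (rule p(1))
  also have "\<dots> = real n * (\<Sum>w\<in>W. p w)" by (simp add: sum_distrib_left mult.commute)
  finally have big: "\<alpha> < real n * (\<Sum>w\<in>W. p w)" .
  have "1 * (\<Sum>w\<in>W. p w) \<le> real n * (\<Sum>w\<in>W. p w)"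
    using n p(1) by (intro mult_right_mono sum_nonneg) auto
  also have "\<dots> \<le> 1"
    using marg[of UNIV] prob_space by (simp add: space)
  finally have "(\<Sum>w\<in>W. p w) \<le> 1" by simp
  with W(2,1) p(1) big show ?thesis using marg by (rule that)
qed

text \<open>A special case of Kellerer's theorem on null sets of multi-marginal problems.\<close>

proposition Kellerer_dichotomy:
  fixes \<pi> :: "(nat \<Rightarrow> bool) measure" and B :: "(nat \<times> nat \<Rightarrow> bool) set"
  assumes "prob_space \<pi>" and sets: "sets \<pi> = sets borel" and n: "0 < n" and B: "B \<in> sets borel"
    and not_null: "\<nexists>N. N \<in> null_sets \<pi> \<and> (\<forall>w\<in>B. \<exists>i<n. coord i w \<in> N)"
  obtains \<eta> where "sets \<eta> = sets borel" "finite_measure \<eta>" "emeasure \<eta> (- B) = 0" "emeasure \<eta> UNIV \<noteq> 0"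
    "\<And>D. D \<in> sets borel \<Longrightarrow> (\<Sum>i<n. emeasure \<eta> {w. coord i w \<in> D}) \<le> emeasure \<pi> D"
proof -
  interpret P: prob_space \<pi> by fact
  have space: "space \<pi> = UNIV" using sets_eq_imp_space_eq[OF sets] by simp
  obtain H :: "((nat \<times> nat \<Rightarrow> bool) \<times> (nat \<Rightarrow> nat)) set" where H: "closed H" "B = fst ` H"
    using borel_imp_analytic[OF B] by (auto simp: analytic_def)
  \<comment> \<open>Covers at all costs \<open>1 / Suc k\<close> would yield a cover of cost 0, by
    continuity along the constant sequence \<open>B\<close>, and hence the excluded null
    set.\<close>
  have "\<exists>k. \<nexists>f. fractional_cover n coord \<pi> B (1 / real (Suc k)) f"
  proof (rule ccontr)
    assume "\<not> ?thesis"
    then have "\<exists>f. fractional_cover n coord \<pi> (\<Union>k::nat. B) 0 f"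
      using LIMSEQ_inverse_real_of_nat
      by (intro fractional_cover_UN[OF assms(1), where L = "\<lambda>k. 1 / real (Suc k)"])
        (auto simp: decseq_def frac_le space inverse_eq_divide)
    then obtain f where "fractional_cover n coord \<pi> B 0 f" by auto
    then have "\<exists>N\<in>null_sets \<pi>. \<forall>w\<in>B. \<exists>i<n. coord i w \<in> N"
      by (rule fractional_cover_zero[OF assms(1)]) (simp add: space)
    with not_null show False by blast
  qed
  then obtain k0 where "\<nexists>f. fractional_cover n coord \<pi> (fst ` H) (1 / real (Suc k0)) f"
    using H(2) by auto
  moreover define \<alpha> where "\<alpha> = 1 / real (Suc k0)"
  ultimately have no_cover: "\<nexists>f. fractional_cover n coord \<pi> (fst ` H) \<alpha> f" by simp
  have \<alpha>: "0 < \<alpha>" by (simp add: \<alpha>_def)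
  obtain a where a: "\<And>k. \<nexists>f. fractional_cover n coord \<pi> (truncation H a k) \<alpha> f"
    by (rule truncation_bound_exists[OF assms(1) _ no_cover]) (auto simp: space)
  define packing where "packing m W p \<longleftrightarrow> finite W \<and> W \<subseteq> truncation H a m \<and> (\<forall>w. 0 \<le> p w) \<and>
    \<alpha> < real n * (\<Sum>w\<in>W. p w) \<and> (\<Sum>w\<in>W. p w) \<le> 1 \<and>
    (\<forall>V. (\<Sum>i<n. \<Sum>w\<in>W. p w * indicator {e. cell m e \<in> V} (coord i w)) \<le> measure \<pi> {e. cell m e \<in> V})"
    for m W and p :: "(nat \<times> nat \<Rightarrow> bool) \<Rightarrow> real"
  have "\<exists>W p. packing m W p" for m
    by (rule packing_of_uncovered[OF assms(1) sets n a[of m], of m]) (unfold packing_def, blast)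
  then obtain W p where "\<And>m. packing m (W m) (p m)" by metis
  then have Wp: "\<And>m. finite (W m)" "\<And>m. W m \<subseteq> truncation H a m" "\<And>m w. 0 \<le> p m w"
    "\<And>m. \<alpha> < real n * (\<Sum>w\<in>W m. p m w)" "\<And>m. (\<Sum>w\<in>W m. p m w) \<le> 1"
    "\<And>m V. (\<Sum>i<n. \<Sum>w\<in>W m. p m w * indicator {e. cell m e \<in> V} (coord i w)) \<le> measure \<pi> {e. cell m e \<in> V}"
    unfolding packing_def by blast+
  \<comment> \<open>Discrete measures given by the packings; their cluster point on cylinders is the
    desired measure on \<open>B\<close>.\<close>
  define \<eta>' where "\<eta>' m C = (\<Sum>w\<in>W m. p m w * indicator C w)" for m C
  have \<eta>'_le: "\<eta>' m C \<le> (\<Sum>w\<in>W m. p m w)" for m C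
    unfolding \<eta>'_def using Wp(3) by (intro sum_mono) (auto simp: indicator_def)
  obtain \<eta> r where \<eta>: "sets \<eta> = sets borel" "finite_measure \<eta>" "strict_mono (r :: nat \<Rightarrow> nat)"
    "\<And>C. C \<in> cylinders \<Longrightarrow> (\<lambda>k. \<eta>' (r k) C) \<longlonglongrightarrow> measure \<eta> C"
  proof (rule cylinder_limit_measure[of \<eta>' 1])
    fix m and C D :: "(nat \<times> nat \<Rightarrow> bool) set"
    show "0 \<le> \<eta>' m C" using Wp(3) by (auto simp: \<eta>'_def intro!: sum_nonneg)
    show "\<eta>' m C \<le> 1" using \<eta>'_le[of m C] Wp(5)[of m] by simp
    assume "C \<inter> D = {}"
    then show "\<eta>' m (C \<union> D) = \<eta>' m C + \<eta>' m D"
      by (simp add: \<eta>'_def indicator_disj_union ring_distribs sum.distrib)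
  qed (rule that)
  interpret E: finite_measure \<eta> by fact
  have r_ge: "k \<le> r k" for k using seq_suble[OF \<eta>(3)] .
  have pos: "emeasure \<eta> UNIV \<noteq> 0"
  proof -
    have "\<alpha> / real n \<le> measure \<eta> UNIV"
    proof (rule LIMSEQ_le_const)
      show "(\<lambda>k. \<eta>' (r k) UNIV) \<longlonglongrightarrow> measure \<eta> UNIV"
        by (rule \<eta>(4)) (rule algebra.top[OF algebra_cylinders])
      show "\<exists>N. \<forall>k\<ge>N. \<alpha> / real n \<le> \<eta>' (r k) UNIV"
        using Wp(4) n by (auto simp: \<eta>'_def field_simps intro: less_imp_le)
    qed
    then have "0 < measure \<eta> UNIV" using \<alpha> n by (smt (verit) divide_pos_pos of_nat_0_less_iff)
    then show ?thesis by (auto simp: measure_def)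
  qed
  \<comment> \<open>From stage \<open>k\<close> on all mass sits inside
    \<open>truncation H a k\<close>, so a cylinder missing this set has limit mass 0. By
    \<open>INT_closure_truncation\<close> the countably many such cylinders cover the complement of
    \<open>B\<close>.\<close>
  have null: "emeasure \<eta> C = 0" if "C \<in> cylinders" "C \<inter> truncation H a k = {}" for C k
  proof -
    have "eventually (\<lambda>j. \<eta>' (r j) C = 0) sequentially"
      using eventually_ge_at_top[of k]
    proof eventually_elim
      case (elim j)
      then have "truncation H a (r j) \<subseteq> truncation H a k"
        using r_ge[of j] by (intro truncation_antimono) simp
      then have "w \<notin> C" if "w \<in> W (r j)" for w
        using that Wp(2)[of "r j"] \<open>C \<inter> truncation H a k = {}\<close> by blast
      then show ?case by (auto simp: \<eta>'_def intro!: sum.neutral)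
    qed
    then have "measure \<eta> C = 0"
      using \<eta>(4)[OF that(1)] by (intro LIMSEQ_unique[OF _ tendsto_eventually]) auto
    then show ?thesis by (simp add: E.emeasure_eq_measure)
  qed
  define \<N> where "\<N> = {C \<in> cylinders. \<exists>k. C \<inter> truncation H a k = {}}"
  have "(\<Union>C\<in>\<N>. C) \<in> null_sets \<eta>"
  proof (rule null_sets_UN')
    show "countable \<N>" unfolding \<N>_def by (rule countable_subset[OF _ countable_cylinders]) auto
  qed (use null \<eta>(1) in \<open>auto simp: \<N>_def null_sets_def\<close>)
  moreover have "- B \<subseteq> (\<Union>C\<in>\<N>. C)"
  proof
    fix w assume "w \<in> - B"
    then obtain k where "w \<notin> closure (truncation H a k)"
      using INT_closure_truncation[OF H(1), of w a] H(2) by auto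
    then obtain C where "C \<in> cylinders" "w \<in> C" "C \<subseteq> - closure (truncation H a k)"
      using cylinder_neighbourhood_exists[of "- closure (truncation H a k)" w] by (auto simp: open_closed[symmetric] open_Compl)
    moreover have "C \<inter> truncation H a k = {}"
      using calculation(3) closure_subset[of "truncation H a k"] by blast
    ultimately show "w \<in> (\<Union>C\<in>\<N>. C)" by (auto simp: \<N>_def)
  qed
  moreover have "- B \<in> sets \<eta>" using B by (simp add: \<eta>(1) borel_comp)
  ultimately have "- B \<in> null_sets \<eta>" by (metis null_sets_subset)
  then have compl: "emeasure \<eta> (- B) = 0" by (rule null_setsD1)
  define M where "M i = distr \<eta> borel (coord i)" for i
  have coordm: "coord i \<in> \<eta> \<rightarrow>\<^sub>M borel" for i
    by (simp add: measurable_cong_sets[OF \<eta>(1) refl])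
  have spaceE: "space \<eta> = UNIV" using sets_eq_imp_space_eq[OF \<eta>(1)] by simp
  have M: "emeasure (M i) D = emeasure \<eta> {w. coord i w \<in> D}" if "D \<in> sets borel" for i D
    using that coordm by (simp add: M_def emeasure_distr spaceE vimage_def)
  obtain S where S: "sets S = sets borel" "\<And>D. D \<in> sets borel \<Longrightarrow> emeasure S D = (\<Sum>i<n. emeasure (M i) D)"
    using finite_sum_measure_exists[of "{..<n}" M borel] by (auto simp: M_def)
  have S_eq: "emeasure S D = (\<Sum>i<n. emeasure \<eta> {w. coord i w \<in> D})" if "D \<in> sets borel" for D
    using S(2)[OF that] M[OF that] by simp
  have S_real: "emeasure S D = ennreal (\<Sum>i<n. measure \<eta> {w. coord i w \<in> D})" if "D \<in> sets borel" for D
    unfolding S_eq[OF that] by (simp add: E.emeasure_eq_measure)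
  have "emeasure S D \<le> emeasure \<pi> D" if "D \<in> sets borel" for D
  proof (rule le_on_cylinders_imp_le[OF _ P.finite_measure_axioms S(1) sets _ that])
    show "finite_measure S"
      using S_real[of UNIV] sets_eq_imp_space_eq[OF S(1)] by (intro finite_measureI) simp
    fix C :: "(nat \<Rightarrow> bool) set" assume C: "C \<in> cylinders"
    \<comment> \<open>From level \<open>m0\<close> on, \<open>C\<close> is a union of cells, and the
      marginal bound of the packing applies to it without error.\<close>
    obtain m0 where m0: "\<And>m. m0 \<le> m \<Longrightarrow> \<exists>V. C = {e. cell m e \<in> V}"
      by (rule cylinder_eq_cells[OF C]) blast
    have "(\<Sum>i<n. measure \<eta> {w. coord i w \<in> C}) \<le> measure \<pi> C"
    proof (rule LIMSEQ_le_const2)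
      show "(\<lambda>k. \<Sum>i<n. \<eta>' (r k) {w. coord i w \<in> C}) \<longlonglongrightarrow> (\<Sum>i<n. measure \<eta> {w. coord i w \<in> C})"
        by (intro tendsto_sum \<eta>(4) coord_vimage_cylinder C)
      have "(\<Sum>i<n. \<eta>' (r k) {w. coord i w \<in> C}) \<le> measure \<pi> C" if "m0 \<le> k" for k
      proof -
        have "m0 \<le> r k" using that r_ge[of k] by (rule order.trans)
        then obtain V where V: "C = {e. cell (r k) e \<in> V}" using m0 by blast
        have "indicator {w. coord i w \<in> C} w = (indicator C (coord i w) :: real)" for i w
          by (simp add: indicator_def)
        then show ?thesis using Wp(6)[of "r k" V] by (simp add: \<eta>'_def flip: V)
      qed
      then show "\<exists>N. \<forall>k\<ge>N. (\<Sum>i<n. \<eta>' (r k) {w. coord i w \<in> C}) \<le> measure \<pi> C" by blast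
    qed
    moreover have "measure S C = (\<Sum>i<n. measure \<eta> {w. coord i w \<in> C})"
      unfolding measure_def[of S] S_real[OF cylinder_in_borel[OF C]]
      by (intro enn2real_ennreal sum_nonneg) simp
    ultimately show "measure S C \<le> measure \<pi> C" by simp
  qed
  then show ?thesis using that[OF \<eta>(1,2) compl pos] S_eq by simp
qed

section \<open>Optimal plans are monotone\<close>

lemma measurable_borel_bool:
  "f \<in> M \<rightarrow>\<^sub>M (borel :: bool measure) \<longleftrightarrow> f \<in> M \<rightarrow>\<^sub>M count_space UNIV"
  by (rule arg_cong[where f = "\<lambda>S. f \<in> S"], rule measurable_cong_sets) (simp_all add: sets_borel_bool)

text \<open>The bits of \<open>\<theta> z\<close> record which balls of radius
  \<open>(1/2)^m\<close> around a dense sequence contain \<open>z\<close>; \<sigma> picks for each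
  \<open>m\<close> the first such centre and takes the limit.\<close>

lemma Cantor_coding_exists:
  "\<exists>\<theta> \<sigma>. \<theta> \<in> borel \<rightarrow>\<^sub>M (borel :: (nat \<Rightarrow> bool) measure) \<and> \<sigma> \<in> borel \<rightarrow>\<^sub>M borel \<and>
    (\<forall>z :: 'a::polish_space. \<sigma> (\<theta> z) = z)"
proof -
  obtain D :: "'a set" where D: "countable D" "\<And>X. open X \<Longrightarrow> X \<noteq> {} \<Longrightarrow> \<exists>d\<in>D. d \<in> X"
    using countable_dense_exists by blast
  have "D \<noteq> {}" using D(2)[of UNIV] by auto
  define d where "d = from_nat_into D"
  have dense: "\<exists>k. dist z (d k) < e" if "0 < e" for z e
  proof -
    have "ball z e \<noteq> {}" using that by simp
    then obtain x where "x \<in> D" "x \<in> ball z e" using D(2)[OF open_ball] by blast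
    then show ?thesis using from_nat_into_surj[OF D(1)] by (auto simp: d_def)
  qed
  define \<theta> where "\<theta> z j = (case prod_decode j of (m, k) \<Rightarrow> dist z (d k) < (1/2)^m)" for z j
  define app where "app b m = d (LEAST k. b (prod_encode (m, k)))" for b :: "nat \<Rightarrow> bool" and m
  \<comment> \<open>The default \<open>d 0\<close> makes the sequence converge for every
    \<open>b\<close>, also outside the range of \<theta>, so that \<sigma> is a pointwise limit of
    measurable functions.\<close>
  define \<sigma> where "\<sigma> b = lim (\<lambda>m. if Cauchy (app b) then app b m else d 0)" for b
  have \<theta>m: "\<theta> \<in> borel \<rightarrow>\<^sub>M borel"
  proof (rule measurable_coordinatewise_then_product, unfold measurable_borel_bool)
    fix j
    show "(\<lambda>z. \<theta> z j) \<in> borel \<rightarrow>\<^sub>M count_space UNIV"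
      unfolding \<theta>_def by (cases "prod_decode j") simp
  qed
  have coordm: "(\<lambda>b. b j) \<in> borel \<rightarrow>\<^sub>M (count_space UNIV :: bool measure)" for j :: nat
    unfolding measurable_borel_bool[symmetric] by (rule measurable_product_coordinates)
  have appm[measurable]: "(\<lambda>b. app b m) \<in> borel_measurable borel" for m
    unfolding app_def
    by (rule measurable_compose[OF measurable_Least[OF coordm]]) simp
  have \<sigma>m: "\<sigma> \<in> borel \<rightarrow>\<^sub>M borel"
  proof (rule borel_measurable_LIMSEQ_metric)
    fix m
    show "(\<lambda>b. if Cauchy (app b) then app b m else d 0) \<in> borel_measurable borel"
      by (rule measurable_If) (auto intro: appm sets_Collect_Cauchy[of "\<lambda>m b. app b m" borel, simplified])
  next
    fix b :: "nat \<Rightarrow> bool"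
    show "(\<lambda>m. if Cauchy (app b) then app b m else d 0) \<longlonglongrightarrow> \<sigma> b"
      unfolding \<sigma>_def
      by (cases "Cauchy (app b)") (auto simp: Cauchy_convergent_iff convergent_LIMSEQ_iff[symmetric])
  qed
  have "\<sigma> (\<theta> z) = z" for z
  proof -
    have near: "dist (app (\<theta> z) m) z < (1/2)^m" for m
    proof -
      have "\<exists>k. \<theta> z (prod_encode (m, k))" using dense[of "(1/2)^m" z] by (simp add: \<theta>_def)
      then have "\<theta> z (prod_encode (m, LEAST k. \<theta> z (prod_encode (m, k))))" by (rule LeastI_ex)
      then show ?thesis by (simp add: \<theta>_def app_def dist_commute)
    qed
    have "app (\<theta> z) \<longlonglongrightarrow> z"
      by (rule metric_tendsto_imp_tendsto[of "\<lambda>m. (1/2::real)^m" 0])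
        (use near in \<open>auto intro!: always_eventually LIMSEQ_power_zero less_imp_le\<close>)
    then show ?thesis unfolding \<sigma>_def by (auto simp: LIMSEQ_imp_Cauchy limI)
  qed
  with \<theta>m \<sigma>m show ?thesis by blast
qed

lemma borel_measurable_fst [measurable]:
  "fst \<in> (borel :: ('a::topological_space \<times> 'b::topological_space) measure) \<rightarrow>\<^sub>M borel"
  by (intro borel_measurable_continuous_onI continuous_on_fst continuous_on_id)

lemma borel_measurable_snd [measurable]:
  "snd \<in> (borel :: ('a::topological_space \<times> 'b::topological_space) measure) \<rightarrow>\<^sub>M borel"
  by (intro borel_measurable_continuous_onI continuous_on_snd continuous_on_id)

lemma bij_betw_Suc_mod: "bij_betw (\<lambda>i. Suc i mod n) {..<n} {..<n}"
proof (cases "n = 0")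
  case False
  have "inj_on (\<lambda>i. Suc i mod n) {..<n}"
    by (rule inj_onI) (auto simp: mod_Suc split: if_splits)
  moreover have "(\<lambda>i. Suc i mod n) ` {..<n} \<subseteq> {..<n}" using False by auto
  ultimately show ?thesis by (simp add: bij_betw_def endo_inj_surj)
qed (simp add: bij_betw_def)

lemma transport_plansD:
  assumes "\<pi> \<in> transport_plans \<mu> \<nu>"
  shows "prob_space \<pi>" "sets \<pi> = sets borel" "space \<pi> = UNIV"
    "distr \<pi> borel fst = \<mu>" "distr \<pi> borel snd = \<nu>"
  using assms sets_eq_imp_space_eq[of \<pi> borel] by (auto simp: transport_plans_def)

text \<open>A measure \<open>\<eta>\<close> charging only cycles that violate monotonicity yields a cheaper plan: remove
  the pairs of the cycles from \<open>\<pi>\<close> and add the shifted pairs.\<close>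

lemma cyclic_shift_improves:
  fixes \<mu> :: "'a::polish_space measure" and \<nu> :: "'b::polish_space measure"
    and c :: "'a \<times> 'b \<Rightarrow> ennreal" and z :: "nat \<Rightarrow> 'w \<Rightarrow> 'a \<times> 'b"
  assumes plan: "\<pi> \<in> transport_plans \<mu> \<nu>" and fin: "transport_cost c \<pi> < \<infinity>"
    and c[measurable]: "c \<in> borel_measurable borel"
    and "finite_measure \<eta>" and nonzero: "emeasure \<eta> (space \<eta>) \<noteq> 0"
    and z[measurable]: "\<And>i. z i \<in> \<eta> \<rightarrow>\<^sub>M borel"
    and dom: "\<And>D. D \<in> sets borel \<Longrightarrow> (\<Sum>i<n. emeasure \<eta> (z i -` D \<inter> space \<eta>)) \<le> emeasure \<pi> D"
    and violated: "AE w in \<eta>. (\<Sum>i<n. c (fst (z i w), snd (z (Suc i mod n) w))) < (\<Sum>i<n. c (z i w))"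
  shows "\<exists>\<pi>'\<in>transport_plans \<mu> \<nu>. transport_cost c \<pi>' < transport_cost c \<pi>"
proof -
  interpret E: finite_measure \<eta> by fact
  interpret P: prob_space \<pi> using transport_plansD(1)[OF plan] .
  note sets = transport_plansD(2)[OF plan]
  define sh where "sh i w = (fst (z i w), snd (z (Suc i mod n) w))" for i w
  have fz[measurable]: "(\<lambda>w. fst (z i w)) \<in> \<eta> \<rightarrow>\<^sub>M borel" "(\<lambda>w. snd (z i w)) \<in> \<eta> \<rightarrow>\<^sub>M borel" for i
    by (rule measurable_compose[OF z], measurable)+
  have sh[measurable]: "sh i \<in> \<eta> \<rightarrow>\<^sub>M borel" for i
    unfolding sh_def by (rule borel_measurable_Pair) measurable
  define Z where "Z i = distr \<eta> borel (z i)" for i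
  obtain S where S: "sets S = sets borel" "\<And>D. D \<in> sets borel \<Longrightarrow> emeasure S D = (\<Sum>i<n. emeasure (Z i) D)"
    using finite_sum_measure_exists[of "{..<n}" Z borel] by (auto simp: Z_def)
  have Zi: "emeasure (Z i) D = emeasure \<eta> (z i -` D \<inter> space \<eta>)" if "D \<in> sets borel" for i D
    using that by (simp add: Z_def emeasure_distr)
  have S_le: "emeasure S D \<le> emeasure \<pi> D" if "D \<in> sets borel" for D
    using dom[OF that] S(2)[OF that] Zi[OF that] by simp
  have spaceS: "space S = UNIV" using sets_eq_imp_space_eq[OF S(1)] by simp
  have finS: "finite_measure S"
    using S_le[of UNIV] P.emeasure_finite[of UNIV] by (intro finite_measureI) (auto simp: spaceS top_unique)
  define R where "R = diff_measure \<pi> S"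
  have setsR: "sets R = sets borel" by (simp add: R_def sets)
  have R: "emeasure R D = emeasure \<pi> D - emeasure S D" if "D \<in> sets borel" for D
    unfolding R_def using that S_le S(1) sets
    by (intro emeasure_diff_measure finS P.finite_measure_axioms) auto
  \<comment> \<open>Index \<open>n\<close> carries the remainder \<open>R\<close>, the indices below
    \<open>n\<close> carry pushforwards of \<eta>. The choice \<open>sel = z\<close> gives back
    \<pi>, the choice \<open>sel = sh\<close> gives the competitor, so both share one cost
    formula.\<close>
  define M where "M sel i = (if i < n then distr \<eta> borel (sel i) else R)" for sel :: "nat \<Rightarrow> 'w \<Rightarrow> 'a \<times> 'b" and i
  have setsM: "sets (M sel i) = sets borel" for sel i by (simp add: M_def setsR)
  have split: "{..n} = insert n {..<n}" by auto
  have ex: "\<exists>Q. sets Q = sets borel \<and>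
      (\<forall>D\<in>sets borel. emeasure Q D = emeasure R D + (\<Sum>i<n. emeasure \<eta> (sel i -` D \<inter> space \<eta>))) \<and>
      nn_integral Q c = nn_integral R c + (\<Sum>i<n. \<integral>\<^sup>+w. c (sel i w) \<partial>\<eta>)"
    if [measurable]: "\<And>i. sel i \<in> \<eta> \<rightarrow>\<^sub>M borel" for sel
  proof -
    obtain Q where Q: "sets Q = sets borel"
      "\<And>D. D \<in> sets borel \<Longrightarrow> emeasure Q D = (\<Sum>i\<in>{..n}. emeasure (M sel i) D)"
      "\<And>f. f \<in> borel_measurable borel \<Longrightarrow> nn_integral Q f = (\<Sum>i\<in>{..n}. nn_integral (M sel i) f)"
      using finite_sum_measure_exists[of "{..n}" "M sel" borel] setsM by auto
    have "emeasure Q D = emeasure R D + (\<Sum>i<n. emeasure \<eta> (sel i -` D \<inter> space \<eta>))" if "D \<in> sets borel" for D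
      using Q(2)[OF that] that by (simp add: split M_def emeasure_distr)
    moreover have "nn_integral Q c = nn_integral R c + (\<Sum>i<n. \<integral>\<^sup>+w. c (sel i w) \<partial>\<eta>)"
      using Q(3)[OF c] by (simp add: split M_def nn_integral_distr)
    ultimately show ?thesis using Q(1) by blast
  qed
  obtain Q where Q: "sets Q = sets borel"
    "\<And>D. D \<in> sets borel \<Longrightarrow> emeasure Q D = emeasure R D + (\<Sum>i<n. emeasure \<eta> (z i -` D \<inter> space \<eta>))"
    "nn_integral Q c = nn_integral R c + (\<Sum>i<n. \<integral>\<^sup>+w. c (z i w) \<partial>\<eta>)"
    using ex[of z] z by blast
  have "Q = \<pi>"
  proof (rule measure_eqI)
    show "sets Q = sets \<pi>" by (simp add: Q(1) sets)
    fix D assume "D \<in> sets Q"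
    then have D: "D \<in> sets borel" by (simp add: Q(1))
    have "emeasure Q D = emeasure \<pi> D - emeasure S D + emeasure S D"
      using Q(2)[OF D] R[OF D] S(2)[OF D] Zi[OF D] by simp
    also have "\<dots> = emeasure \<pi> D"
      using S_le[OF D] by (rule diff_add_cancel_ennreal)
    finally show "emeasure Q D = emeasure \<pi> D" .
  qed
  obtain \<pi>' where \<pi>': "sets \<pi>' = sets borel"
    "\<And>D. D \<in> sets borel \<Longrightarrow> emeasure \<pi>' D = emeasure R D + (\<Sum>i<n. emeasure \<eta> (sh i -` D \<inter> space \<eta>))"
    "nn_integral \<pi>' c = nn_integral R c + (\<Sum>i<n. \<integral>\<^sup>+w. c (sh i w) \<partial>\<eta>)"
    using ex[of sh] sh by blast
  have space': "space \<pi>' = UNIV" using sets_eq_imp_space_eq[OF \<pi>'(1)] by simp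
  note space = transport_plansD(3)[OF plan]
  have fst_sets: "fst -` A \<in> sets (borel :: ('a \<times> 'b) measure)" if "A \<in> sets borel" for A
    using measurable_sets[OF borel_measurable_fst that] by simp
  have snd_sets: "snd -` A \<in> sets (borel :: ('a \<times> 'b) measure)" if "A \<in> sets borel" for A
    using measurable_sets[OF borel_measurable_snd that] by simp
  have m1: "emeasure \<pi>' (fst -` A) = emeasure \<pi> (fst -` A)" if "A \<in> sets borel" for A
    using \<pi>'(2)[OF fst_sets[OF that]] Q(2)[OF fst_sets[OF that]] unfolding \<open>Q = \<pi>\<close>
    by (simp add: sh_def vimage_def)
  \<comment> \<open>The cyclic shift permutes the indices and so preserves the sum of the second
    marginals; the first coordinates are not moved at all.\<close>
  have m2: "emeasure \<pi>' (snd -` A) = emeasure \<pi> (snd -` A)" if "A \<in> sets borel" for A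
  proof -
    have "(\<Sum>i<n. emeasure \<eta> (sh i -` (snd -` A) \<inter> space \<eta>))
        = (\<Sum>i<n. emeasure \<eta> (z (Suc i mod n) -` (snd -` A) \<inter> space \<eta>))"
      by (simp add: sh_def vimage_def)
    also have "\<dots> = (\<Sum>i<n. emeasure \<eta> (z i -` (snd -` A) \<inter> space \<eta>))"
      by (rule sum.reindex_bij_betw[OF bij_betw_Suc_mod])
    finally show ?thesis
      using \<pi>'(2)[OF snd_sets[OF that]] Q(2)[OF snd_sets[OF that]] unfolding \<open>Q = \<pi>\<close> by simp
  qed
  have "distr \<pi>' borel fst = distr \<pi> borel fst"
    by (rule measure_eqI)
      (simp_all add: emeasure_distr measurable_cong_sets[OF \<pi>'(1) refl] measurable_cong_sets[OF sets refl] space space' m1)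
  moreover have "distr \<pi>' borel snd = distr \<pi> borel snd"
    by (rule measure_eqI)
      (simp_all add: emeasure_distr measurable_cong_sets[OF \<pi>'(1) refl] measurable_cong_sets[OF sets refl] space space' m2)
  moreover have "prob_space \<pi>'"
    using m1[of UNIV] P.emeasure_space_1 by (intro prob_spaceI) (simp add: space space')
  ultimately have "\<pi>' \<in> transport_plans \<mu> \<nu>"
    using transport_plansD(4,5)[OF plan] \<pi>'(1) by (simp add: transport_plans_def)
  moreover have "transport_cost c \<pi>' < transport_cost c \<pi>"
  proof -
    have cost: "transport_cost c \<pi> = nn_integral R c + (\<integral>\<^sup>+w. (\<Sum>i<n. c (z i w)) \<partial>\<eta>)"
      using Q(3) unfolding \<open>Q = \<pi>\<close> transport_cost_def by (subst nn_integral_sum) auto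
    have cost': "transport_cost c \<pi>' = nn_integral R c + (\<integral>\<^sup>+w. (\<Sum>i<n. c (sh i w)) \<partial>\<eta>)"
      using \<pi>'(3) unfolding transport_cost_def by (subst nn_integral_sum) auto
    \<comment> \<open>Finiteness of the plan is what allows the common part to be cancelled and the
      strict inequality to be integrated.\<close>
    have finR: "nn_integral R c < top" "(\<integral>\<^sup>+w. (\<Sum>i<n. c (z i w)) \<partial>\<eta>) < top"
      using fin cost by (auto simp: less_top)
    have le: "(\<integral>\<^sup>+w. (\<Sum>i<n. c (sh i w)) \<partial>\<eta>) \<le> (\<integral>\<^sup>+w. (\<Sum>i<n. c (z i w)) \<partial>\<eta>)"
      using violated by (intro nn_integral_mono_AE) (auto simp: sh_def)
    have "(\<integral>\<^sup>+w. (\<Sum>i<n. c (sh i w)) \<partial>\<eta>) < (\<integral>\<^sup>+w. (\<Sum>i<n. c (z i w)) \<partial>\<eta>)"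
    proof (rule nn_integral_less)
      show "(\<integral>\<^sup>+w. (\<Sum>i<n. c (sh i w)) \<partial>\<eta>) \<noteq> \<infinity>" using le finR(2) by (auto simp: top_unique)
      show "AE w in \<eta>. (\<Sum>i<n. c (sh i w)) \<le> (\<Sum>i<n. c (z i w))"
        using violated by (auto simp: sh_def)
      show "\<not> (AE w in \<eta>. (\<Sum>i<n. c (z i w)) \<le> (\<Sum>i<n. c (sh i w)))"
      proof
        assume "AE w in \<eta>. (\<Sum>i<n. c (z i w)) \<le> (\<Sum>i<n. c (sh i w))"
        with violated have "AE w in \<eta>. False"
          by eventually_elim (simp add: sh_def)
        then show False using nonzero by (simp add: AE_iff_measurable[OF sets.top])
      qed
    qed measurable
    then show ?thesis unfolding cost cost' using finR(1) by (simp add: ennreal_add_left_cancel_less)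
  qed
  ultimately show ?thesis by blast
qed

theorem optimal_imp_c_monotone:
  fixes \<mu> :: "'a::polish_space measure" and \<nu> :: "'b::polish_space measure"
    and c :: "'a \<times> 'b \<Rightarrow> ennreal"
  assumes c[measurable]: "c \<in> borel_measurable borel"
    and fin: "finite_plan \<mu> \<nu> c \<pi>" and opt: "optimal_plan \<mu> \<nu> c \<pi>"
  shows "c_monotone_plan \<mu> \<nu> c \<pi>"
proof -
  have plan: "\<pi> \<in> transport_plans \<mu> \<nu>" and cost: "transport_cost c \<pi> < \<infinity>"
    using fin by (auto simp: finite_plan_def)
  have best: "transport_cost c \<pi> \<le> transport_cost c \<pi>'" if "\<pi>' \<in> transport_plans \<mu> \<nu>" for \<pi>'
    using opt that by (simp add: optimal_plan_def)
  note sets = transport_plansD(2)[OF plan] and space = transport_plansD(3)[OF plan]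
  interpret P: prob_space \<pi> using transport_plansD(1)[OF plan] .
  obtain \<theta> :: "'a \<times> 'b \<Rightarrow> nat \<Rightarrow> bool" and \<sigma> where
    \<theta>: "\<theta> \<in> borel \<rightarrow>\<^sub>M borel" and \<sigma>: "\<sigma> \<in> borel \<rightarrow>\<^sub>M borel" and \<sigma>\<theta>: "\<And>z. \<sigma> (\<theta> z) = z"
    using Cantor_coding_exists[where 'a = "'a \<times> 'b"] by blast
  have \<theta>': "\<theta> \<in> \<pi> \<rightarrow>\<^sub>M borel" using \<theta> by (simp add: measurable_cong_sets[OF sets refl])
  define \<rho> where "\<rho> = distr \<pi> borel \<theta>"
  have \<rho>: "prob_space \<rho>" "sets \<rho> = sets borel"
    unfolding \<rho>_def using \<theta>' by (auto intro: P.prob_space_distr)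
  define z where "z i w = \<sigma> (coord i w)" for i w
  have z[measurable]: "z i \<in> borel \<rightarrow>\<^sub>M borel" for i
    unfolding z_def by (rule measurable_compose[OF coord_measurable \<sigma>])
  have fz[measurable]: "(\<lambda>w. fst (z i w)) \<in> borel \<rightarrow>\<^sub>M borel" "(\<lambda>w. snd (z i w)) \<in> borel \<rightarrow>\<^sub>M borel" for i
    by (rule measurable_compose[OF z], measurable)+
  \<comment> \<open>Arrays whose first \<open>n\<close> rows decode to a cycle violating
    monotonicity.\<close>
  define B where "B n = {w. (\<Sum>i<n. c (fst (z i w), snd (z (Suc i mod n) w))) < (\<Sum>i<n. c (z i w))}" for n
  have sh[measurable]: "(\<lambda>w. (fst (z i w), snd (z j w))) \<in> borel \<rightarrow>\<^sub>M borel" for i j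
    by (rule borel_measurable_Pair) measurable
  have B: "B n \<in> sets borel" for n
  proof -
    have "{w \<in> space borel. (\<Sum>i<n. c (fst (z i w), snd (z (Suc i mod n) w))) < (\<Sum>i<n. c (z i w))} \<in> sets borel"
      by measurable
    then show ?thesis by (simp add: B_def)
  qed
  \<comment> \<open>The length is \<open>Suc n\<close> because the dichotomy needs at least one
    coordinate; the empty cycle is trivial.\<close>
  have "\<exists>N. N \<in> null_sets \<rho> \<and> (\<forall>w\<in>B (Suc n). \<exists>i<Suc n. coord i w \<in> N)" for n
  proof (rule ccontr)
    assume "\<not> ?thesis"
    then obtain \<eta> where \<eta>: "sets \<eta> = sets borel" "finite_measure \<eta>" "emeasure \<eta> (- B (Suc n)) = 0" "emeasure \<eta> UNIV \<noteq> 0"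
      "\<And>D. D \<in> sets borel \<Longrightarrow> (\<Sum>i<Suc n. emeasure \<eta> {w. coord i w \<in> D}) \<le> emeasure \<rho> D"
      by (rule Kellerer_dichotomy[OF \<rho> zero_less_Suc B]) (rule that)
    have space\<eta>: "space \<eta> = UNIV" using sets_eq_imp_space_eq[OF \<eta>(1)] by simp
    have "\<exists>\<pi>'\<in>transport_plans \<mu> \<nu>. transport_cost c \<pi>' < transport_cost c \<pi>"
    proof (rule cyclic_shift_improves[OF plan cost c \<eta>(2), where z = z and n = "Suc n"])
      show "emeasure \<eta> (space \<eta>) \<noteq> 0" using \<eta>(4) by (simp add: space\<eta>)
      show "z i \<in> \<eta> \<rightarrow>\<^sub>M borel" for i using z by (simp add: measurable_cong_sets[OF \<eta>(1) refl])
      have "- B (Suc n) \<in> null_sets \<eta>"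
        using \<eta>(3) B by (intro null_setsI) (auto simp: \<eta>(1) borel_comp)
      then show "AE w in \<eta>. (\<Sum>i<Suc n. c (fst (z i w), snd (z (Suc i mod Suc n) w))) < (\<Sum>i<Suc n. c (z i w))"
        by (rule AE_I') (auto simp: B_def)
      fix D :: "('a \<times> 'b) set" assume D: "D \<in> sets borel"
      have \<sigma>D: "\<sigma> -` D \<in> sets borel" using measurable_sets[OF \<sigma> D] by simp
      have "(\<Sum>i<Suc n. emeasure \<eta> (z i -` D \<inter> space \<eta>)) = (\<Sum>i<Suc n. emeasure \<eta> {w. coord i w \<in> \<sigma> -` D})"
        by (simp add: space\<eta> z_def vimage_def)
      also have "\<dots> \<le> emeasure \<rho> (\<sigma> -` D)" by (rule \<eta>(5)[OF \<sigma>D])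
      also have "\<dots> = emeasure \<pi> D"
        unfolding \<rho>_def using \<sigma>D \<theta>' by (simp add: emeasure_distr space vimage_def \<sigma>\<theta>)
      finally show "(\<Sum>i<Suc n. emeasure \<eta> (z i -` D \<inter> space \<eta>)) \<le> emeasure \<pi> D" .
    qed
    then show False using best by (auto simp: not_le[symmetric])
  qed
  then obtain N where N: "\<And>n. N n \<in> null_sets \<rho>" "\<And>n w. w \<in> B (Suc n) \<Longrightarrow> \<exists>i<Suc n. coord i w \<in> N n"
    by metis
  define M where "M = (\<Union>n. N n)"
  have M: "M \<in> null_sets \<rho>" unfolding M_def using N(1) by auto
  have Mb: "M \<in> sets borel" using M \<rho>(2) by auto
  define \<Gamma> where "\<Gamma> = \<theta> -` (- M)"
  have \<Gamma>b: "\<Gamma> \<in> sets borel"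
    unfolding \<Gamma>_def using measurable_sets[OF \<theta>, of "- M"] Mb by (simp add: borel_comp)
  have "emeasure \<rho> (- M) = 1"
  proof -
    have "emeasure \<rho> (space \<rho> - M) = emeasure \<rho> (space \<rho>)"
      using M by (rule emeasure_Diff_null_set) simp
    then show ?thesis
      using prob_space.emeasure_space_1[OF \<rho>(1)] sets_eq_imp_space_eq[OF \<rho>(2)]
      by (simp add: Compl_eq_Diff_UNIV)
  qed
  then have "emeasure \<pi> \<Gamma> = 1"
    unfolding \<rho>_def \<Gamma>_def using \<theta>' Mb by (simp add: emeasure_distr space borel_comp)
  moreover have "c_monotone_set c \<Gamma>"
    unfolding c_monotone_set_def
  proof (intro conjI allI impI \<Gamma>b)
    fix n and x :: "nat \<Rightarrow> 'a" and y :: "nat \<Rightarrow> 'b"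
    assume xy: "\<forall>i<n. (x i, y i) \<in> \<Gamma>"
    show "(\<Sum>i<n. c (x i, y i)) \<le> (\<Sum>i<n. c (x i, y (Suc i mod n)))"
    proof (cases n)
      case (Suc m)
      \<comment> \<open>The cycle is coded by an array; a violation would put one of its rows into
        the null set that \<Gamma> avoids.\<close>
      define w where "w = (\<lambda>(i, k). \<theta> (x i, y i) k)"
      have coord: "coord i w = \<theta> (x i, y i)" for i by (simp add: coord_def w_def)
      then have z: "z i w = (x i, y i)" for i by (simp add: z_def \<sigma>\<theta>)
      have "w \<notin> B n"
      proof
        assume "w \<in> B n"
        then obtain i where "i < n" "\<theta> (x i, y i) \<in> N m" using N(2)[of w m] Suc by (auto simp: coord)
        then show False using xy by (auto simp: \<Gamma>_def M_def)
      qed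
      then show ?thesis by (simp add: B_def z)
    qed simp
  qed
  ultimately show ?thesis using plan by (auto simp: c_monotone_plan_def)
qed

section \<open>Stationary chains with prescribed transitions\<close>

lemma countable_prob_imp_pmf:
  fixes M :: "'a::countable measure"
  assumes "prob_space M" "sets M = UNIV"
  shows "\<exists>p. measure_pmf p = M"
proof -
  interpret prob_space M by fact
  have "(\<Union>x\<in>{x. measure M {x} = 0}. {x}) \<in> null_sets M"
    using assms(2) by (intro null_sets_UN') (auto simp: emeasure_eq_measure null_sets_def)
  then have "AE x in M. measure M {x} \<noteq> 0"
    by (rule AE_I') auto
  then show ?thesis
    using assms by (intro exI[of _ "Abs_pmf M"] Abs_pmf_inverse) auto
qed

text \<open>Conditional law of the next state. It is unspecified for states outside the support of
  the first marginal, which a chain with matching marginals does not visit.\<close>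

definition next_pmf :: "('s \<times> 's) pmf \<Rightarrow> 's \<Rightarrow> 's pmf" where
  "next_pmf q s = map_pmf snd (cond_pmf q {p. fst p = s})"

lemma bind_next_pmf: "bind_pmf (map_pmf fst q) (\<lambda>s. map_pmf (Pair s) (next_pmf q s)) = q"
proof -
  have "bind_pmf (map_pmf fst q) (\<lambda>s. map_pmf (Pair s) (next_pmf q s))
      = bind_pmf (map_pmf fst q) (\<lambda>s. cond_pmf q {p. s = fst p})"
  proof (rule bind_pmf_cong[OF refl])
    fix s assume "s \<in> set_pmf (map_pmf fst q)"
    then have ne: "set_pmf q \<inter> {p. fst p = s} \<noteq> {}" by auto
    have "map_pmf (Pair s) (next_pmf q s) = map_pmf (\<lambda>p. (s, snd p)) (cond_pmf q {p. fst p = s})"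
      by (simp add: next_pmf_def pmf.map_comp comp_def)
    also have "\<dots> = map_pmf id (cond_pmf q {p. fst p = s})"
      by (rule map_pmf_cong[OF refl]) (auto simp: set_cond_pmf[OF ne])
    finally show "map_pmf (Pair s) (next_pmf q s) = cond_pmf q {p. s = fst p}"
      by (simp add: eq_commute[of s])
  qed
  also have "\<dots> = q"
    by (rule bind_cond_pmf_cancel) (auto simp: vimage_def eq_commute)
  finally show ?thesis .
qed

text \<open>Entries after \<open>n\<close> hold the initial state as filler, so that paths of all
  lengths have one type.\<close>

fun path_pmf :: "(nat \<Rightarrow> ('s \<times> 's) pmf) \<Rightarrow> nat \<Rightarrow> (nat \<Rightarrow> 's) pmf" where
  "path_pmf q 0 = map_pmf (\<lambda>s _. s) (map_pmf fst (q 0))"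
| "path_pmf q (Suc n) = bind_pmf (path_pmf q n) (\<lambda>w. map_pmf (\<lambda>s. w(Suc n := s)) (next_pmf (q n) (w n)))"

text \<open>By induction the current state has the first marginal of \<open>q n\<close>, so drawing
  from the conditional law reproduces \<open>q n\<close> as the joint law of the step.\<close>

lemma path_pmf_marginals:
  assumes "\<And>i. map_pmf snd (q i) = map_pmf fst (q (Suc i))"
  shows "map_pmf (\<lambda>w. w n) (path_pmf q n) = map_pmf fst (q n) \<and>
    (\<forall>i<n. map_pmf (\<lambda>w. (w i, w (Suc i))) (path_pmf q n) = q i)"
proof (induction n)
  case 0
  show ?case by (simp add: pmf.map_comp comp_def)
next
  case (Suc n)
  have last: "map_pmf (\<lambda>w. (w n, w (Suc n))) (path_pmf q (Suc n)) = q n"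
  proof -
    have "map_pmf (\<lambda>w. (w n, w (Suc n))) (path_pmf q (Suc n))
        = bind_pmf (path_pmf q n) (\<lambda>w. map_pmf (Pair (w n)) (next_pmf (q n) (w n)))"
      by (simp add: map_bind_pmf pmf.map_comp comp_def)
    also have "\<dots> = bind_pmf (map_pmf (\<lambda>w. w n) (path_pmf q n)) (\<lambda>s. map_pmf (Pair s) (next_pmf (q n) s))"
      by (simp add: bind_map_pmf)
    also have "\<dots> = q n" using Suc by (simp add: bind_next_pmf)
    finally show ?thesis .
  qed
  have "map_pmf (\<lambda>w. w (Suc n)) (path_pmf q (Suc n)) = map_pmf snd (map_pmf (\<lambda>w. (w n, w (Suc n))) (path_pmf q (Suc n)))"
    by (simp add: pmf.map_comp comp_def del: path_pmf.simps)
  also have "\<dots> = map_pmf fst (q (Suc n))" unfolding last by (rule assms)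
  finally have 1: "map_pmf (\<lambda>w. w (Suc n)) (path_pmf q (Suc n)) = map_pmf fst (q (Suc n))" .
  have "map_pmf (\<lambda>w. (w i, w (Suc i))) (path_pmf q (Suc n)) = q i" if "i < Suc n" for i
  proof (cases "i = n")
    case False
    then have "i < n" using that by simp
    then have "map_pmf (\<lambda>w. (w i, w (Suc i))) (path_pmf q (Suc n)) = map_pmf (\<lambda>w. (w i, w (Suc i))) (path_pmf q n)"
      by (simp add: map_bind_pmf pmf.map_comp comp_def map_pmf_def bind_return_pmf bind_assoc_pmf)
    then show ?thesis using Suc \<open>i < n\<close> by simp
  qed (simp add: last del: path_pmf.simps)
  with 1 show ?case by blast
qed

section \<open>From words to chains in the Cantor space\<close>

definition word :: "nat \<Rightarrow> (nat \<Rightarrow> bool) \<Rightarrow> bool list" where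
  "word m e = map e [0..<m]"

definition unword :: "bool list \<Rightarrow> nat \<Rightarrow> bool" where
  "unword l k \<longleftrightarrow> k < length l \<and> l ! k"

lemma unword_word: "k < m \<Longrightarrow> unword (word m e) k = e k"
  by (simp add: unword_def word_def)

text \<open>A cylinder reads finitely many bits, so the \<open>False\<close> padding of
  \<open>unword\<close> becomes invisible once \<open>m\<close> exceeds them.\<close>

lemma cylinder_unword_word:
  assumes "D \<in> cylinders"
  obtains m0 where "\<And>m e. m0 \<le> m \<Longrightarrow> unword (word m e) \<in> D \<longleftrightarrow> e \<in> D"
proof -
  obtain I where I: "finite I" "\<And>w w'. (\<And>i. i \<in> I \<Longrightarrow> w i = w' i) \<Longrightarrow> w \<in> D \<longleftrightarrow> w' \<in> D"
    using assms by (rule cylindersE) blast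
  obtain m0 where m0: "I \<subseteq> {..<m0}" using finite_nat_bounded[OF I(1)] by auto
  have "unword (word m e) \<in> D \<longleftrightarrow> e \<in> D" if "m0 \<le> m" for m e
  proof (rule I(2))
    fix i assume "i \<in> I"
    then have "i < m" using m0 that by auto
    then show "unword (word m e) i = e i" by (rule unword_word)
  qed
  then show ?thesis by (rule that)
qed

lemma word_measurable [measurable]: "word m \<in> borel \<rightarrow>\<^sub>M count_space UNIV"
proof (subst measurable_count_space_eq2_countable, intro conjI ballI)
  fix l :: "bool list"
  have "word m -` {l} \<in> cylinders"
  proof (rule cylindersI[of "{..<m}"])
    fix w w' :: "nat \<Rightarrow> bool" assume *: "\<And>i. i \<in> {..<m} \<Longrightarrow> w i = w' i" "w \<in> word m -` {l}"
    have "word m w = word m w'" unfolding word_def using *(1) by (intro map_cong) auto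
    then show "w' \<in> word m -` {l}" using *(2) by simp
  qed simp
  then show "word m -` {l} \<inter> space borel \<in> sets borel" by (simp add: cylinder_in_borel)
qed auto

lemma borel_Cantor_square_generator:
  "sets (borel :: ((nat \<Rightarrow> bool) \<times> (nat \<Rightarrow> bool)) measure)
     = sigma_sets UNIV {A \<times> B | A B. A \<in> cylinders \<and> B \<in> cylinders}"
proof -
  have top: "(UNIV :: (nat \<Rightarrow> bool) set) \<in> cylinders" by (rule algebra.top[OF algebra_cylinders])
  have "sets ((borel :: (nat \<Rightarrow> bool) measure) \<Otimes>\<^sub>M (borel :: (nat \<Rightarrow> bool) measure))
     = sets (sigma (space borel \<times> space borel) {A \<times> B | A B. A \<in> cylinders \<and> B \<in> cylinders})"
    by (rule sets_pair_eq[where Ca = "{UNIV}" and Cb = "{UNIV}"]) (auto simp: sets_borel_fun_bool top)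
  then show ?thesis unfolding borel_prod by simp
qed

text \<open>Gluing by discretisation: the laws of the \<open>m\<close>-bit words admit an explicit
  Markov chain, and a limit on cylinders is taken as \<open>m\<close> grows. On a rectangle of
  cylinders the prescribed law of a step holds exactly from some \<open>m\<close> on, which
  identifies it in the limit.\<close>

theorem Cantor_chain_exists:
  fixes q :: "nat \<Rightarrow> ((nat \<Rightarrow> bool) \<times> (nat \<Rightarrow> bool)) measure"
  assumes prob: "\<And>i. prob_space (q i)" and sets: "\<And>i. sets (q i) = sets borel"
    and match: "\<And>i. distr (q i) borel snd = distr (q (Suc i)) borel fst"
  obtains P where "prob_space P" "sets P = sets borel"
    "\<And>i. distr P borel (\<lambda>w. (coord i w, coord (Suc i) w)) = q i"
proof -
  have space: "space (q i) = UNIV" for i using sets_eq_imp_space_eq[OF sets] by simp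
  define words where "words m p = (word m (fst p), word m (snd p))" for m p
  have meas: "f \<in> q i \<rightarrow>\<^sub>M N" if "f \<in> borel \<rightarrow>\<^sub>M N" for i f and N :: "'x measure"
    using that by (simp add: measurable_cong_sets[OF sets refl])
  have words_m: "words m \<in> q i \<rightarrow>\<^sub>M count_space UNIV" for m i
  proof (rule meas)
    have "(\<lambda>p. word m (fst p)) \<in> borel \<rightarrow>\<^sub>M count_space UNIV" "(\<lambda>p. word m (snd p)) \<in> borel \<rightarrow>\<^sub>M count_space UNIV"
      by (auto intro: measurable_compose[OF borel_measurable_fst word_measurable]
          measurable_compose[OF borel_measurable_snd word_measurable])
    then have "words m \<in> borel \<rightarrow>\<^sub>M count_space UNIV \<Otimes>\<^sub>M count_space UNIV"
      unfolding words_def by (rule measurable_Pair)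
    then show "words m \<in> borel \<rightarrow>\<^sub>M count_space UNIV" by (simp add: pair_measure_countable)
  qed
  define Q where "Q m i = (SOME p. measure_pmf p = distr (q i) (count_space UNIV) (words m))" for m i
  have Q: "measure_pmf (Q m i) = distr (q i) (count_space UNIV) (words m)" for i m
    unfolding Q_def
    by (rule someI_ex[OF countable_prob_imp_pmf]) (auto intro: prob_space.prob_space_distr[OF prob words_m])
  have Q_prob: "measure_pmf.prob (Q m i) A = measure (q i) (words m -` A)" for m i A
    unfolding Q by (simp add: measure_distr[OF words_m] space)
  have Q_match: "map_pmf snd (Q m i) = map_pmf fst (Q m (Suc i))" for m i
  proof (rule pmf_eqI)
    fix l
    have lb: "word m -` {l} \<in> sets borel"
      using measurable_sets[OF word_measurable, of "{l}" m] by simp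
    have "pmf (map_pmf snd (Q m i)) l = measure (q i) (snd -` (word m -` {l}))"
      by (simp add: pmf_map Q_prob words_def vimage_def)
    also have "\<dots> = measure (distr (q i) borel snd) (word m -` {l})"
      using lb by (simp add: measure_distr meas space)
    also have "\<dots> = measure (q (Suc i)) (fst -` (word m -` {l}))"
      unfolding match using lb by (simp add: measure_distr meas space)
    also have "\<dots> = pmf (map_pmf fst (Q m (Suc i))) l"
      by (simp add: pmf_map Q_prob words_def vimage_def)
    finally show "pmf (map_pmf snd (Q m i)) l = pmf (map_pmf fst (Q m (Suc i))) l" .
  qed
  define path where "path w = (\<lambda>(i, k). unword (w i) k)" for w :: "nat \<Rightarrow> bool list"
  have coord_path: "coord i (path w) = unword (w i)" for i w by (simp add: coord_def path_def)
  \<comment> \<open>Entries beyond the first \<open>m\<close> bits or steps are filler; the events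
    compared below read only finitely many entries.\<close>
  define \<eta> where "\<eta> m C = measure_pmf.prob (path_pmf (Q m) m) (path -` C)" for m C
  obtain P r where P: "sets P = sets borel" "finite_measure P" "strict_mono (r :: nat \<Rightarrow> nat)"
    "\<And>C. C \<in> cylinders \<Longrightarrow> (\<lambda>k. \<eta> (r k) C) \<longlonglongrightarrow> measure P C"
  proof (rule cylinder_limit_measure[of \<eta> 1])
    show "\<eta> m (C \<union> D) = \<eta> m C + \<eta> m D" if "C \<inter> D = {}" for m C D
      unfolding \<eta>_def vimage_Un
      by (rule measure_pmf.finite_measure_Union) (use that in auto)
  qed (simp_all add: \<eta>_def that)
  interpret P: finite_measure P by fact
  have spaceP: "space P = UNIV" using sets_eq_imp_space_eq[OF P(1)] by simp
  have "prob_space P"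
  proof (rule prob_spaceI)
    have "(\<lambda>k. \<eta> (r k) UNIV) \<longlonglongrightarrow> measure P UNIV" by (rule P(4)) (rule algebra.top[OF algebra_cylinders])
    moreover have "\<eta> m UNIV = 1" for m by (simp add: \<eta>_def)
    ultimately have "measure P UNIV = 1" by (simp add: LIMSEQ_const_iff)
    then show "emeasure P (space P) = 1" by (simp add: spaceP P.emeasure_eq_measure)
  qed
  moreover have "distr P borel (\<lambda>w. (coord i w, coord (Suc i) w)) = q i" for i
  proof -
    let ?pair = "\<lambda>w. (coord i w, coord (Suc i) w)"
    have pair: "?pair \<in> P \<rightarrow>\<^sub>M borel"
      using borel_measurable_Pair[OF coord_measurable coord_measurable]
      by (simp add: measurable_cong_sets[OF P(1) refl])
    have rect: "emeasure (distr P borel ?pair) (A \<times> B) = emeasure (q i) (A \<times> B)"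
      if A: "A \<in> cylinders" and B: "B \<in> cylinders" for A B
    proof -
      have AB: "A \<times> B \<in> sets borel"
        using A B by (auto simp: borel_Cantor_square_generator)
      let ?C = "{w. coord i w \<in> A} \<inter> {w. coord (Suc i) w \<in> B}"
      obtain m1 where m1: "\<And>m e. m1 \<le> m \<Longrightarrow> unword (word m e) \<in> A \<longleftrightarrow> e \<in> A"
        by (rule cylinder_unword_word[OF A]) (rule that)
      obtain m2 where m2: "\<And>m e. m2 \<le> m \<Longrightarrow> unword (word m e) \<in> B \<longleftrightarrow> e \<in> B"
        by (rule cylinder_unword_word[OF B]) (rule that)
      have "\<eta> m ?C = measure (q i) (A \<times> B)" if m: "max (Suc i) (max m1 m2) \<le> m" for m
      proof -
        have im: "i < m" using m by simp
        have "\<eta> m ?C = measure_pmf.prob (map_pmf (\<lambda>w. (w i, w (Suc i))) (path_pmf (Q m) m))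
            {p. unword (fst p) \<in> A \<and> unword (snd p) \<in> B}"
          by (simp add: \<eta>_def coord_path vimage_def)
        also have "\<dots> = measure (q i) (words m -` {p. unword (fst p) \<in> A \<and> unword (snd p) \<in> B})"
          using path_pmf_marginals[of "Q m" m, OF Q_match] im by (simp add: Q_prob)
        also have "words m -` {p. unword (fst p) \<in> A \<and> unword (snd p) \<in> B} = A \<times> B"
          using m1[of m] m2[of m] m by (auto simp: words_def)
        finally show ?thesis .
      qed
      then have "eventually (\<lambda>k. \<eta> (r k) ?C = measure (q i) (A \<times> B)) sequentially"
        using eventually_ge_at_top[of "max (Suc i) (max m1 m2)"] seq_suble[OF P(3)]
        by (auto elim!: eventually_mono intro: order.trans)
      then have "(\<lambda>k. \<eta> (r k) ?C) \<longlonglongrightarrow> measure (q i) (A \<times> B)" by (rule tendsto_eventually)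
      moreover have "(\<lambda>k. \<eta> (r k) ?C) \<longlonglongrightarrow> measure P ?C"
        using A B by (intro P(4) cylinder_Int coord_vimage_cylinder)
      ultimately have "measure P ?C = measure (q i) (A \<times> B)" by (rule LIMSEQ_unique[rotated])
      moreover have "?pair -` (A \<times> B) = ?C" by auto
      ultimately show ?thesis
        using AB pair by (simp add: emeasure_distr spaceP P.emeasure_eq_measure
            finite_measure.emeasure_eq_measure[OF prob_space.finite_measure[OF prob]])
    qed
    let ?E = "{A \<times> B | A B. A \<in> cylinders \<and> B \<in> cylinders} :: ((nat \<Rightarrow> bool) \<times> (nat \<Rightarrow> bool)) set set"
    show ?thesis
    proof (rule measure_eqI_generator_eq[where E = ?E and \<Omega> = UNIV and A = "\<lambda>_. UNIV"])
      show "Int_stable ?E"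
      proof (rule Int_stableI)
        fix X Y assume "X \<in> ?E" "Y \<in> ?E"
        then obtain A B A' B' where "X = A \<times> B" "Y = A' \<times> B'"
          "A \<in> cylinders" "B \<in> cylinders" "A' \<in> cylinders" "B' \<in> cylinders" by blast
        then show "X \<inter> Y \<in> ?E"
          using cylinder_Int[of A A'] cylinder_Int[of B B'] Times_Int_Times[of A B A' B'] by auto
      qed
      show "emeasure (distr P borel ?pair) UNIV \<noteq> \<infinity>"
        using emeasure_distr[OF pair, of UNIV] P.emeasure_finite by simp
      have "UNIV \<times> UNIV \<in> ?E" using algebra.top[OF algebra_cylinders] by blast
      then show "range (\<lambda>_::nat. UNIV) \<subseteq> ?E" by simp
      show "emeasure (distr P borel ?pair) X = emeasure (q i) X" if "X \<in> ?E" for X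
        using that rect by blast
    qed (simp_all add: sets borel_Cantor_square_generator)
  qed
  ultimately show ?thesis using P(1) by (intro that)
qed

text \<open>The chain runs \<open>y 0\<close>, \<open>x 0\<close>, \<open>y 1\<close>,
  \<open>x 1\<close>, ... alternately through both spaces: even transitions have law \<pi> with
  swapped components, odd ones law \<pi>'. They fit together because the two plans share both
  marginals.\<close>

theorem plan_chain_exists:
  fixes \<mu> :: "'a::polish_space measure" and \<nu> :: "'b::polish_space measure"
  assumes plan: "\<pi> \<in> transport_plans \<mu> \<nu>" and plan': "\<pi>' \<in> transport_plans \<mu> \<nu>"
  obtains P :: "(nat \<times> nat \<Rightarrow> bool) measure" and x :: "nat \<Rightarrow> _ \<Rightarrow> 'a" and y :: "nat \<Rightarrow> _ \<Rightarrow> 'b"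
  where "prob_space P" "\<And>i. x i \<in> P \<rightarrow>\<^sub>M borel" "\<And>i. y i \<in> P \<rightarrow>\<^sub>M borel"
    "\<And>i. distr P borel (\<lambda>w. (x i w, y i w)) = \<pi>"
    "\<And>i. distr P borel (\<lambda>w. (x i w, y (Suc i) w)) = \<pi>'"
proof -
  obtain \<theta> :: "'a \<Rightarrow> nat \<Rightarrow> bool" and \<sigma> where
    \<theta>: "\<theta> \<in> borel \<rightarrow>\<^sub>M borel" and \<sigma>: "\<sigma> \<in> borel \<rightarrow>\<^sub>M borel" and \<sigma>\<theta>: "\<And>z. \<sigma> (\<theta> z) = z"
    using Cantor_coding_exists[where 'a = 'a] by blast
  obtain \<theta>' :: "'b \<Rightarrow> nat \<Rightarrow> bool" and \<sigma>' where
    \<theta>': "\<theta>' \<in> borel \<rightarrow>\<^sub>M borel" and \<sigma>': "\<sigma>' \<in> borel \<rightarrow>\<^sub>M borel" and \<sigma>\<theta>': "\<And>z. \<sigma>' (\<theta>' z) = z"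
    using Cantor_coding_exists[where 'a = 'b] by blast
  note D = transport_plansD[OF plan] and D' = transport_plansD[OF plan']
  have fs: "(\<lambda>p :: 'a \<times> 'b. \<theta> (fst p)) \<in> borel \<rightarrow>\<^sub>M borel" "(\<lambda>p :: 'a \<times> 'b. \<theta>' (snd p)) \<in> borel \<rightarrow>\<^sub>M borel"
    by (rule measurable_compose[OF borel_measurable_fst \<theta>], rule measurable_compose[OF borel_measurable_snd \<theta>'])
  define f where "f p = (\<theta>' (snd p), \<theta> (fst p))" for p
  define f' where "f' p = (\<theta> (fst p), \<theta>' (snd p))" for p
  have fm: "f \<in> borel \<rightarrow>\<^sub>M borel" "f' \<in> borel \<rightarrow>\<^sub>M borel"
    unfolding f_def f'_def by (intro borel_measurable_Pair fs)+
  have fm1: "f \<in> \<pi> \<rightarrow>\<^sub>M borel" and fm2: "f' \<in> \<pi>' \<rightarrow>\<^sub>M borel"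
    using fm by (simp_all add: measurable_cong_sets[OF D(2) refl] measurable_cong_sets[OF D'(2) refl])
  define q where "q i = (if even i then distr \<pi> borel f else distr \<pi>' borel f')" for i :: nat
  have law1: "distr M borel (\<lambda>p. \<theta> (fst p)) = distr (distr M borel fst) borel \<theta>"
    "distr M borel (\<lambda>p. \<theta>' (snd p)) = distr (distr M borel snd) borel \<theta>'"
    if "sets M = sets borel" for M :: "('a \<times> 'b) measure"
    using \<theta> \<theta>' by (simp_all add: distr_distr measurable_cong_sets[OF that refl] comp_def)
  obtain P where P: "prob_space P" "sets P = sets borel"
    "\<And>i. distr P borel (\<lambda>w. (coord i w, coord (Suc i) w)) = q i"
  proof (rule Cantor_chain_exists[of q])
    show "prob_space (q i)" for i
      using prob_space.prob_space_distr[OF D(1) fm1] prob_space.prob_space_distr[OF D'(1) fm2]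
      by (simp add: q_def)
    show "distr (q i) borel snd = distr (q (Suc i)) borel fst" for i
      using fm1 fm2 law1[OF D(2)] law1[OF D'(2)]
      by (simp add: q_def distr_distr comp_def f_def f'_def D(4,5) D'(4,5))
  qed (auto simp: q_def that)
  have coordP: "coord i \<in> P \<rightarrow>\<^sub>M borel" for i by (simp add: measurable_cong_sets[OF P(2) refl])
  have pairP: "(\<lambda>w. (coord i w, coord (Suc i) w)) \<in> P \<rightarrow>\<^sub>M borel" for i
    by (intro borel_measurable_Pair coordP)
  define x where "x i w = \<sigma> (coord (Suc (2 * i)) w)" for i w
  define y where "y i w = \<sigma>' (coord (2 * i) w)" for i w
  have xm: "x i \<in> P \<rightarrow>\<^sub>M borel" and ym: "y i \<in> P \<rightarrow>\<^sub>M borel" for i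
    unfolding x_def y_def by (rule measurable_compose[OF coordP \<sigma>], rule measurable_compose[OF coordP \<sigma>'])
  define g where "g p = (\<sigma> (snd p), \<sigma>' (fst p))" for p
  define g' where "g' p = (\<sigma> (fst p), \<sigma>' (snd p))" for p
  have gm: "g \<in> borel \<rightarrow>\<^sub>M borel" "g' \<in> borel \<rightarrow>\<^sub>M borel"
    unfolding g_def g'_def
    by (intro borel_measurable_Pair measurable_compose[OF borel_measurable_fst \<sigma>] measurable_compose[OF borel_measurable_snd \<sigma>]
        measurable_compose[OF borel_measurable_fst \<sigma>'] measurable_compose[OF borel_measurable_snd \<sigma>'])+
  have "distr P borel (\<lambda>w. (x i w, y i w)) = \<pi>" for i
  proof -
    have "distr P borel (\<lambda>w. (x i w, y i w)) = distr (distr P borel (\<lambda>w. (coord (2 * i) w, coord (Suc (2 * i)) w))) borel g"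
      using gm pairP by (simp add: distr_distr comp_def g_def x_def y_def)
    also have "\<dots> = distr \<pi> borel (\<lambda>p. p)"
      using gm fm1 by (simp add: P(3) q_def distr_distr comp_def g_def f_def \<sigma>\<theta> \<sigma>\<theta>')
    also have "\<dots> = \<pi>" using D(2) by (simp add: distr_id2)
    finally show ?thesis .
  qed
  moreover have "distr P borel (\<lambda>w. (x i w, y (Suc i) w)) = \<pi>'" for i
  proof -
    have "distr P borel (\<lambda>w. (x i w, y (Suc i) w))
        = distr (distr P borel (\<lambda>w. (coord (Suc (2 * i)) w, coord (Suc (Suc (2 * i))) w))) borel g'"
      using gm pairP by (simp add: distr_distr comp_def g'_def x_def y_def)
    also have "\<dots> = distr \<pi>' borel (\<lambda>p. p)"
      using gm fm2 by (simp add: P(3) q_def distr_distr comp_def g'_def f'_def \<sigma>\<theta> \<sigma>\<theta>')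
    also have "\<dots> = \<pi>'" using D'(2) by (simp add: distr_id2)
    finally show ?thesis .
  qed
  ultimately show ?thesis using P(1) xm ym by (intro that)
qed

section \<open>Monotone plans are optimal\<close>

text \<open>Integrate the bound and divide by \<open>n\<close>. The exceptional event that an end
  point misses \<open>G M\<close> need not be independent of the costs in between; there each cost
  is cut at a height \<open>T\<close>, and by stationarity the part above \<open>T\<close> has the
  same small integral for every index.\<close>

lemma stationary_comparison:
  fixes z :: "nat \<Rightarrow> 'w \<Rightarrow> 'z" and c :: "'z \<Rightarrow> ennreal" and g :: "nat \<Rightarrow> 'w \<Rightarrow> ennreal"
    and G :: "nat \<Rightarrow> 'z set"
  assumes "prob_space P" "prob_space \<pi>"
    and z[measurable]: "\<And>i. z i \<in> P \<rightarrow>\<^sub>M \<pi>" and law: "\<And>i. distr P \<pi> (z i) = \<pi>"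
    and c[measurable]: "c \<in> borel_measurable \<pi>" and finite: "(\<integral>\<^sup>+z. c z \<partial>\<pi>) < \<infinity>"
    and g[measurable]: "\<And>i. g i \<in> borel_measurable P" and g_int: "\<And>i. (\<integral>\<^sup>+w. g i w \<partial>P) = b"
    and G[measurable]: "\<And>M. G M \<in> sets \<pi>" and "incseq G" and G_full: "AE z in \<pi>. z \<in> (\<Union>M. G M)"
    and R: "\<And>M. R M < (\<infinity>::ennreal)"
    and bound: "\<And>n M. AE w in P. z 0 w \<in> G M \<and> z n w \<in> G M \<longrightarrow> (\<Sum>i<n. c (z i w)) \<le> (\<Sum>i<n. g i w) + R M"
  shows "(\<integral>\<^sup>+z. c z \<partial>\<pi>) \<le> b"
proof -
  interpret P: prob_space P by fact
  interpret Q: prob_space \<pi> by fact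
  define a where "a = (\<integral>\<^sup>+z. c z \<partial>\<pi>)"
  define \<tau> where "\<tau> T = (\<integral>\<^sup>+z. c z * indicator {z. of_nat T < c z} z \<partial>\<pi>)" for T :: nat
  have int_z: "(\<integral>\<^sup>+w. h (z i w) \<partial>P) = (\<integral>\<^sup>+z. h z \<partial>\<pi>)" if [measurable]: "h \<in> borel_measurable \<pi>" for h :: "'z \<Rightarrow> ennreal" and i
  proof -
    have "(\<integral>\<^sup>+z. h z \<partial>\<pi>) = (\<integral>\<^sup>+z. h z \<partial>distr P \<pi> (z i))" by (simp add: law)
    also have "\<dots> = (\<integral>\<^sup>+w. h (z i w) \<partial>P)" by (rule nn_integral_distr) measurable
    finally show ?thesis by simp
  qed
  have step: "of_nat n * a \<le> of_nat n * b + R M + of_nat n * (\<tau> T + of_nat T * (2 * emeasure \<pi> (space \<pi> - G M)))"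
    for n M T :: nat
  proof -
    \<comment> \<open>The number of end points outside \<open>G M\<close>. Where it is 0 the assumed
      bound applies; elsewhere a cost is at most its part above \<open>T\<close> plus
      \<open>of_nat T * bad w\<close>.\<close>
    define bad where "bad w = (indicator (space \<pi> - G M) (z 0 w) + indicator (space \<pi> - G M) (z n w) :: ennreal)" for w
    have bad_m[measurable]: "bad \<in> borel_measurable P" unfolding bad_def by measurable
    have bad_int: "(\<integral>\<^sup>+w. bad w \<partial>P) = 2 * emeasure \<pi> (space \<pi> - G M)"
      unfolding bad_def by (subst nn_integral_add) (simp_all add: int_z mult_2)
    have "of_nat n * a = (\<Sum>i<n. \<integral>\<^sup>+w. c (z i w) \<partial>P)" by (simp add: int_z a_def)
    also have "\<dots> = (\<integral>\<^sup>+w. (\<Sum>i<n. c (z i w)) \<partial>P)" by (subst nn_integral_sum) auto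
    also have "\<dots> \<le> (\<integral>\<^sup>+w. ((\<Sum>i<n. g i w) + R M)
        + (\<Sum>i<n. c (z i w) * indicator {z. of_nat T < c z} (z i w) + of_nat T * bad w) \<partial>P)"
    proof (rule nn_integral_mono_AE)
      show "AE w in P. (\<Sum>i<n. c (z i w)) \<le> ((\<Sum>i<n. g i w) + R M)
        + (\<Sum>i<n. c (z i w) * indicator {z. of_nat T < c z} (z i w) + of_nat T * bad w)"
        using bound[of M n] AE_space
      proof eventually_elim
        case (elim w)
        show ?case
        proof (cases "z 0 w \<in> G M \<and> z n w \<in> G M")
          case True
          with elim(1) have "(\<Sum>i<n. c (z i w)) \<le> (\<Sum>i<n. g i w) + R M" by blast
          then show ?thesis by (rule add_increasing2[OF zero_le])
        next
          case False
          moreover have "z 0 w \<in> space \<pi>" "z n w \<in> space \<pi>"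
            using measurable_space[OF z elim(2)] by auto
          ultimately have "1 \<le> bad w" by (auto simp: bad_def indicator_def)
          then have T: "(of_nat T :: ennreal) \<le> of_nat T * bad w"
            using mult_left_mono[of 1 "bad w" "of_nat T"] by simp
          have "c (z i w) \<le> c (z i w) * indicator {z. of_nat T < c z} (z i w) + of_nat T * bad w" for i
            using T by (cases "of_nat T < c (z i w)") (auto simp: indicator_def not_less intro: order.trans)
          then have "(\<Sum>i<n. c (z i w)) \<le> (\<Sum>i<n. c (z i w) * indicator {z. of_nat T < c z} (z i w) + of_nat T * bad w)"
            by (intro sum_mono)
          then show ?thesis by (rule add_increasing[OF zero_le])
        qed
      qed
    qed
    also have "\<dots> = (\<Sum>i<n. \<integral>\<^sup>+w. g i w \<partial>P) + R M
        + (\<Sum>i<n. (\<integral>\<^sup>+w. c (z i w) * indicator {z. of_nat T < c z} (z i w) \<partial>P) + of_nat T * (\<integral>\<^sup>+w. bad w \<partial>P))"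
      by (simp add: nn_integral_add nn_integral_sum nn_integral_cmult P.emeasure_space_1)
    also have "\<dots> = of_nat n * b + R M + of_nat n * (\<tau> T + of_nat T * (2 * emeasure \<pi> (space \<pi> - G M)))"
      using int_z[of "\<lambda>z. c z * indicator {z. of_nat T < c z} z"] by (simp add: g_int bad_int \<tau>_def)
    finally show ?thesis .
  qed
  have \<tau>_lim: "\<tau> \<longlonglongrightarrow> 0"
  proof -
    have "(\<lambda>T. \<integral>\<^sup>+z. c z * indicator {z. of_nat T < c z} z \<partial>\<pi>) \<longlonglongrightarrow> (\<integral>\<^sup>+z. 0 \<partial>\<pi>)"
    proof (rule nn_integral_dominated_convergence[where w = c])
      show "(\<integral>\<^sup>+z. c z \<partial>\<pi>) < \<infinity>" by fact
      have "AE z in \<pi>. c z \<noteq> \<infinity>" using finite by (intro nn_integral_noteq_infinite) auto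
      then show "AE z in \<pi>. (\<lambda>T. c z * indicator {z. of_nat T < c z} z) \<longlonglongrightarrow> 0"
      proof eventually_elim
        case (elim z)
        then obtain k :: nat where k: "c z < of_nat k" using ennreal_Ex_less_of_nat[of "c z"] by (auto simp: less_top)
        have "eventually (\<lambda>T. c z * indicator {z. of_nat T < c z} z = 0) sequentially"
          using eventually_ge_at_top[of k]
        proof eventually_elim
          case (elim T)
          then have "(of_nat k :: ennreal) \<le> of_nat T" by simp
          with k have "\<not> of_nat T < c z" by (meson leD order.strict_trans1 order.strict_trans2 less_imp_le)
          then show ?case by simp
        qed
        then show ?case by (rule tendsto_eventually)
      qed
    qed (auto simp: indicator_def)
    then show ?thesis by (simp add: \<tau>_def[abs_def])
  qed
  have G_lim: "(\<lambda>M. emeasure \<pi> (space \<pi> - G M)) \<longlonglongrightarrow> 0"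
  proof -
    have "(\<lambda>M. emeasure \<pi> (space \<pi> - G M)) \<longlonglongrightarrow> emeasure \<pi> (\<Inter>M. space \<pi> - G M)"
      using incseqD[OF \<open>incseq G\<close>] by (intro Lim_emeasure_decseq) (auto simp: decseq_def)
    moreover have "emeasure \<pi> (\<Inter>M. space \<pi> - G M) = 0"
      using G_full AE_iff_measurable[of "\<Inter>M. space \<pi> - G M" \<pi> "\<lambda>z. z \<in> (\<Union>M. G M)"] by auto
    ultimately show ?thesis by simp
  qed
  have "a \<le> b + ennreal e" if e: "0 < e" for e
  proof -
    \<comment> \<open>Order of choice: \<open>T\<close> makes the tail small, then \<open>M\<close>
      makes the mass outside \<open>G M\<close> small even after multiplication by \<open>T\<close>,
      and finally \<open>n\<close> absorbs the constant \<open>R M\<close>.\<close>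
    have "eventually (\<lambda>T. \<tau> T < ennreal (e/3)) sequentially"
      using \<tau>_lim e by (intro order_tendstoD(2)) auto
    then obtain T where T: "\<tau> T < ennreal (e/3)" by (auto simp: eventually_sequentially)
    have "(\<lambda>M. of_nat T * (2 * emeasure \<pi> (space \<pi> - G M))) \<longlonglongrightarrow> of_nat T * (2 * 0)"
      using G_lim by (intro ennreal_tendsto_cmult) (auto simp: of_nat_less_top)
    then have "eventually (\<lambda>M. of_nat T * (2 * emeasure \<pi> (space \<pi> - G M)) < ennreal (e/3)) sequentially"
      using e by (intro order_tendstoD(2)) auto
    then obtain M where M: "of_nat T * (2 * emeasure \<pi> (space \<pi> - G M)) < ennreal (e/3)"
      by (auto simp: eventually_sequentially)
    obtain r where r: "R M = ennreal r" "0 \<le> r" using R[of M] by (cases "R M") auto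
    obtain n :: nat where n: "r / (e/3) < real n" using reals_Archimedean2 by blast
    then have n0: "0 < n" using r e by (metis divide_nonneg_pos gr0I le_less_trans of_nat_0 less_irrefl zero_less_divide_iff zero_less_numeral)
    have "r \<le> real n * (e/3)" using n e by (simp add: field_simps)
    then have Rn: "R M \<le> of_nat n * ennreal (e/3)"
      using r e by (simp add: ennreal_of_nat_eq_real_of_nat ennreal_mult[symmetric] ennreal_leI)
    have "of_nat n * a \<le> of_nat n * b + of_nat n * ennreal (e/3) + of_nat n * (ennreal (e/3) + ennreal (e/3))"
      using T M Rn by (intro order.trans[OF step[of n M T]] add_mono mult_left_mono) auto
    also have "\<dots> = of_nat n * (b + (ennreal (e/3) + (ennreal (e/3) + ennreal (e/3))))"
      by (simp add: distrib_left add.assoc)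
    also have "ennreal (e/3) + (ennreal (e/3) + ennreal (e/3)) = ennreal e"
      using e by (simp add: ennreal_plus[symmetric] del: ennreal_plus)
    finally show ?thesis
      using n0 by (subst (asm) ennreal_mult_le_mult_iff) (auto simp: ennreal_of_nat_eq_real_of_nat)
  qed
  then show ?thesis unfolding a_def[symmetric] by (rule ennreal_le_epsilon)
qed

lemma open_Union_rectangles:
  fixes W :: "('a::second_countable_topology \<times> 'b::second_countable_topology) set"
  assumes "open W"
  obtains U :: "nat \<Rightarrow> 'a set" and V :: "nat \<Rightarrow> 'b set"
  where "\<And>j. open (U j)" "\<And>j. open (V j)" "(\<Union>j. U j \<times> V j) = W"
proof -
  obtain BX :: "'a set set" where BX: "countable BX" "topological_basis BX"
    using ex_countable_basis by blast
  obtain BY :: "'b set set" where BY: "countable BY" "topological_basis BY"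
    using ex_countable_basis by blast
  \<comment> \<open>The empty rectangle keeps the family nonempty, so that it can be enumerated by
    \<open>nat\<close> even if \<open>W\<close> is empty.\<close>
  define \<R> where "\<R> = insert ({}, {}) {p \<in> BX \<times> BY. fst p \<times> snd p \<subseteq> W}"
  have cnt: "countable \<R>" unfolding \<R>_def using BX(1) BY(1) by auto
  have ne: "\<R> \<noteq> {}" by (auto simp: \<R>_def)
  define r where "r = from_nat_into \<R>"
  have rR: "r j \<in> \<R>" for j unfolding r_def using ne by (rule from_nat_into)
  have "open (fst (r j))" "open (snd (r j))" for j
    using rR[of j] topological_basis_open[OF BX(2)] topological_basis_open[OF BY(2)] by (auto simp: \<R>_def)
  moreover have "(\<Union>j. fst (r j) \<times> snd (r j)) = W"
  proof (intro equalityI subsetI)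
    fix p assume "p \<in> (\<Union>j. fst (r j) \<times> snd (r j))"
    then obtain j where "p \<in> fst (r j) \<times> snd (r j)" by blast
    then show "p \<in> W" using rR[of j] by (auto simp: \<R>_def)
  next
    fix p assume "p \<in> W"
    then obtain A B where AB: "open A" "open B" "p \<in> A \<times> B" "A \<times> B \<subseteq> W"
      using assms by (metis open_prod_elim)
    obtain A' where A': "A' \<in> BX" "fst p \<in> A'" "A' \<subseteq> A"
      using topological_basisE[OF BX(2) AB(1), of "fst p"] AB(3) by (auto simp: mem_Times_iff)
    obtain B' where B': "B' \<in> BY" "snd p \<in> B'" "B' \<subseteq> B"
      using topological_basisE[OF BY(2) AB(2), of "snd p"] AB(3) by (auto simp: mem_Times_iff)
    have "(A', B') \<in> \<R>" using A' B' AB(4) by (auto simp: \<R>_def)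
    then obtain j where "r j = (A', B')" unfolding r_def using from_nat_into_surj[OF cnt] by blast
    then have "p \<in> fst (r j) \<times> snd (r j)" using A' B' by (simp add: mem_Times_iff)
    then show "p \<in> (\<Union>j. fst (r j) \<times> snd (r j))" by blast
  qed
  ultimately show ?thesis by (rule that)
qed

lemma sum_lessThan_add:
  fixes f :: "nat \<Rightarrow> 'a::comm_monoid_add"
  shows "(\<Sum>i<m + n. f i) = (\<Sum>i<m. f i) + (\<Sum>j<n. f (m + j))"
  by (induction n) (simp_all add: add.assoc)

text \<open>Isolates the wrap-around term, the only cost that does not come from a step of the
  path.\<close>

lemma c_monotone_set_cycle:
  assumes "c_monotone_set c \<Gamma>" "\<And>i. i \<le> n \<Longrightarrow> z i \<in> \<Gamma>"
  shows "(\<Sum>i<Suc n. c (z i)) \<le> (\<Sum>i<n. c (fst (z i), snd (z (Suc i)))) + c (fst (z n), snd (z 0))"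
proof -
  have "(\<Sum>i<Suc n. c (fst (z i), snd (z i))) \<le> (\<Sum>i<Suc n. c (fst (z i), snd (z (Suc i mod Suc n))))"
    by (rule assms(1)[unfolded c_monotone_set_def, THEN conjunct2, rule_format,
          where x = "\<lambda>i. fst (z i)" and y = "\<lambda>i. snd (z i)"])
      (simp add: assms(2))
  also have "\<dots> = (\<Sum>i<n. c (fst (z i), snd (z (Suc i)))) + c (fst (z n), snd (z 0))"
    by simp
  finally show ?thesis by simp
qed

text \<open>A fixed chain of finite cost from \<open>p\<close> to \<open>p'\<close> closes every cycle that leaves through \<open>p\<close>
  and returns through \<open>p'\<close> at a bounded extra cost.\<close>

lemma c_monotone_set_closing_cost:
  assumes mono: "c_monotone_set c \<Gamma>"
    and reach: "(\<lambda>p p'. p' \<in> \<Gamma> \<and> c (fst p, snd p') < \<infinity>)\<^sup>*\<^sup>* p p'" and p: "p \<in> \<Gamma>"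
  shows "\<exists>H<\<infinity>. \<forall>n z. (\<forall>i\<le>n. z i \<in> \<Gamma>) \<longrightarrow>
    (\<Sum>i<n. c (z i)) \<le> (\<Sum>i<n. c (fst (z i), snd (z (Suc i)))) + (c (fst (z n), snd p) + H + c (fst p', snd (z 0)))"
proof -
  obtain r where "((\<lambda>p p'. p' \<in> \<Gamma> \<and> c (fst p, snd p') < \<infinity>) ^^ r) p p'"
    using rtranclp_imp_relpowp[OF reach] by blast
  then obtain f where f: "f 0 = p" "f r = p'" "\<And>i. i < r \<Longrightarrow> f (Suc i) \<in> \<Gamma>"
    "\<And>i. i < r \<Longrightarrow> c (fst (f i), snd (f (Suc i))) < \<infinity>"
    unfolding relpowp_fun_conv by blast
  have f_mem: "f i \<in> \<Gamma>" if "i \<le> r" for i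
    using that f(1,3) p by (cases i) auto
  define H where "H = (\<Sum>i<r. c (fst (f i), snd (f (Suc i))))"
  have "H < \<infinity>" unfolding H_def using f(4) by (simp add: less_top)
  moreover have "(\<Sum>i<n. c (z i)) \<le> (\<Sum>i<n. c (fst (z i), snd (z (Suc i)))) + (c (fst (z n), snd p) + H + c (fst p', snd (z 0)))"
    if z: "\<forall>i\<le>n. z i \<in> \<Gamma>" for n z
  proof -
    \<comment> \<open>The cycle visits \<open>z 0\<close>, ..., \<open>z n\<close> and then
      \<open>f 0\<close>, ..., \<open>f r\<close>, hence its last index is
      \<open>Suc n + r\<close>.\<close>
    define y where "y i = (if i \<le> n then z i else f (i - Suc n))" for i
    have y: "y i \<in> \<Gamma>" if "i \<le> Suc n + r" for i
      using that z f_mem by (auto simp: y_def)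
    have y1: "y i = z i" if "i \<le> n" for i using that by (simp add: y_def)
    have y2: "y (Suc n + j) = f j" for j by (simp add: y_def)
    have "(\<Sum>i<n. c (z i)) = (\<Sum>i<n. c (y i))" by (simp add: y1)
    \<comment> \<open>The nonnegative costs of \<open>z n\<close> and of the detour are added on the
      left side of the cycle inequality.\<close>
    also have "\<dots> \<le> (\<Sum>i<Suc (Suc n + r). c (y i))" by (rule sum_mono2) auto
    also have "\<dots> \<le> (\<Sum>i<Suc n + r. c (fst (y i), snd (y (Suc i)))) + c (fst (y (Suc n + r)), snd (y 0))"
      by (rule c_monotone_set_cycle[OF mono y])
    also have "(\<Sum>i<Suc n + r. c (fst (y i), snd (y (Suc i))))
        = (\<Sum>i<n. c (fst (z i), snd (z (Suc i)))) + c (fst (z n), snd p) + H"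
    proof -
      have "(\<Sum>i<Suc n + r. c (fst (y i), snd (y (Suc i))))
          = (\<Sum>i<n. c (fst (y i), snd (y (Suc i)))) + c (fst (y n), snd (y (Suc n)))
            + (\<Sum>j<r. c (fst (y (Suc n + j)), snd (y (Suc n + Suc j))))"
        by (simp only: sum_lessThan_add sum.lessThan_Suc add_Suc_right)
      also have "(\<Sum>i<n. c (fst (y i), snd (y (Suc i)))) = (\<Sum>i<n. c (fst (z i), snd (z (Suc i))))"
        by (intro sum.cong) (auto simp: y1)
      also have "c (fst (y n), snd (y (Suc n))) = c (fst (z n), snd p)"
        using y1[of n] y2[of 0] f(1) by simp
      also have "(\<Sum>j<r. c (fst (y (Suc n + j)), snd (y (Suc n + Suc j)))) = H"
        unfolding H_def y2 ..
      finally show ?thesis .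
    qed
    also have "c (fst (y (Suc n + r)), snd (y 0)) = c (fst p', snd (z 0))"
      unfolding y2 f(2) by (simp add: y1)
    finally show ?thesis by (simp add: add.assoc)
  qed
  ultimately show ?thesis by blast
qed

lemma (in finite_measure) AE_subset_measure_eq_imp_AE_eq:
  assumes A: "A \<in> sets M" and B: "B \<in> sets M"
    and sub: "AE x in M. x \<in> A \<longrightarrow> x \<in> B" and eq: "measure M A = measure M B"
  shows "AE x in M. x \<in> A \<longleftrightarrow> x \<in> B"
proof -
  have "measure M (B - A) = measure M B - measure M (B \<inter> A)"
    using A B by (rule finite_measure_Diff'[rotated])
  also have "measure M (B \<inter> A) = measure M A"
    by (rule measure_eq_AE) (use sub A B in auto)
  finally have "B - A \<in> null_sets M"
    using A B eq by (auto simp: emeasure_eq_measure)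
  then have "AE x in M. x \<notin> B - A" by (rule AE_not_in)
  with sub show ?thesis by eventually_elim auto
qed

theorem c_monotone_imp_cost_le:
  fixes \<mu> :: "'a::polish_space measure" and \<nu> :: "'b::polish_space measure"
    and c :: "'a \<times> 'b \<Rightarrow> ennreal"
  assumes "prob_space \<mu>" and sets\<mu>: "sets \<mu> = sets borel"
    and "prob_space \<nu>" and sets\<nu>: "sets \<nu> = sets borel"
    and c[measurable]: "c \<in> borel_measurable borel"
    and F: "closed F" and N: "N \<in> null_sets (completion (\<mu> \<Otimes>\<^sub>M \<nu>))" and FN: "{z. c z = \<infinity>} = F \<union> N"
    and plan: "\<pi> \<in> transport_plans \<mu> \<nu>" and cost: "transport_cost c \<pi> < \<infinity>"
    and mono: "c_monotone_set c \<Gamma>" and full: "emeasure \<pi> \<Gamma> = 1"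
    and plan': "\<pi>' \<in> transport_plans \<mu> \<nu>" and cost': "transport_cost c \<pi>' < \<infinity>"
  shows "transport_cost c \<pi> \<le> transport_cost c \<pi>'"
proof -
  interpret M1: prob_space \<mu> by fact
  interpret M2: prob_space \<nu> by fact
  interpret M12: pair_prob_space \<mu> \<nu> ..
  note D = transport_plansD[OF plan] and D' = transport_plansD[OF plan']
  interpret Q: prob_space \<pi> by (rule D(1))
  have c_\<pi>: "c \<in> borel_measurable \<pi>" and c_\<pi>': "c \<in> borel_measurable \<pi>'"
    using c by (simp_all add: measurable_cong_sets[OF D(2) refl] measurable_cong_sets[OF D'(2) refl])
  have fst_\<pi>: "fst \<in> \<pi> \<rightarrow>\<^sub>M borel" and snd_\<pi>: "snd \<in> \<pi> \<rightarrow>\<^sub>M borel"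
    by (simp_all add: measurable_cong_sets[OF D(2) refl])
  have AE_fst: "AE p in \<pi>. S (fst p)" if "AE x in \<mu>. S x" for S
    by (rule AE_distrD[OF fst_\<pi>]) (unfold D(4), rule that)
  have AE_snd: "AE p in \<pi>. S (snd p)" if "AE y in \<nu>. S y" for S
    by (rule AE_distrD[OF snd_\<pi>]) (unfold D(5), rule that)

  \<comment> \<open>Sections of the exceptional null set\<close>
  obtain N' where N': "N' \<in> null_sets (\<mu> \<Otimes>\<^sub>M \<nu>)" "N \<subseteq> N'"
    using N unfolding null_sets_completion_iff2 by blast
  have AE_N': "AE x in \<mu>. AE y in \<nu>. (x, y) \<notin> N'"
    by (rule M12.AE_pair) (rule AE_not_in[OF N'(1)])
  \<comment> \<open>Both orders are used: a generic point must be linkable through its first and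
    through its second coordinate.\<close>
  have "AE y in \<nu>. AE x in \<mu>. (x, y) \<notin> N'"
  proof (subst M12.AE_commute[symmetric])
    have "space (\<mu> \<Otimes>\<^sub>M \<nu>) - N' \<in> sets (\<mu> \<Otimes>\<^sub>M \<nu>)" using N'(1) by auto
    moreover have "{x \<in> space (\<mu> \<Otimes>\<^sub>M \<nu>). (fst x, snd x) \<notin> N'} = space (\<mu> \<Otimes>\<^sub>M \<nu>) - N'" by auto
    ultimately show "{x \<in> space (\<mu> \<Otimes>\<^sub>M \<nu>). (fst x, snd x) \<notin> N'} \<in> sets (\<mu> \<Otimes>\<^sub>M \<nu>)" by simp
  qed (rule AE_N')
  note AE_N'2 = this

  \<comment> \<open>Rectangles and generic points\<close>
  obtain U :: "nat \<Rightarrow> 'a set" and V :: "nat \<Rightarrow> 'b set"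
    where UV: "\<And>j. open (U j)" "\<And>j. open (V j)" "(\<Union>j. U j \<times> V j) = - F"
    by (rule open_Union_rectangles[OF open_Compl[OF F]]) (rule that)
  define R where "R j = U j \<times> V j" for j
  have R_sets[measurable]: "R j \<in> sets borel" for j
    unfolding R_def by (intro borel_open open_Times UV)
  \<comment> \<open>Only sections of \<open>N'\<close> are controlled, since \<pi> may be singular
    to the product measure and charge \<open>N'\<close> itself. The last clause discards rectangles
    without mass, so that auxiliary points can be found in the others.\<close>
  define gen where "gen p \<longleftrightarrow> p \<in> \<Gamma> \<and> c p < \<infinity> \<and> (AE y in \<nu>. (fst p, y) \<notin> N') \<and>
    (AE x in \<mu>. (x, snd p) \<notin> N') \<and> (\<forall>j. p \<in> R j \<longrightarrow> emeasure \<pi> (R j) \<noteq> 0)" for p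
  have AE_gen: "AE p in \<pi>. gen p"
  proof -
    have "\<Gamma> \<in> sets \<pi>" using mono by (simp add: c_monotone_set_def D(2))
    then have "AE p in \<pi>. p \<in> \<Gamma>"
      using full by (simp add: Q.AE_in_set_eq_1 Q.emeasure_eq_measure)
    moreover have "AE p in \<pi>. c p \<noteq> \<infinity>"
      using cost by (intro nn_integral_noteq_infinite c_\<pi>) (auto simp: transport_cost_def)
    moreover have "AE p in \<pi>. \<forall>j. p \<in> R j \<longrightarrow> emeasure \<pi> (R j) \<noteq> 0"
      unfolding AE_all_countable
    proof
      fix j show "AE p in \<pi>. p \<in> R j \<longrightarrow> emeasure \<pi> (R j) \<noteq> 0"
      proof (cases "emeasure \<pi> (R j) = 0")
        case True
        then have "R j \<in> null_sets \<pi>" by (intro null_setsI) (auto simp: D(2))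
        from AE_not_in[OF this] show ?thesis by eventually_elim simp
      qed simp
    qed
    ultimately show ?thesis
      using AE_fst[OF AE_N'] AE_snd[OF AE_N'2]
      by eventually_elim (auto simp: gen_def less_top)
  qed
  have gen_\<Gamma>: "p \<in> \<Gamma>" if "gen p" for p using that by (simp add: gen_def)
  have gen_cell: "\<exists>j. p \<in> R j" if "gen p" for p
  proof -
    have "p \<notin> {z. c z = \<infinity>}" using that by (simp add: gen_def less_top)
    then have "p \<notin> F" unfolding FN by blast
    then have "p \<in> (\<Union>j. U j \<times> V j)" unfolding UV(3) by simp
    then show ?thesis unfolding R_def by blast
  qed
  have R_F: "R j \<subseteq> - F" for j unfolding UV(3)[symmetric] R_def by blast
  \<comment> \<open>A rectangle contains the crossed pair of any two of its points and misses
    \<open>F\<close>.\<close>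
  have finite_cell: "c (fst p, snd p') < \<infinity>" if "p \<in> R j" "p' \<in> R j" "(fst p, snd p') \<notin> N'" for p p' j
  proof -
    have "(fst p, snd p') \<in> R j" using that by (auto simp: R_def)
    then have "(fst p, snd p') \<notin> F" using R_F by blast
    then have "(fst p, snd p') \<notin> {z. c z = \<infinity>}" unfolding FN using that(3) N'(2) by blast
    then show ?thesis by (simp add: less_top)
  qed

  \<comment> \<open>Reachability between rectangles\<close>
  define step where "step p p' \<longleftrightarrow> gen p \<and> gen p' \<and> c (fst p, snd p') < \<infinity>" for p p'
  \<comment> \<open>Two generic points of one cell are linked through almost every third point of the cell.\<close>
  have same_cell: "step\<^sup>*\<^sup>* p p'" if p: "gen p" "p \<in> R j" and p': "gen p'" "p' \<in> R j" for p p' j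
  proof -
    have ae: "AE q in \<pi>. gen q \<and> (fst p, snd q) \<notin> N' \<and> (fst q, snd p') \<notin> N'"
      using AE_gen AE_snd[of "\<lambda>y. (fst p, y) \<notin> N'"] AE_fst[of "\<lambda>x. (x, snd p') \<notin> N'"] p(1) p'(1)
      by (auto simp: gen_def)
    have "\<not> (AE q in \<pi>. q \<notin> R j)"
      using p AE_iff_measurable[of "R j" \<pi> "\<lambda>q. q \<notin> R j"] by (auto simp: gen_def D)
    moreover have "AE q in \<pi>. q \<notin> R j"
      if "\<nexists>q. q \<in> R j \<and> gen q \<and> (fst p, snd q) \<notin> N' \<and> (fst q, snd p') \<notin> N'"
      using ae by eventually_elim (use that in blast)
    ultimately have "\<exists>q. q \<in> R j \<and> gen q \<and> (fst p, snd q) \<notin> N' \<and> (fst q, snd p') \<notin> N'" by blast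
    then obtain q where q: "q \<in> R j" "gen q" "(fst p, snd q) \<notin> N'" "(fst q, snd p') \<notin> N'" by blast
    have "step p q" "step q p'"
      using p p' q finite_cell[of p j q] finite_cell[of q j p'] by (auto simp: step_def)
    then show ?thesis by (meson converse_rtranclp_into_rtranclp r_into_rtranclp)
  qed

  \<comment> \<open>Rectangles reachable from \<open>R j\<close>. By \<open>same_cell\<close> the
    generic points chosen in the two rectangles do not matter, which is the content of
    \<open>upD\<close>.\<close>
  define up where "up j = {k. \<exists>p p'. gen p \<and> p \<in> R j \<and> gen p' \<and> p' \<in> R k \<and> step\<^sup>*\<^sup>* p p'}" for j
  have upD: "step\<^sup>*\<^sup>* p p'"
    if k: "k \<in> up j" and p: "gen p" "p \<in> R j" and p': "gen p'" "p' \<in> R k" for j k p p'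
  proof -
    obtain r r' where r: "gen r" "r \<in> R j" "gen r'" "r' \<in> R k" "step\<^sup>*\<^sup>* r r'"
      using k unfolding up_def by blast
    show ?thesis
      using same_cell[OF p r(1,2)] r(5) same_cell[OF r(3,4) p'] by (meson rtranclp_trans)
  qed
  define A where "A j = (\<Union>k\<in>up j. R k)" for j
  have A_sets: "A j \<in> sets borel" for j unfolding A_def by (intro sets.countable_UN') auto
  have A_step: "p' \<in> A j" if p: "p \<in> A j" and s: "step p p'" for p p' j
  proof -
    obtain k where k: "k \<in> up j" "p \<in> R k" using p unfolding A_def by blast
    obtain r r' where r: "gen r" "r \<in> R j" "gen r'" "r' \<in> R k" "step\<^sup>*\<^sup>* r r'"
      using k(1) unfolding up_def by blast
    have gp: "gen p" "gen p'" using s by (simp_all add: step_def)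
    obtain l where l: "p' \<in> R l" using gen_cell[OF gp(2)] by blast
    have "step\<^sup>*\<^sup>* r p" by (rule upD[OF k(1) r(1,2) gp(1) k(2)])
    then have "step\<^sup>*\<^sup>* r p'" using s by (rule rtranclp.rtrancl_into_rtrancl)
    then have "l \<in> up j" using r(1,2) l gp(2) unfolding up_def by blast
    then show ?thesis using l unfolding A_def by blast
  qed

  \<comment> \<open>The chain and its return to the starting class\<close>
  obtain P :: "(nat \<times> nat \<Rightarrow> bool) measure" and x :: "nat \<Rightarrow> _ \<Rightarrow> 'a" and y :: "nat \<Rightarrow> _ \<Rightarrow> 'b"
    where P: "prob_space P" and xm: "\<And>i. x i \<in> P \<rightarrow>\<^sub>M borel" and ym: "\<And>i. y i \<in> P \<rightarrow>\<^sub>M borel"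
    and law: "\<And>i. distr P borel (\<lambda>w. (x i w, y i w)) = \<pi>"
    and law': "\<And>i. distr P borel (\<lambda>w. (x i w, y (Suc i) w)) = \<pi>'"
    by (rule plan_chain_exists[OF plan plan']) (rule that)
  interpret P: prob_space P by fact
  define z where "z i w = (x i w, y i w)" for i w
  have zm: "z i \<in> P \<rightarrow>\<^sub>M borel" for i unfolding z_def by (intro borel_measurable_Pair xm ym)
  have sm: "(\<lambda>w. (x i w, y (Suc i) w)) \<in> P \<rightarrow>\<^sub>M borel" for i by (intro borel_measurable_Pair xm ym)
  have z_law: "distr P borel (z i) = \<pi>" for i using law[of i] by (simp add: z_def[abs_def])
  have AE_z: "AE w in P. S (z i w)" if "AE p in \<pi>. S p" for S i
    by (rule AE_distrD[OF zm]) (unfold z_law, rule that)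
  have AE_zgen: "AE w in P. \<forall>i. gen (z i w)"
    unfolding AE_all_countable using AE_z[OF AE_gen] by blast
  have cfin: "AE p in \<pi>'. c p \<noteq> \<infinity>"
    using cost' by (intro nn_integral_noteq_infinite c_\<pi>') (auto simp: transport_cost_def)
  have "AE w in P. c (x i w, y (Suc i) w) \<noteq> \<infinity>" for i
    by (rule AE_distrD[OF sm]) (unfold law', rule cfin)
  then have "AE w in P. \<forall>i. c (x i w, y (Suc i) w) \<noteq> \<infinity>"
    unfolding AE_all_countable by blast
  with AE_zgen have AE_step: "AE w in P. \<forall>i. step (z i w) (z (Suc i) w)"
    by eventually_elim (simp add: step_def z_def less_top)
  \<comment> \<open>By stationarity a set that the chain cannot leave cannot be entered either.\<close>
  have "AE w in P. z i w \<in> A j \<longleftrightarrow> z (Suc i) w \<in> A j" for i j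
  proof -
    have meas: "z i -` A j \<inter> space P \<in> sets P" for i
      using measurable_sets[OF zm A_sets] .
    have eq: "measure P (z i -` A j \<inter> space P) = measure \<pi> (A j)" for i
      using measure_distr[OF zm A_sets, of i j] by (simp add: z_law)
    have "AE w in P. w \<in> z i -` A j \<inter> space P \<longleftrightarrow> w \<in> z (Suc i) -` A j \<inter> space P"
    proof (rule P.AE_subset_measure_eq_imp_AE_eq[OF meas meas])
      show "AE w in P. w \<in> z i -` A j \<inter> space P \<longrightarrow> w \<in> z (Suc i) -` A j \<inter> space P"
        using AE_step by eventually_elim (use A_step in blast)
    qed (simp add: eq)
    then show ?thesis using AE_space by eventually_elim simp
  qed
  then have AE_inv: "AE w in P. \<forall>i j. z i w \<in> A j \<longleftrightarrow> z (Suc i) w \<in> A j"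
    unfolding AE_all_countable by blast
  \<comment> \<open>The set reachable from the rectangle of \<open>z n w\<close> contains
    \<open>z n w\<close>; as it cannot be entered from outside, it already contains
    \<open>z 0 w\<close>.\<close>
  have AE_back: "AE w in P. \<forall>n. step\<^sup>*\<^sup>* (z n w) (z 0 w)"
    using AE_inv AE_zgen
  proof eventually_elim
    case (elim w)
    have inv: "z 0 w \<in> A j \<longleftrightarrow> z n w \<in> A j" for n j
      by (induction n) (use elim(1) in auto)
    show ?case
    proof
      fix n
      have g: "gen (z n w)" "gen (z 0 w)" using elim(2) by auto
      obtain k where k: "z n w \<in> R k" using gen_cell g(1) by blast
      then have "k \<in> up k" using g(1) unfolding up_def by blast
      then have "z n w \<in> A k" using k unfolding A_def by blast
      then have "z 0 w \<in> A k" using inv by blast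
      then obtain l where "l \<in> up k" "z 0 w \<in> R l" unfolding A_def by blast
      then show "step\<^sup>*\<^sup>* (z n w) (z 0 w)" using upD g k by blast
    qed
  qed

  \<comment> \<open>Closing a path through reference points\<close>
  define \<kappa> where "\<kappa> p = (LEAST k. p \<in> R k)" for p
  have \<kappa>: "p \<in> R (\<kappa> p)" if "gen p" for p
    using gen_cell[OF that] unfolding \<kappa>_def by (rule LeastI_ex)
  have \<kappa>m[measurable]: "\<kappa> \<in> borel \<rightarrow>\<^sub>M count_space UNIV"
    unfolding \<kappa>_def by measurable
  \<comment> \<open>One reference point per rectangle: as these are countably many, the exceptional
    sets of all of them are null together.\<close>
  define \<zeta> where "\<zeta> k = (SOME p. gen p \<and> p \<in> R k)" for k
  have \<zeta>: "gen (\<zeta> (\<kappa> p))" "\<zeta> (\<kappa> p) \<in> R (\<kappa> p)" if "gen p" for p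
    using someI[of "\<lambda>q. gen q \<and> q \<in> R (\<kappa> p)" p] that \<kappa>[OF that] by (auto simp: \<zeta>_def)
  \<comment> \<open>Guarding the bound by implications makes a finite \<open>H\<close> exist for
    every pair; pairs that are not linked get 0, so that the sums in \<open>B\<close> stay
    finite.\<close>
  have closing: "\<exists>H<\<infinity>. step\<^sup>*\<^sup>* (\<zeta> k) (\<zeta> l) \<longrightarrow> gen (\<zeta> k) \<longrightarrow> (\<forall>n z. (\<forall>i\<le>n. z i \<in> \<Gamma>) \<longrightarrow>
    (\<Sum>i<n. c (z i)) \<le> (\<Sum>i<n. c (fst (z i), snd (z (Suc i)))) + (c (fst (z n), snd (\<zeta> k)) + H + c (fst (\<zeta> l), snd (z 0))))"
    for k l
  proof (cases "step\<^sup>*\<^sup>* (\<zeta> k) (\<zeta> l) \<and> gen (\<zeta> k)")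
    case True
    have "(\<lambda>p p'. p' \<in> \<Gamma> \<and> c (fst p, snd p') < \<infinity>)\<^sup>*\<^sup>* (\<zeta> k) (\<zeta> l)"
      using True by (auto elim!: rtranclp_mono[THEN predicate2D, rotated] simp: step_def gen_\<Gamma>)
    from c_monotone_set_closing_cost[OF mono this gen_\<Gamma>] True show ?thesis by blast
  next
    case False
    then show ?thesis by (intro exI[of _ 0]) auto
  qed
  define H where "H k l = (SOME H. H < \<infinity> \<and> (step\<^sup>*\<^sup>* (\<zeta> k) (\<zeta> l) \<longrightarrow> gen (\<zeta> k) \<longrightarrow> (\<forall>n z. (\<forall>i\<le>n. z i \<in> \<Gamma>) \<longrightarrow>
    (\<Sum>i<n. c (z i)) \<le> (\<Sum>i<n. c (fst (z i), snd (z (Suc i)))) + (c (fst (z n), snd (\<zeta> k)) + H + c (fst (\<zeta> l), snd (z 0))))))"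
    for k l
  have H_fin: "H k l < \<infinity>" for k l
    using someI_ex[OF closing[of k l]] unfolding H_def by blast
  have H_bound: "(\<Sum>i<n. c (z i)) \<le> (\<Sum>i<n. c (fst (z i), snd (z (Suc i)))) + (c (fst (z n), snd (\<zeta> k)) + H k l + c (fst (\<zeta> l), snd (z 0)))"
    if "step\<^sup>*\<^sup>* (\<zeta> k) (\<zeta> l)" "gen (\<zeta> k)" "\<And>i. i \<le> n \<Longrightarrow> z i \<in> \<Gamma>" for k l n z
    using someI_ex[OF closing[of k l]] that unfolding H_def by blast

  define a where "a p = c (fst p, snd (\<zeta> (\<kappa> p)))" for p
  define b where "b p = c (fst (\<zeta> (\<kappa> p)), snd p)" for p
  have am[measurable]: "a \<in> borel_measurable borel"
  proof -
    have "(\<lambda>p. c (fst p, snd (\<zeta> k))) \<in> borel_measurable borel" for k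
      by (rule measurable_compose[OF _ c]) (intro borel_measurable_Pair, auto)
    then show ?thesis unfolding a_def by (rule measurable_compose_countable[OF _ \<kappa>m])
  qed
  have bm[measurable]: "b \<in> borel_measurable borel"
  proof -
    have "(\<lambda>p. c (fst (\<zeta> k), snd p)) \<in> borel_measurable borel" for k
      by (rule measurable_compose[OF _ c]) (intro borel_measurable_Pair, auto)
    then show ?thesis unfolding b_def by (rule measurable_compose_countable[OF _ \<kappa>m])
  qed
  \<comment> \<open>Bounding the index of the rectangle together with the costs of going to its
    reference point and of coming back leaves finitely many connections to dominate.\<close>
  define G where "G M = {p. \<kappa> p \<le> M \<and> a p \<le> of_nat M \<and> b p \<le> of_nat M}" for M :: nat
  have G_sets: "G M \<in> sets borel" for M
  proof -
    have "{p \<in> space borel. \<kappa> p \<le> M \<and> a p \<le> of_nat M \<and> b p \<le> of_nat M} \<in> sets borel" by measurable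
    then show ?thesis by (simp add: G_def)
  qed
  have G_full: "AE p in \<pi>. p \<in> (\<Union>M. G M)"
  proof -
    have "AE p in \<pi>. \<forall>k. gen (\<zeta> k) \<longrightarrow> (fst p, snd (\<zeta> k)) \<notin> N' \<and> (fst (\<zeta> k), snd p) \<notin> N'"
      unfolding AE_all_countable
    proof
      fix k show "AE p in \<pi>. gen (\<zeta> k) \<longrightarrow> (fst p, snd (\<zeta> k)) \<notin> N' \<and> (fst (\<zeta> k), snd p) \<notin> N'"
      proof (cases "gen (\<zeta> k)")
        case True
        then show ?thesis
          using AE_fst[of "\<lambda>x. (x, snd (\<zeta> k)) \<notin> N'"] AE_snd[of "\<lambda>y. (fst (\<zeta> k), y) \<notin> N'"]
          by (auto simp: gen_def)
      qed simp
    qed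
    with AE_gen show ?thesis
    proof eventually_elim
      case (elim p)
      have "a p < \<infinity>" "b p < \<infinity>"
        unfolding a_def b_def using elim \<zeta>[OF elim(1)] \<kappa>[OF elim(1)] finite_cell by blast+
      then obtain m1 m2 :: nat where m: "a p < of_nat m1" "b p < of_nat m2"
        using ennreal_Ex_less_of_nat by (metis infinity_ennreal_def)
      define M where "M = max (\<kappa> p) (max m1 m2)"
      have "(of_nat m1 :: ennreal) \<le> of_nat M" "(of_nat m2 :: ennreal) \<le> of_nat M"
        by (auto simp: M_def)
      then have "p \<in> G M"
        using m unfolding G_def by (auto simp: M_def intro: order.trans less_imp_le)
      then show ?case by blast
    qed
  qed
  \<comment> \<open>Summing all connection costs with indices up to \<open>M\<close> dominates the
    one that occurs; the two summands \<open>of_nat M\<close> pay for leaving the last and for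
    entering the first point.\<close>
  define B where "B M = of_nat M + (\<Sum>k\<le>M. \<Sum>l\<le>M. H k l) + of_nat M" for M :: nat

  have "(\<integral>\<^sup>+p. c p \<partial>\<pi>) \<le> transport_cost c \<pi>'"
  proof (rule stationary_comparison[where P = P and z = z and G = G and R = B
        and g = "\<lambda>i w. c (x i w, y (Suc i) w)"])
    show "prob_space P" "prob_space \<pi>" by fact+
    show "z i \<in> P \<rightarrow>\<^sub>M \<pi>" for i using zm by (simp add: measurable_cong_sets[OF refl D(2)])
    show "distr P \<pi> (z i) = \<pi>" for i
      using z_law[of i] distr_cong[OF refl D(2), of P "z i" "z i"] by simp
    show "c \<in> borel_measurable \<pi>" by fact
    show "(\<integral>\<^sup>+p. c p \<partial>\<pi>) < \<infinity>" using cost by (simp add: transport_cost_def)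
    show "(\<lambda>w. c (x i w, y (Suc i) w)) \<in> borel_measurable P" for i
      by (rule measurable_compose[OF sm c])
    show "(\<integral>\<^sup>+w. c (x i w, y (Suc i) w) \<partial>P) = transport_cost c \<pi>'" for i
      unfolding transport_cost_def law'[of i, symmetric]
      by (rule nn_integral_distr[OF sm, symmetric]) (simp add: c)
    show "G M \<in> sets \<pi>" for M using G_sets by (simp add: D(2))
    show "incseq G"
    proof (rule incseq_SucI)
      fix M
      have "(of_nat M :: ennreal) \<le> of_nat (Suc M)" by (simp del: of_nat_Suc)
      then show "G M \<le> G (Suc M)" unfolding G_def by (auto intro: order.trans simp del: of_nat_Suc)
    qed
    show "AE p in \<pi>. p \<in> (\<Union>M. G M)" by fact
    show "B M < \<infinity>" for M
      unfolding B_def using H_fin by (auto simp: less_top[symmetric])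
    fix n M
    show "AE w in P. z 0 w \<in> G M \<and> z n w \<in> G M \<longrightarrow>
        (\<Sum>i<n. c (z i w)) \<le> (\<Sum>i<n. c (x i w, y (Suc i) w)) + B M"
      using AE_back AE_zgen
    proof eventually_elim
      case (elim w)
      show ?case
      proof
        assume GM: "z 0 w \<in> G M \<and> z n w \<in> G M"
        let ?k = "\<kappa> (z n w)" and ?l = "\<kappa> (z 0 w)"
        have g: "gen (z n w)" "gen (z 0 w)" using elim(2) by auto
        have "step\<^sup>*\<^sup>* (\<zeta> ?k) (\<zeta> ?l)"
          using same_cell[OF \<zeta>[OF g(1)] g(1) \<kappa>[OF g(1)]] elim(1) same_cell[OF g(2) \<kappa>[OF g(2)] \<zeta>[OF g(2)]]
          by (meson rtranclp_trans)
        then have "(\<Sum>i<n. c (z i w)) \<le> (\<Sum>i<n. c (fst (z i w), snd (z (Suc i) w)))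
            + (c (fst (z n w), snd (\<zeta> ?k)) + H ?k ?l + c (fst (\<zeta> ?l), snd (z 0 w)))"
          using H_bound[of ?k ?l n "\<lambda>i. z i w"] \<zeta>(1)[OF g(1)] elim(2) gen_\<Gamma> by blast
        also have "\<dots> \<le> (\<Sum>i<n. c (x i w, y (Suc i) w)) + B M"
        proof (rule add_mono)
          have "H ?k ?l \<le> (\<Sum>l\<le>M. H ?k l)"
            using GM by (intro member_le_sum) (auto simp: G_def)
          also have "\<dots> \<le> (\<Sum>k\<le>M. \<Sum>l\<le>M. H k l)"
            using GM by (intro member_le_sum) (auto simp: G_def)
          finally show "c (fst (z n w), snd (\<zeta> ?k)) + H ?k ?l + c (fst (\<zeta> ?l), snd (z 0 w)) \<le> B M"
            unfolding B_def using GM by (intro add_mono) (auto simp: G_def a_def b_def)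
        qed (simp add: z_def)
        finally show "(\<Sum>i<n. c (z i w)) \<le> (\<Sum>i<n. c (x i w, y (Suc i) w)) + B M" .
      qed
    qed
  qed
  then show ?thesis by (simp add: transport_cost_def)
qed

theorem theorem1:
  fixes \<mu> :: "'a::polish_space measure"
    and \<nu> :: "'b::polish_space measure"
    and c :: "'a \<times> 'b \<Rightarrow> ennreal"
  assumes "prob_space \<mu>" and "sets \<mu> = sets borel"
    and "prob_space \<nu>" and "sets \<nu> = sets borel"
    and "c \<in> borel_measurable borel"
  shows "(\<forall>\<pi>. finite_plan \<mu> \<nu> c \<pi> \<and> optimal_plan \<mu> \<nu> c \<pi> \<longrightarrow> c_monotone_plan \<mu> \<nu> c \<pi>) \<and>
    ((\<exists>F N. closed F \<and> N \<in> null_sets (completion (\<mu> \<Otimes>\<^sub>M \<nu>)) \<and> {z. c z = \<infinity>} = F \<union> N) \<longrightarrow>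
      (\<forall>\<pi>. finite_plan \<mu> \<nu> c \<pi> \<and> c_monotone_plan \<mu> \<nu> c \<pi> \<longrightarrow> optimal_plan \<mu> \<nu> c \<pi>))"
proof (intro conjI impI allI)
  fix \<pi> assume "finite_plan \<mu> \<nu> c \<pi> \<and> optimal_plan \<mu> \<nu> c \<pi>"
  then show "c_monotone_plan \<mu> \<nu> c \<pi>"
    using optimal_imp_c_monotone[OF assms(5)] by blast
next
  fix \<pi>
  assume "\<exists>F N. closed F \<and> N \<in> null_sets (completion (\<mu> \<Otimes>\<^sub>M \<nu>)) \<and> {z. c z = \<infinity>} = F \<union> N"
    and *: "finite_plan \<mu> \<nu> c \<pi> \<and> c_monotone_plan \<mu> \<nu> c \<pi>"
  then obtain F N where FN: "closed F" "N \<in> null_sets (completion (\<mu> \<Otimes>\<^sub>M \<nu>))" "{z. c z = \<infinity>} = F \<union> N"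
    by blast
  have plan: "\<pi> \<in> transport_plans \<mu> \<nu>" "transport_cost c \<pi> < \<infinity>"
    using * by (auto simp: finite_plan_def)
  obtain \<Gamma> where \<Gamma>: "c_monotone_set c \<Gamma>" "emeasure \<pi> \<Gamma> = 1"
    using * by (auto simp: c_monotone_plan_def)
  have "transport_cost c \<pi> \<le> transport_cost c \<pi>'" if "\<pi>' \<in> transport_plans \<mu> \<nu>" for \<pi>'
  proof (cases "transport_cost c \<pi>' < \<infinity>")
    case True
    then show ?thesis
      by (rule c_monotone_imp_cost_le[OF assms FN plan \<Gamma> that])
  next
    case False
    then show ?thesis by (simp add: less_top[symmetric])
  qed
  then show "optimal_plan \<mu> \<nu> c \<pi>"
    using plan(1) by (simp add: optimal_plan_def)
qed

end
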